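(* Assume that $f_{ij}$ is convex and $L$-smooth for all $i=1,\dots,n$, $j=1,\dots,m$ and that $f$ is $\mu$-quasi strongly convex, $\mu\ge0$. Consider EC-LSVRG-DIANA with $p\in(0,1)$, $0<\alpha\le\frac1{\omega+1}$ and $$0<\gamma\le\min\left\{\frac{9}{296L},\ \frac{\delta}{4L\sqrt{6\left(4+3\delta+\frac{2}{1-\alpha}\left(3+\frac4{1-p}\right)(4+3\delta)+\frac{6\delta}{1-p}\right)}}\right\}.$$ Then EC-LSVRG-DIANA satisfies the parametric assumption of the context with $A=A'=2L$, $\widetilde A=3L$, $B_1'=B_2=0$, $B_1=B_2'=2$, $\widetilde B_1=\widetilde B_2=3$, $D_1=\widetilde D_1=D_1'=D_2=D_3=0$, $\rho_1=\alpha$, $\rho_2=p$, $C_1=3L\alpha$, $C_2=Lp$, $G=2$, $$\sigma_{1,k}^2=\frac1n\sum_{i=1}^n\|h_i^k-\nabla f_i(x^* )\|^2,\qquad \sigma_{2,k}^2=\frac1{nm}\sum_{i=1}^n\sum_{j=1}^m\|\nabla f_{ij}(w_i^k)-\nabla f_{ij}(x^* )\|^2,$$ $$F_1=\frac{24L\gamma^2\left(\frac4\delta+3\right)}{\delta\alpha\left(1-\min\{\frac{\gamma\mu}2,\frac\alpha4,\frac p4\}\right)},\qquad F_2=\frac{24L\gamma^2\left(\frac4{1-\alpha}\left(\frac4\delta+3\right)+3\right)}{\delta p\left(1-\min\{\frac{\gamma\mu}2,\frac\alpha4,\frac p4\}\right)}.$$ Moreover, with $M_1=0$, $M_2=\frac{8}{3p}+\frac{32}{9p}$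 and $T^0=\|x^0-x^*\|^2+M_2\gamma^2\sigma_{2,0}^2$, for all $K\ge0$ $$\mathbf E[f(\bar x^K)-f(x^* )]\le\left(1-\min\left\{\frac{\gamma\mu}2,\frac\alpha4,\frac p4\right\}\right)^K\frac{4(T^0+\gamma F_1\sigma_{1,0}^2+\gamma F_2\sigma_{2,0}^2)}{\gamma}$$ when $\mu>0$, and $$\mathbf E[f(\bar x^K)-f(x^* )]\le\frac{4(T^0+\gamma F_1\sigma_{1,0}^2+\gamma F_2\sigma_{2,0}^2)}{K\gamma}$$ when $\mu=0$ (right-hand side read as $+\infty$ for $K=0$).
   Context: $f(x)=\frac1n\sum_{i=1}^nf_i(x)$, $f_i(x)=\frac1m\sum_{j=1}^mf_{ij}(x)$ on $\mathbb R^d$. A function is $L$-smooth if it is differentiable with $L$-Lipschitz gradient. $f$ is $\mu$-quasi strongly convex if it has a unique minimizer $x^*$ and $f(x^* )\ge f(x)+\langle\nabla f(x),x^*-x\rangle+\frac\mu2\|x-x^*\|^2$ for all $x$. Operators: $\mathcal C$ is a (possibly randomized) compression operator with $\mathbf E\|\mathcal C(x)-x\|^2\le(1-\delta)\|x\|^2$ for all $x\in\mathbb R^d$, $\delta\in(0,1]$; $Q$ is a randomized quantization operator with $\mathbf E[Q(x)]=x$, $\mathbf E\|Q(x)-x\|^2\le\omega\|x\|^2$ for all $x$, $\omega>0$. All random choices (indices, coin flips, applications of $\mathcal C$, $Q$) are made with fresh independent randomness. EC-LSVRG-DIANA: given deterministic $x^0$, $h_i^0$, $w_i^0\in\mathbb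 R^d$, $e_i^0=0$. At iteration $k\ge 0$, each worker $i$ picks $l$ uniformly from $\{1,\dots,m\}$ and sets $\hat g_i^k=\nabla f_{il}(x^k)-\nabla f_{il}(w_i^k)+\nabla f_i(w_i^k)$, $g_i^k=\hat g_i^k-h_i^k+h^k$ with $h^k=\frac1n\sum_ih_i^k$, $v_i^k=\mathcal C(e_i^k+\gamma g_i^k)$, $e_i^{k+1}=e_i^k+\gamma g_i^k-v_i^k$, $h_i^{k+1}=h_i^k+\alpha Q(\hat g_i^k-h_i^k)$, and $w_i^{k+1}=x^k$ with probability $p$, $w_i^{k+1}=w_i^k$ with probability $1-p$. Then $x^{k+1}=x^k-\frac1n\sum_iv_i^k$. Parametric assumption: let $g^k=\frac1n\sum_ig_i^k$, $e^k=\frac1n\sum_ie_i^k$, $\mathbf E_k$ the conditional expectation given all randomness generated before iteration $k$, $\bar g_i^k=\mathbf E_k[g_i^k]$. For all $k,K\ge0$: $\mathbf E_k[g^k]=\nabla f(x^k)$; $\frac1n\sum_i\|\bar g_i^k\|^2\le2A(f(x^k)-f(x^* ))+B_1\sigma_{1,k}^2+B_2\sigma_{2,k}^2+D_1$; $\frac1n\sum_i\mathbf E_k\|g_i^k-\bar g_i^k\|^2\le2\widetilde A(f(x^k)-f(x^* ))+\widetilde B_1\sigma_{1,k}^2+\widetilde B_2\sigma_{2,k}^2+\widetilde D_1$; $\mathbf E_k\|g^k\|^2\le2A'(f(x^k)-f(x^* ))+B_1'\sigma_{1,k}^2+B_2'\sigma_{2,k}^2+D_1'$; $\mathbf E_k[\sigma_{1,k+1}^2]\le(1-\rho_1)\sigma_{1,k}^2+2C_1(f(x^k)-f(x^*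 ))+G\rho_1\sigma_{2,k}^2+D_2$; $\mathbf E_k[\sigma_{2,k+1}^2]\le(1-\rho_2)\sigma_{2,k}^2+2C_2(f(x^k)-f(x^* ))$; $3L\sum_{k=0}^Kw_k\mathbf E\|e^k\|^2\le\frac14\sum_{k=0}^Kw_k\mathbf E[f(x^k)-f(x^* )]+F_1\sigma_{1,0}^2+F_2\sigma_{2,0}^2+\gamma D_3W_K$, where (scalar weights) $w_k=(1-\eta)^{-(k+1)}$, $W_K=\sum_{k=0}^Kw_k$, $\eta=\min\{\frac{\gamma\mu}2,\frac{\rho_1}4,\frac{\rho_2}4\}$. Also $\bar x^K=\frac1{W_K}\sum_{k=0}^Kw_kx^k$. *)

theory Defs
  imports "HOL-Probability.Probability"
begin

section \<open>Finite-sum objective\<close>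

definition avg :: "nat \<Rightarrow> (nat \<Rightarrow> 'a::real_vector) \<Rightarrow> 'a" where
  "avg n a = (1 / real n) *\<^sub>R (\<Sum>i=1..n. a i)"

definition worker_obj :: "nat \<Rightarrow> (nat \<Rightarrow> nat \<Rightarrow> 'a \<Rightarrow> real) \<Rightarrow> nat \<Rightarrow> 'a \<Rightarrow> real" where
  "worker_obj m fs i x = avg m (\<lambda>j. fs i j x)"

definition objective :: "nat \<Rightarrow> nat \<Rightarrow> (nat \<Rightarrow> nat \<Rightarrow> 'a \<Rightarrow> real) \<Rightarrow> 'a \<Rightarrow> real" where
  "objective n m fs x = avg n (\<lambda>i. worker_obj m fs i x)"

text \<open>Only meaningful where the function is differentiable.\<close>

definition grad :: "('a::real_inner \<Rightarrow> real) \<Rightarrow> 'a \<Rightarrow> 'a" where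
  "grad F x = (THE D. GDERIV F x :> D)"

definition smooth :: "real \<Rightarrow> ('a::real_inner \<Rightarrow> real) \<Rightarrow> bool" where
  "smooth L F \<longleftrightarrow> (\<forall>x. \<exists>D. GDERIV F x :> D) \<and> L-lipschitz_on UNIV (grad F)"

definition quasi_strongly_convex :: "real \<Rightarrow> ('a::real_inner \<Rightarrow> real) \<Rightarrow> bool" where
  "quasi_strongly_convex \<mu> F \<longleftrightarrow>
     (\<exists>!z. is_arg_min F (\<lambda>_. True) z) \<and>
     (\<forall>z. is_arg_min F (\<lambda>_. True) z \<longrightarrow>
        (\<forall>x. F z \<ge> F x + inner (grad F x) (z - x) + \<mu> / 2 * (norm (x - z))\<^sup>2))"

section \<open>Randomized operators\<close>

text \<open>
  A randomized operator is a jointly measurable map taking, besides its argument, a random seed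
  drawn from a probability space; an application with fresh randomness uses a fresh seed.
  A deterministic operator is one that ignores its seed.
\<close>

definition randomized_operator ::
    "'s measure \<Rightarrow> ('s \<Rightarrow> 'a::euclidean_space \<Rightarrow> 'a) \<Rightarrow> bool" where
  "randomized_operator S R \<longleftrightarrow>
     prob_space S \<and> (\<lambda>(s, x). R s x) \<in> borel_measurable (S \<Otimes>\<^sub>M borel)"

definition compression_operator ::
    "real \<Rightarrow> 's measure \<Rightarrow> ('s \<Rightarrow> 'a::euclidean_space \<Rightarrow> 'a) \<Rightarrow> bool" where
  "compression_operator \<delta> S C \<longleftrightarrow>
     randomized_operator S C \<and>
     (\<forall>x. integrable S (\<lambda>s. (norm (C s x - x))\<^sup>2) \<and>
          (\<integral>s. (norm (C s x - x))\<^sup>2 \<partial>S) \<le> (1 - \<delta>) * (norm x)\<^sup>2)"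

definition quantization_operator ::
    "real \<Rightarrow> 's measure \<Rightarrow> ('s \<Rightarrow> 'a::euclidean_space \<Rightarrow> 'a) \<Rightarrow> bool" where
  "quantization_operator \<omega> S Q \<longleftrightarrow>
     randomized_operator S Q \<and>
     (\<forall>x. integrable S (\<lambda>s. Q s x) \<and> (\<integral>s. Q s x \<partial>S) = x \<and>
          integrable S (\<lambda>s. (norm (Q s x - x))\<^sup>2) \<and>
          (\<integral>s. (norm (Q s x - x))\<^sup>2 \<partial>S) \<le> \<omega> * (norm x)\<^sup>2)"

text \<open>
  The law of everything one worker draws in one iteration: a uniform index, a coin showing True
  with probability p, a seed for the compression and a seed for the quantization, independent.
\<close>

definition draw_law ::
    "nat \<Rightarrow> real \<Rightarrow> 'c measure \<Rightarrow> 'q measure \<Rightarrow> (nat \<times> bool \<times> 'c \<times> 'q) measure" where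
  "draw_law m p CS QS =
     measure_pmf (pmf_of_set {1..m}) \<Otimes>\<^sub>M measure_pmf (bernoulli_pmf p) \<Otimes>\<^sub>M CS \<Otimes>\<^sub>M QS"

text \<open>The sigma-algebra generated by all draws made before iteration k.\<close>

definition history ::
    "'o measure \<Rightarrow> 'z measure \<Rightarrow> nat \<Rightarrow> (nat \<Rightarrow> nat \<Rightarrow> 'o \<Rightarrow> 'z) \<Rightarrow> nat \<Rightarrow> 'o measure" where
  "history M N n Z k =
     vimage_algebra (space M)
       (\<lambda>s. \<lambda>(t, i)\<in>{..<k} \<times> {1..n}. Z t i s)
       (\<Pi>\<^sub>M _\<in>{..<k} \<times> {1..n}. N)"

definition vec_cond_exp ::
    "'o measure \<Rightarrow> 'o measure \<Rightarrow> ('o \<Rightarrow> real ^ 'd) \<Rightarrow> 'o \<Rightarrow> real ^ 'd" where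
  "vec_cond_exp M F X s = (\<chi> c. real_cond_exp M F (\<lambda>s. X s $ c) s)"

section \<open>The parametric assumption\<close>

definition weight :: "real \<Rightarrow> nat \<Rightarrow> real" where
  "weight \<eta> k = 1 / (1 - \<eta>) ^ (k + 1)"

definition weight_sum :: "real \<Rightarrow> nat \<Rightarrow> real" where
  "weight_sum \<eta> K = (\<Sum>k=0..K. weight \<eta> k)"

text \<open>
  The suffix t marks the constants carrying a tilde.
\<close>

record parametric_constants =
  cA :: real    cB1 :: real    cB2 :: real    cD1 :: real
  cAt :: real   cB1t :: real   cB2t :: real   cD1t :: real
  cA' :: real   cB1' :: real   cB2' :: real   cD1' :: real
  c\<rho>1 :: real   cC1 :: real    cG :: real     cD2 :: real
  c\<rho>2 :: real   cC2 :: real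
  cF1 :: real   cF2 :: real    cD3 :: real

text \<open>
  E k is the sigma-algebra with respect to which the k-th conditional expectation is taken, and
  S1 k, S2 k are the (already squared) quantities written as squared sigmas on paper.  Integrability
  is required throughout, since Isabelle's expectations are total functions with arbitrary values
  on non-integrable arguments.  Statements about conditional expectations hold almost everywhere.
\<close>

definition parametric_assumption ::
   "'o measure \<Rightarrow> (nat \<Rightarrow> 'o measure) \<Rightarrow> nat \<Rightarrow> (real ^ 'd \<Rightarrow> real) \<Rightarrow> real ^ 'd \<Rightarrow>
    real \<Rightarrow> real \<Rightarrow> real \<Rightarrow>
    (nat \<Rightarrow> 'o \<Rightarrow> real ^ 'd) \<Rightarrow> (nat \<Rightarrow> nat \<Rightarrow> 'o \<Rightarrow> real ^ 'd) \<Rightarrow> (nat \<Rightarrow> nat \<Rightarrow> 'o \<Rightarrow> real ^ 'd) \<Rightarrow>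
    (nat \<Rightarrow> 'o \<Rightarrow> real) \<Rightarrow> (nat \<Rightarrow> 'o \<Rightarrow> real) \<Rightarrow> parametric_constants \<Rightarrow> bool" where
  "parametric_assumption M E n f xstar L \<mu> \<gamma> x gi ei S1 S2 c \<longleftrightarrow>
    (let g = (\<lambda>k s. avg n (\<lambda>i. gi k i s));
         e = (\<lambda>k s. avg n (\<lambda>i. ei k i s));
         gbar = (\<lambda>k i. vec_cond_exp M (E k) (gi k i));
         \<eta> = min (\<gamma> * \<mu> / 2) (min (c\<rho>1 c / 4) (c\<rho>2 c / 4))
     in
      (\<forall>k. (\<forall>i\<in>{1..n}. integrable M (gi k i) \<and>
                        integrable M (\<lambda>s. (norm (gi k i s - gbar k i s))\<^sup>2)) \<and>
           integrable M (\<lambda>s. (norm (g k s))\<^sup>2) \<and>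
           integrable M (\<lambda>s. (norm (e k s))\<^sup>2) \<and>
           integrable M (\<lambda>s. f (x k s)) \<and>
           integrable M (S1 k) \<and> integrable M (S2 k)) \<and>
      (\<forall>k. AE s in M. vec_cond_exp M (E k) (g k) s = grad f (x k s)) \<and>
      (\<forall>k. AE s in M.
         avg n (\<lambda>i. (norm (gbar k i s))\<^sup>2)
           \<le> 2 * cA c * (f (x k s) - f xstar) + cB1 c * S1 k s + cB2 c * S2 k s + cD1 c) \<and>
      (\<forall>k. AE s in M.
         avg n (\<lambda>i. real_cond_exp M (E k) (\<lambda>s. (norm (gi k i s - gbar k i s))\<^sup>2) s)
           \<le> 2 * cAt c * (f (x k s) - f xstar) + cB1t c * S1 k s + cB2t c * S2 k s + cD1t c) \<and>
      (\<forall>k. AE s in M.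
         real_cond_exp M (E k) (\<lambda>s. (norm (g k s))\<^sup>2) s
           \<le> 2 * cA' c * (f (x k s) - f xstar) + cB1' c * S1 k s + cB2' c * S2 k s + cD1' c) \<and>
      (\<forall>k. AE s in M.
         real_cond_exp M (E k) (S1 (Suc k)) s
           \<le> (1 - c\<rho>1 c) * S1 k s + 2 * cC1 c * (f (x k s) - f xstar)
              + cG c * c\<rho>1 c * S2 k s + cD2 c) \<and>
      (\<forall>k. AE s in M.
         real_cond_exp M (E k) (S2 (Suc k)) s
           \<le> (1 - c\<rho>2 c) * S2 k s + 2 * cC2 c * (f (x k s) - f xstar)) \<and>
      (\<forall>K. AE s in M.
         3 * L * (\<Sum>k=0..K. weight \<eta> k * (\<integral>s'. (norm (e k s'))\<^sup>2 \<partial>M))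
           \<le> 1 / 4 * (\<Sum>k=0..K. weight \<eta> k * (\<integral>s'. (f (x k s') - f xstar) \<partial>M))
              + cF1 c * S1 0 s + cF2 c * S2 0 s + \<gamma> * cD3 c * weight_sum \<eta> K))"

definition sigma1_sq ::
    "nat \<Rightarrow> nat \<Rightarrow> (nat \<Rightarrow> nat \<Rightarrow> 'a::real_inner \<Rightarrow> real) \<Rightarrow> 'a \<Rightarrow> (nat \<Rightarrow> 'a) \<Rightarrow> real" where
  "sigma1_sq n m fs xstar h = avg n (\<lambda>i. (norm (h i - grad (worker_obj m fs i) xstar))\<^sup>2)"

definition sigma2_sq ::
    "nat \<Rightarrow> nat \<Rightarrow> (nat \<Rightarrow> nat \<Rightarrow> 'a::real_inner \<Rightarrow> real) \<Rightarrow> 'a \<Rightarrow> (nat \<Rightarrow> 'a) \<Rightarrow> real" where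
  "sigma2_sq n m fs xstar w =
     1 / (real n * real m) *
     (\<Sum>i=1..n. \<Sum>j=1..m. (norm (grad (fs i j) (w i) - grad (fs i j) xstar))\<^sup>2)"

end

theory Submission
  imports Defs
begin

text \<open>
  The compression errors are harmless for the virtual iterate \<open>x - avg e\<close>: it moves by an
  uncompressed step \<open>- \<gamma> g\<close>, whose conditional mean is the gradient of \<open>f\<close>.  Quasi strong
  convexity therefore contracts the expected squared distance of the virtual iterate to the
  minimizer, up to two disturbances: the second moment of \<open>g\<close> and the distance \<open>avg e\<close> between the
  true and the virtual iterate (\<open>expected_virtual\<close>).

  The second moment of \<open>g\<close> consists of a function gap and of \<open>\<sigma>\<^sub>2\<^sup>2\<close>, the staleness of the LSVRG
  anchors \<open>w\<close>.  Since an anchor jumps to \<open>x\<close> with probability \<open>p\<close>, \<open>\<sigma>\<^sub>2\<^sup>2\<close> contracts up to a multiple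
  of the gap, so that it can be absorbed in a Lyapunov function (\<open>lyapunov_step\<close>).  The error
  \<open>avg e\<close> contracts because \<open>C\<close> is a contraction in mean square; it is fed by the size of the
  directions, that is, by the gap, by \<open>\<sigma>\<^sub>2\<^sup>2\<close> and by \<open>\<sigma>\<^sub>1\<^sup>2\<close>, the distance of the learned shifts \<open>h\<close>
  to the worker gradients at the minimizer.  The DIANA update contracts \<open>\<sigma>\<^sub>1\<^sup>2\<close>, again up to the gap
  and \<open>\<sigma>\<^sub>2\<^sup>2\<close>.  These are the lemmas \<open>cond_err\<close>, \<open>cond_S1\<close> and \<open>cond_S2\<close>.

  All these recursions are summed with the weights \<open>1 / (1 - \<eta>) ^ (k + 1)\<close>, which are so flat that every
  contraction survives (\<open>weighted_contraction\<close>).  For small step sizes the accumulated error is then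
  at most a quarter of the accumulated gap plus the initial terms (\<open>compensation_error\<close>), and the
  Lyapunov recursion bounds the accumulated gap (\<open>total_gap\<close>).  Jensen's inequality carries the
  bound over to the weighted average of the iterates.

  Two inputs make the one-step bounds work.  On the analytic side, co-coercivity of the gradients of
  smooth convex functions turns differences of gradients at \<open>x\<close> and at the minimizer into function
  gaps.  On the probabilistic side, the draws of one worker in iteration \<open>k\<close> are independent of the
  history, so conditional expectations are integrals over a fresh draw with the past frozen
  (\<open>freezing_cond_exp\<close>).  Averages over workers are handled by convexity, one worker at a time.
\<close>

section \<open>Averages\<close>

lemma avg_cong: "(\<And>i. i \<in> {1..n} \<Longrightarrow> a i = b i) \<Longrightarrow> avg n a = avg n b"
  unfolding avg_def by (intro arg_cong[where f="\<lambda>z. (1 / real n) *\<^sub>R z"] sum.cong) auto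

lemma avg_add: "avg n (\<lambda>i. a i + b i) = avg n a + avg n b"
  by (simp add: avg_def sum.distrib scaleR_right_distrib)

lemma avg_diff: "avg n (\<lambda>i. a i - b i) = avg n a - avg n b"
  by (simp add: avg_def sum_subtractf scaleR_right_diff_distrib)

lemma avg_scaleR: "avg n (\<lambda>i. c *\<^sub>R a i) = c *\<^sub>R avg n a"
  by (simp add: avg_def scaleR_sum_right mult.commute)

lemma avg_mult: "avg n (\<lambda>i. c * a i) = c * avg n a" for c :: real
  using avg_scaleR[of n c a] by simp

lemma avg_const: "n \<ge> 1 \<Longrightarrow> avg n (\<lambda>_. c) = c"
  by (simp add: avg_def scaleR_conv_of_real[symmetric] sum_constant_scaleR)

lemma inner_avg_left: "inner (avg n a) c = avg n (\<lambda>i. inner (a i) c)"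
  by (simp add: avg_def inner_sum_left)

lemma inner_avg_right: "inner c (avg n a) = avg n (\<lambda>i. inner c (a i))"
  by (simp add: avg_def inner_sum_right)

lemma avg_mono: "(\<And>i. i \<in> {1..n} \<Longrightarrow> a i \<le> b i) \<Longrightarrow> avg n a \<le> avg n b" for a b :: "nat \<Rightarrow> real"
  by (auto simp: avg_def intro!: divide_right_mono sum_mono)

lemma avg_nonneg: "(\<And>i. i \<in> {1..n} \<Longrightarrow> 0 \<le> a i) \<Longrightarrow> 0 \<le> avg n a" for a :: "nat \<Rightarrow> real"
  by (auto simp: avg_def intro!: divide_nonneg_nonneg sum_nonneg)

lemma norm_diff_sq: "(norm (a - b))\<^sup>2 = (norm a)\<^sup>2 - 2 * inner a b + (norm b)\<^sup>2"
  for a b :: "'a::real_inner"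
  by (simp add: power2_norm_eq_inner inner_diff_left inner_diff_right inner_commute)

lemma norm_add_sq: "(norm (a + b))\<^sup>2 = (norm a)\<^sup>2 + 2 * inner a b + (norm b)\<^sup>2"
  for a b :: "'a::real_inner"
  by (simp add: power2_norm_eq_inner inner_add_left inner_add_right inner_commute)

lemma avg_norm_sq_shift:
  fixes a :: "nat \<Rightarrow> 'a::real_inner"
  assumes "n \<ge> 1"
  shows "avg n (\<lambda>i. (norm (a i - c))\<^sup>2)
    = avg n (\<lambda>i. (norm (a i))\<^sup>2) - 2 * inner (avg n a) c + (norm c)\<^sup>2"
  using assms by (simp add: norm_diff_sq avg_add avg_diff avg_const avg_mult inner_avg_left)

text \<open>The two sides differ by the squared distance between \<open>c\<close> and the average.\<close>

lemma avg_variance_le: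
  fixes a :: "nat \<Rightarrow> 'a::real_inner"
  assumes "n \<ge> 1"
  shows "avg n (\<lambda>i. (norm (a i - avg n a))\<^sup>2) \<le> avg n (\<lambda>i. (norm (a i - c))\<^sup>2)"
proof -
  have "0 \<le> (norm (avg n a - c))\<^sup>2" by simp
  then show ?thesis
    unfolding avg_norm_sq_shift[OF assms] norm_diff_sq[of "avg n a" c]
    by (simp add: power2_norm_eq_inner)
qed

lemma norm_avg_sq_le:
  fixes a :: "nat \<Rightarrow> 'a::real_inner"
  assumes "n \<ge> 1"
  shows "(norm (avg n a))\<^sup>2 \<le> avg n (\<lambda>i. (norm (a i))\<^sup>2)"
proof -
  have "0 \<le> avg n (\<lambda>i. (norm (a i - avg n a))\<^sup>2)" by (rule avg_nonneg) simp
  then show ?thesis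
    unfolding avg_norm_sq_shift[OF assms] by (simp add: power2_norm_eq_inner)
qed

text \<open>Expanding the square of \<open>c a - b\<close> trades the cross term for squares; \<open>c\<close> decides how little
  is paid for \<open>a\<close>.\<close>

lemma young:
  fixes a b :: "'a::real_inner"
  assumes "c > 0"
  shows "(norm (a + b))\<^sup>2 \<le> (1 + c) * (norm a)\<^sup>2 + (1 + 1 / c) * (norm b)\<^sup>2"
proof -
  have "0 \<le> (1/c) * (norm (c *\<^sub>R a - b))\<^sup>2" using assms by simp
  also have "\<dots> = c * (norm a)\<^sup>2 - 2 * inner a b + (1/c) * (norm b)\<^sup>2"
    unfolding norm_diff_sq using assms by (simp add: field_simps power2_eq_square)
  finally show ?thesis unfolding norm_add_sq by (simp add: algebra_simps)
qed

lemma norm_add_sq_le: "(norm (a + b))\<^sup>2 \<le> 2 * (norm a)\<^sup>2 + 2 * (norm b)\<^sup>2"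
  for a b :: "'a::real_inner"
  using young[of 1 a b] by simp

lemma norm_diff_sq_le: "(norm (a - b))\<^sup>2 \<le> 2 * (norm a)\<^sup>2 + 2 * (norm b)\<^sup>2"
  for a b :: "'a::real_inner"
  using norm_add_sq_le[of a "- b"] by simp

section \<open>Smooth convex functions\<close>

lemma grad_eqI:
  assumes "GDERIV F x :> D"
  shows "grad F x = D"
  unfolding grad_def
proof (rule the_equality)
  show "GDERIV F x :> D" by fact
next
  fix D' assume "GDERIV F x :> D'"
  then have "(\<lambda>h. inner h D') = (\<lambda>h. inner h D)"
    using assms unfolding gderiv_def by (metis has_derivative_unique)
  then have "inner (D' - D) D' = inner (D' - D) D" by meson
  then have "inner (D' - D) (D' - D) = 0" by (simp add: inner_diff_right)
  then show "D' = D" by simp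
qed

lemma smooth_GDERIV: "smooth L F \<Longrightarrow> GDERIV F x :> grad F x"
  unfolding smooth_def using grad_eqI by metis

lemma smooth_lipschitz: "smooth L F \<Longrightarrow> norm (grad F x - grad F y) \<le> L * norm (x - y)"
  unfolding smooth_def lipschitz_on_def dist_norm by auto

lemma GDERIV_avg:
  assumes "\<And>i. i \<in> {1..n} \<Longrightarrow> GDERIV (F i) x :> D i"
  shows "GDERIV (\<lambda>y. avg n (\<lambda>i. F i y)) x :> avg n D"
proof -
  have "((\<lambda>y. avg n (\<lambda>i. F i y)) has_derivative (\<lambda>h. avg n (\<lambda>i. inner h (D i)))) (at x)"
    unfolding avg_def
    by (intro has_derivative_scaleR_right has_derivative_sum)
       (use assms in \<open>auto simp: gderiv_def\<close>)
  then show ?thesis unfolding gderiv_def inner_avg_right .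
qed

lemma smooth_avg:
  assumes "n \<ge> 1" and "\<And>i. i \<in> {1..n} \<Longrightarrow> smooth L (F i)"
  shows "smooth L (\<lambda>y. avg n (\<lambda>i. F i y))"
    and "grad (\<lambda>y. avg n (\<lambda>i. F i y)) x = avg n (\<lambda>i. grad (F i) x)"
proof -
  have D: "GDERIV (\<lambda>y. avg n (\<lambda>i. F i y)) x :> avg n (\<lambda>i. grad (F i) x)" for x
    using assms(2) by (intro GDERIV_avg smooth_GDERIV)
  show g: "grad (\<lambda>y. avg n (\<lambda>i. F i y)) x = avg n (\<lambda>i. grad (F i) x)" for x
    by (rule grad_eqI[OF D])
  have L: "L \<ge> 0" using assms unfolding smooth_def lipschitz_on_def by force
  have "norm (avg n (\<lambda>i. grad (F i) x) - avg n (\<lambda>i. grad (F i) y)) \<le> L * norm (x - y)" for x y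
  proof -
    have "norm (avg n (\<lambda>i. grad (F i) x - grad (F i) y))
        \<le> avg n (\<lambda>i. norm (grad (F i) x - grad (F i) y))"
      unfolding avg_def by (auto intro!: divide_right_mono norm_sum)
    also have "\<dots> \<le> avg n (\<lambda>i. L * norm (x - y))"
      by (intro avg_mono smooth_lipschitz assms)
    finally show ?thesis using assms(1) by (simp add: avg_const avg_diff)
  qed
  then show "smooth L (\<lambda>y. avg n (\<lambda>i. F i y))"
    unfolding smooth_def lipschitz_on_def g dist_norm using D L by auto
qed

lemma convex_on_avg:
  assumes "\<And>i. i \<in> {1..n} \<Longrightarrow> convex_on UNIV (F i)"
  shows "convex_on UNIV (\<lambda>y. avg n (\<lambda>i. F i y))"
proof -
  have "convex_on UNIV (\<lambda>y. \<Sum>i\<in>A. F i y)" if "finite A" "A \<subseteq> {1..n}" for A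
    using that
  proof (induction rule: finite_induct)
    case empty
    then show ?case by (simp add: convex_on_const)
  next
    case (insert a A)
    then show ?case using assms by (auto intro!: convex_on_add)
  qed
  from convex_on_cmul[OF _ this[of "{1..n}"], of "1 / real n"] show ?thesis
    by (simp add: avg_def)
qed

lemma line_derivative:
  fixes F :: "'a::real_inner \<Rightarrow> real"
  assumes "GDERIV F (x + t *\<^sub>R d) :> D"
  shows "((\<lambda>t. F (x + t *\<^sub>R d)) has_real_derivative inner d D) (at t)"
proof -
  have "((\<lambda>t. x + t *\<^sub>R d) has_derivative (\<lambda>h. h *\<^sub>R d)) (at t)"
    by (auto intro!: derivative_eq_intros)
  from has_derivative_compose[OF this assms[unfolded gderiv_def]]
  have "((\<lambda>t. F (x + t *\<^sub>R d)) has_derivative (\<lambda>h. inner (h *\<^sub>R d) D)) (at t)" .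
  then show ?thesis
    unfolding has_field_derivative_def by (simp add: mult.commute[of _ "inner d D"])
qed

text \<open>Along the segment from \<open>x\<close> to \<open>y\<close> the difference of the two sides is monotone, because the
  Lipschitz bound controls the growth of the directional derivative.\<close>

lemma smooth_upper_bound:
  fixes F :: "'a::real_inner \<Rightarrow> real"
  assumes "smooth L F"
  shows "F y \<le> F x + inner (grad F x) (y - x) + L / 2 * (norm (y - x))\<^sup>2"
proof -
  define d where "d = y - x"
  define \<phi> where "\<phi> t = F (x + t *\<^sub>R d) - t * inner (grad F x) d - L / 2 * t\<^sup>2 * (norm d)\<^sup>2" for t
  have "\<phi> 1 \<le> \<phi> 0"
  proof (rule DERIV_nonpos_imp_nonincreasing[where f=\<phi>])
    fix t :: real assume t: "0 \<le> t" "t \<le> 1"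
    let ?D = "inner d (grad F (x + t *\<^sub>R d)) - inner (grad F x) d - L * t * (norm d)\<^sup>2"
    have "(\<phi> has_real_derivative ?D) (at t)"
      unfolding \<phi>_def
      by (auto intro!: derivative_eq_intros line_derivative smooth_GDERIV assms)
    moreover have "inner d (grad F (x + t *\<^sub>R d) - grad F x) \<le> norm d * (L * norm (t *\<^sub>R d))"
      using norm_cauchy_schwarz[of d "grad F (x + t *\<^sub>R d) - grad F x"]
        mult_left_mono[OF smooth_lipschitz[OF assms, of "x + t *\<^sub>R d" x], of "norm d"] by simp
    then have "?D \<le> 0"
      using t by (simp add: inner_diff_right inner_commute power2_eq_square algebra_simps)
    ultimately show "\<exists>y. (\<phi> has_real_derivative y) (at t) \<and> y \<le> 0" by blast
  qed simp
  then show ?thesis unfolding \<phi>_def d_def by simp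
qed

lemma convex_gradient_ineq:
  fixes F :: "'a::real_inner \<Rightarrow> real"
  assumes "convex_on UNIV F" and "GDERIV F x :> D"
  shows "F y \<ge> F x + inner D (y - x)"
proof -
  define d where "d = y - x"
  define \<phi> where "\<phi> t = F (x + t *\<^sub>R d)" for t
  have "convex_on UNIV \<phi>"
  proof (rule convex_onI)
    fix t a b :: real assume t: "0 < t" "t < 1"
    have "x + ((1 - t) *\<^sub>R a + t *\<^sub>R b) *\<^sub>R d
        = (1 - t) *\<^sub>R (x + a *\<^sub>R d) + t *\<^sub>R (x + b *\<^sub>R d)"
      by (simp add: algebra_simps)
    then show "\<phi> ((1 - t) *\<^sub>R a + t *\<^sub>R b) \<le> (1 - t) * \<phi> a + t * \<phi> b"
      unfolding \<phi>_def using t convex_onD[OF assms(1)] by simp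
  qed simp
  moreover have "(\<phi> has_real_derivative inner d D) (at 0)"
    unfolding \<phi>_def using assms(2) by (intro line_derivative) simp
  ultimately have "\<phi> 1 - \<phi> 0 \<ge> inner d D * (1 - 0)"
    by (intro convex_on_imp_above_tangent) (auto simp: connected_UNIV)
  then show ?thesis unfolding \<phi>_def d_def by (simp add: inner_commute)
qed

text \<open>Subtracting the linearization at \<open>y\<close> gives a convex function with minimizer \<open>y\<close>.  A gradient step
  from \<open>x\<close> decreases this function by at least the square of its gradient divided by \<open>2 L\<close>, and cannot get
  below the minimum.\<close>

lemma smooth_convex_cocoercive:
  fixes F :: "'a::real_inner \<Rightarrow> real"
  assumes "convex_on UNIV F" and "smooth L F" and "L > 0"
  shows "(norm (grad F x - grad F y))\<^sup>2 \<le> 2 * L * (F x - F y - inner (grad F y) (x - y))"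
proof -
  define D where "D = grad F x - grad F y"
  \<comment> \<open>the gradient step for \<open>F\<close> minus its linearization at \<open>y\<close>\<close>
  define z where "z = x - (1 / L) *\<^sub>R D"
  have lower: "F y + inner (grad F y) (z - y) \<le> F z"
    using convex_gradient_ineq[OF assms(1) smooth_GDERIV[OF assms(2)]] .
  have "F z \<le> F x + inner (grad F x) (z - x) + L / 2 * (norm (z - x))\<^sup>2"
    by (rule smooth_upper_bound[OF assms(2)])
  also have "L / 2 * (norm (z - x))\<^sup>2 = (norm D)\<^sup>2 / (2 * L)"
    using assms(3) by (simp add: z_def power_divide power2_eq_square field_simps)
  finally have upper: "F z \<le> F x + inner (grad F x) (z - x) + (norm D)\<^sup>2 / (2 * L)" .
  have "inner (grad F y) (z - y) = inner (grad F y) (z - x) + inner (grad F y) (x - y)"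
    by (simp add: inner_diff_right)
  moreover have "inner (grad F x) (z - x) - inner (grad F y) (z - x) = - (norm D)\<^sup>2 / L"
  proof -
    have "inner (grad F x) (z - x) - inner (grad F y) (z - x) = inner D (z - x)"
      by (simp add: D_def inner_diff_left)
    then show ?thesis by (simp add: z_def power2_norm_eq_inner)
  qed
  ultimately have "(norm D)\<^sup>2 / L - (norm D)\<^sup>2 / (2 * L) \<le> F x - F y - inner (grad F y) (x - y)"
    using lower upper by linarith
  then show ?thesis unfolding D_def[symmetric] using assms(3) by (simp add: field_simps)
qed

lemma grad_minimizer:
  fixes F :: "'a::real_inner \<Rightarrow> real"
  assumes "GDERIV F z :> D" and "\<And>y. F z \<le> F y"
  shows "D = 0"
proof -
  have "((\<lambda>t. F (z + t *\<^sub>R D)) has_real_derivative inner D D) (at 0)"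
    using assms(1) by (intro line_derivative) simp
  then have "inner D D = 0"
    by (rule DERIV_local_min[where d=1]) (use assms(2) in auto)
  then show ?thesis by simp
qed

section \<open>Conditioning on the past of an independent draw\<close>

text \<open>The state before a draw is the sample point itself, seen through the sigma-algebra \<open>F\<close> of the
  past.  Independence is the product rule for an event of the past and an event of the draw, since
  the two live in different types.\<close>

locale fresh_draw = prob_space M for M :: "'o measure" +
  fixes F :: "'o measure" and N P :: "'z measure" and Z :: "'o \<Rightarrow> 'z"
  assumes sub: "subalgebra M F"
    and Z_measurable: "Z \<in> measurable M N"
    and law: "distr M N Z = P"
    and indep: "\<And>A B. A \<in> sets F \<Longrightarrow> B \<in> sets N \<Longrightarrow>
      prob (A \<inter> (Z -` B \<inter> space M)) = prob A * prob (Z -` B \<inter> space M)"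
begin

lemma id_measurable: "(\<lambda>s. s) \<in> measurable M F"
  by (rule measurable_from_subalg[OF sub]) simp

lemma pair_measurable: "(\<lambda>s. (s, Z s)) \<in> measurable M (F \<Otimes>\<^sub>M N)"
  using id_measurable Z_measurable by (rule measurable_Pair)

lemma joint_law: "distr M (F \<Otimes>\<^sub>M N) (\<lambda>s. (s, Z s)) = distr M F (\<lambda>s. s) \<Otimes>\<^sub>M P"
proof (rule sym, rule pair_measure_eqI)
  show "sigma_finite_measure (distr M F (\<lambda>s. s))"
    using prob_space_distr[OF id_measurable] by (simp add: prob_space_imp_sigma_finite)
  show "sigma_finite_measure P"
    unfolding law[symmetric] using prob_space_distr[OF Z_measurable]
    by (simp add: prob_space_imp_sigma_finite)
  show "sets (distr M F (\<lambda>s. s) \<Otimes>\<^sub>M P) = sets (distr M (F \<Otimes>\<^sub>M N) (\<lambda>s. (s, Z s)))"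
    unfolding law[symmetric] by (simp cong: sets_pair_measure_cong)
next
  fix A B assume "A \<in> sets (distr M F (\<lambda>s. s))" "B \<in> sets P"
  then have AB: "A \<in> sets F" "B \<in> sets N" unfolding law[symmetric] by simp_all
  then have A: "A \<subseteq> space M" "A \<in> sets M"
    using sub sets.sets_into_space[of A M] unfolding subalgebra_def by auto
  have "(\<lambda>s. (s, Z s)) -` (A \<times> B) \<inter> space M = A \<inter> (Z -` B \<inter> space M)" by auto
  moreover have "(\<lambda>s. s) -` A \<inter> space M = A" using A by auto
  ultimately show "emeasure (distr M F (\<lambda>s. s)) A * emeasure P B
      = emeasure (distr M (F \<Otimes>\<^sub>M N) (\<lambda>s. (s, Z s))) (A \<times> B)"
    unfolding law[symmetric] using AB indep[OF AB]
    by (simp add: emeasure_distr id_measurable Z_measurable pair_measurable pair_measureI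
        emeasure_eq_measure ennreal_mult[symmetric])
qed

text \<open>The pair of sample point and draw has a product law on \<open>F \<Otimes>\<^sub>M N\<close>.  Testing against events of the
  past and integrating with Fubini therefore averages over the draw with the past held fixed.\<close>

lemma freezing_cond_exp:
  fixes \<phi> :: "'o \<times> 'z \<Rightarrow> real"
  assumes meas[measurable]: "\<phi> \<in> borel_measurable (F \<Otimes>\<^sub>M N)"
    and int: "integrable M (\<lambda>s. \<phi> (s, Z s))"
  shows "AE s in M. real_cond_exp M F (\<lambda>s. \<phi> (s, Z s)) s = (\<integral>z. \<phi> (s, z) \<partial>P)"
    and "(\<integral>s. \<phi> (s, Z s) \<partial>M) = (\<integral>s. (\<integral>z. \<phi> (s, z) \<partial>P) \<partial>M)"
proof -
  note rv = id_measurable Z_measurable pair_measurable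
  define PF where "PF = distr M F (\<lambda>s. s)"
  interpret PF: prob_space PF unfolding PF_def by (rule prob_space_distr[OF rv(1)])
  interpret law_P: prob_space P unfolding law[symmetric] by (rule prob_space_distr[OF rv(2)])
  interpret pair_sigma_finite PF P ..
  interpret sub: finite_measure_subalgebra M F by unfold_locales (rule sub)
  have [simp]: "sets PF = sets F" "space PF = space F" by (simp_all add: PF_def)
  have [simp]: "sets P = sets N" "space P = space N" by (auto simp: law[symmetric])
  have meas_P [measurable]: "\<psi> \<in> borel_measurable (PF \<Otimes>\<^sub>M P)" if "\<psi> \<in> borel_measurable (F \<Otimes>\<^sub>M N)"
    for \<psi> :: "'o \<times> 'z \<Rightarrow> real"
    using that by (subst measurable_cong_sets[OF sets_pair_measure_cong refl, of _ F _ N]) auto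
  have joint: "distr M (F \<Otimes>\<^sub>M N) (\<lambda>s. (s, Z s)) = PF \<Otimes>\<^sub>M P"
    unfolding PF_def by (rule joint_law)
  define g where "g s = (\<integral>z. \<phi> (s, z) \<partial>P)" for s
  have integrable_pair: "integrable (PF \<Otimes>\<^sub>M P) \<psi>"
    if "\<psi> \<in> borel_measurable (F \<Otimes>\<^sub>M N)" "integrable M (\<lambda>s. \<psi> (s, Z s))"
    for \<psi> :: "'o \<times> 'z \<Rightarrow> real"
    unfolding joint[symmetric] by (subst integrable_distr_eq[OF rv(3) that(1)]) (rule that(2))
  have integral_pair: "(\<integral>s. \<psi> (s, Z s) \<partial>M) = (\<integral>s. (\<integral>z. \<psi> (s, z) \<partial>P) \<partial>PF)"
    if "\<psi> \<in> borel_measurable (F \<Otimes>\<^sub>M N)" "integrable M (\<lambda>s. \<psi> (s, Z s))"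
    for \<psi> :: "'o \<times> 'z \<Rightarrow> real"
  proof -
    have "(\<integral>s. \<psi> (s, Z s) \<partial>M) = (\<integral>u. \<psi> u \<partial>(PF \<Otimes>\<^sub>M P))"
      unfolding joint[symmetric] by (rule integral_distr[OF rv(3) that(1), symmetric])
    also have "\<dots> = (\<integral>s. (\<integral>z. \<psi> (s, z) \<partial>P) \<partial>PF)"
      by (rule integral_fst'[symmetric, OF integrable_pair[OF that]])
    finally show ?thesis .
  qed
  have g_meas: "g \<in> borel_measurable F"
  proof -
    have "g \<in> borel_measurable PF"
      unfolding g_def using meas_P[OF meas] 
      by (intro law_P.borel_measurable_lebesgue_integral[where f="\<lambda>s z. \<phi> (s, z)"]) simp
    moreover have "borel_measurable PF = (borel_measurable F :: ('o \<Rightarrow> real) set)"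
      by (rule measurable_cong_sets) auto
    ultimately show ?thesis by blast
  qed
  have "integrable PF g"
    unfolding g_def by (rule integrable_fst'[OF integrable_pair[OF meas int]])
  then have g_int: "integrable M g"
    unfolding PF_def by (subst (asm) integrable_distr_eq[OF rv(1) g_meas])
  have to_M: "(\<integral>s. u s \<partial>PF) = (\<integral>s. u s \<partial>M)" if "u \<in> borel_measurable F" for u :: "'o \<Rightarrow> real"
    unfolding PF_def by (rule integral_distr[OF rv(1) that])
  show "(\<integral>s. \<phi> (s, Z s) \<partial>M) = (\<integral>s. (\<integral>z. \<phi> (s, z) \<partial>P) \<partial>M)"
    using integral_pair[OF meas int] to_M[OF g_meas] unfolding g_def by simp
  have "AE s in M. real_cond_exp M F (\<lambda>s. \<phi> (s, Z s)) s = g s"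
  proof (rule sub.real_cond_exp_charact)
    fix A assume A[measurable]: "A \<in> sets F"
    then have AM: "A \<in> sets M" using sub unfolding subalgebra_def by auto
    define \<psi> where "\<psi> = (\<lambda>(s, z). indicator A s * \<phi> (s, z))"
    have \<psi>_meas: "\<psi> \<in> borel_measurable (F \<Otimes>\<^sub>M N)" unfolding \<psi>_def by measurable
    have \<psi>_int: "integrable M (\<lambda>s. \<psi> (s, Z s))"
      unfolding \<psi>_def using integrable_mult_indicator[OF AM int] by simp
    have "(\<integral>s\<in>A. \<phi> (s, Z s) \<partial>M) = (\<integral>s. \<psi> (s, Z s) \<partial>M)"
      unfolding \<psi>_def set_lebesgue_integral_def by simp
    also have "\<dots> = (\<integral>s. (\<integral>z. \<psi> (s, z) \<partial>P) \<partial>PF)"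
      by (rule integral_pair[OF \<psi>_meas \<psi>_int])
    also have "\<dots> = (\<integral>s. indicator A s * g s \<partial>PF)"
      by (simp add: \<psi>_def g_def)
    also have "\<dots> = (\<integral>s. indicator A s * g s \<partial>M)"
      by (intro to_M borel_measurable_times borel_measurable_indicator A g_meas)
    finally show "(\<integral>s\<in>A. \<phi> (s, Z s) \<partial>M) = (\<integral>s\<in>A. g s \<partial>M)"
      unfolding set_lebesgue_integral_def real_scaleR_def .
  qed (rule int g_int g_meas)+
  then show "AE s in M. real_cond_exp M F (\<lambda>s. \<phi> (s, Z s)) s = (\<integral>z. \<phi> (s, z) \<partial>P)"
    unfolding g_def .
qed

text \<open>For nonnegative functions Tonelli's theorem gives integrability for free as soon as the sections
  have an integrable bound; this is how square integrability passes from one iteration to the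
  next.\<close>

lemma freezing_bound:
  fixes \<phi> :: "'o \<times> 'z \<Rightarrow> real"
  assumes meas[measurable]: "\<phi> \<in> borel_measurable (F \<Otimes>\<^sub>M N)"
    and nonneg: "\<And>u. 0 \<le> \<phi> u"
    and sections: "\<And>s. s \<in> space M \<Longrightarrow> integrable P (\<lambda>z. \<phi> (s, z))"
    and bound: "\<And>s. s \<in> space M \<Longrightarrow> (\<integral>z. \<phi> (s, z) \<partial>P) \<le> \<psi> s"
    and int: "integrable M \<psi>"
  shows "integrable M (\<lambda>s. \<phi> (s, Z s))"
    and "AE s in M. real_cond_exp M F (\<lambda>s. \<phi> (s, Z s)) s \<le> \<psi> s"
proof -
  note rv = id_measurable Z_measurable pair_measurable
  define PF where "PF = distr M F (\<lambda>s. s)"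
  interpret law_P: prob_space P unfolding law[symmetric] by (rule prob_space_distr[OF rv(2)])
  have [simp]: "sets PF = sets F" "space PF = space F" by (simp_all add: PF_def)
  have [simp]: "sets P = sets N" "space P = space N" by (auto simp: law[symmetric])
  have meas_P: "\<phi> \<in> borel_measurable (PF \<Otimes>\<^sub>M P)"
    using meas by (subst measurable_cong_sets[OF sets_pair_measure_cong refl, of _ F _ N]) auto
  have joint: "distr M (F \<Otimes>\<^sub>M N) (\<lambda>s. (s, Z s)) = PF \<Otimes>\<^sub>M P"
    unfolding PF_def by (rule joint_law)
  have meas_e: "(\<lambda>u. ennreal (\<phi> u)) \<in> borel_measurable (PF \<Otimes>\<^sub>M P)"
    using meas_P by simp
  have "(\<integral>\<^sup>+s. ennreal (\<phi> (s, Z s)) \<partial>M) = (\<integral>\<^sup>+u. ennreal (\<phi> u) \<partial>(PF \<Otimes>\<^sub>M P))"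
    unfolding joint[symmetric] using rv(3) by (subst nn_integral_distr) auto
  also have "\<dots> = (\<integral>\<^sup>+s. (\<integral>\<^sup>+z. ennreal (\<phi> (s, z)) \<partial>P) \<partial>PF)"
    using law_P.nn_integral_fst[OF meas_e] by simp
  also have "\<dots> = (\<integral>\<^sup>+s. (\<integral>\<^sup>+z. ennreal (\<phi> (s, z)) \<partial>P) \<partial>M)"
    unfolding PF_def using rv(1) law_P.borel_measurable_nn_integral_fst[OF meas_e]
    by (subst nn_integral_distr) (auto simp: PF_def)
  also have "\<dots> \<le> (\<integral>\<^sup>+s. ennreal (\<psi> s) \<partial>M)"
  proof (rule nn_integral_mono)
    fix s assume s: "s \<in> space M"
    show "(\<integral>\<^sup>+z. ennreal (\<phi> (s, z)) \<partial>P) \<le> ennreal (\<psi> s)"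
      using bound[OF s] nonneg by (subst nn_integral_eq_integral[OF sections[OF s]]) (auto intro: ennreal_leI)
  qed
  also have "\<dots> \<le> (\<integral>\<^sup>+s. ennreal (norm (\<psi> s)) \<partial>M)"
    by (intro nn_integral_mono ennreal_leI) simp
  also have "\<dots> < \<infinity>" using int unfolding integrable_iff_bounded by simp
  finally have fin: "(\<integral>\<^sup>+s. ennreal (\<phi> (s, Z s)) \<partial>M) < \<infinity>" .
  have "(\<lambda>s. \<phi> (s, Z s)) \<in> borel_measurable M"
    using measurable_compose[OF rv(3) meas] .
  with fin show *: "integrable M (\<lambda>s. \<phi> (s, Z s))"
    using nonneg by (intro integrableI_nonneg) auto
  show "AE s in M. real_cond_exp M F (\<lambda>s. \<phi> (s, Z s)) s \<le> \<psi> s"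
    using freezing_cond_exp(1)[OF meas *] AE_space by eventually_elim (simp add: bound)
qed

end

section \<open>Product measures with a uniform first factor\<close>

lemma distr_pair_snd:
  assumes "prob_space A" "sigma_finite_measure B"
  shows "distr (A \<Otimes>\<^sub>M B) B snd = B"
proof (rule measure_eqI)
  interpret A: prob_space A by fact
  interpret B: sigma_finite_measure B by fact
  fix X assume X: "X \<in> sets (distr (A \<Otimes>\<^sub>M B) B snd)"
  then have "snd -` X \<inter> space (A \<Otimes>\<^sub>M B) = space A \<times> X"
    by (auto simp: space_pair_measure dest: sets.sets_into_space)
  with X show "emeasure (distr (A \<Otimes>\<^sub>M B) B snd) X = emeasure B X"
    by (simp add: emeasure_distr B.emeasure_pair_measure_Times A.emeasure_space_1)
qed simp

lemma draw_law_integral: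
  fixes G :: "nat \<Rightarrow> 'r \<Rightarrow> real"
  assumes "m \<ge> 1" and "prob_space R"
    and [measurable]: "\<And>j. G j \<in> borel_measurable R"
    and int: "\<And>j. j \<in> {1..m} \<Longrightarrow> integrable R (G j)"
  shows "integrable (measure_pmf (pmf_of_set {1..m}) \<Otimes>\<^sub>M R) (\<lambda>z. G (fst z) (snd z))"
    and "(\<integral>z. G (fst z) (snd z) \<partial>(measure_pmf (pmf_of_set {1..m}) \<Otimes>\<^sub>M R)) = avg m (\<lambda>j. \<integral>r. G j r \<partial>R)"
proof -
  interpret R: prob_space R by fact
  let ?U = "measure_pmf (pmf_of_set {1..m})"
  interpret pair_sigma_finite ?U R ..
  have ne: "{1..m} \<noteq> {}" using assms(1) by simp
  have [measurable]: "fst \<in> measurable (?U \<Otimes>\<^sub>M R) (count_space UNIV)"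
    using measurable_fst[of ?U R] by simp
  have meas: "(\<lambda>z. G (fst z) (snd z)) \<in> borel_measurable (?U \<Otimes>\<^sub>M R)"
    by (rule measurable_compose_countable[where f="\<lambda>j z. G j (snd z)"]) measurable
  show *: "integrable (?U \<Otimes>\<^sub>M R) (\<lambda>z. G (fst z) (snd z))"
  proof (rule Fubini_integrable[OF meas])
    show "integrable ?U (\<lambda>x. \<integral>y. norm (G (fst (x, y)) (snd (x, y))) \<partial>R)"
      by (rule integrable_measure_pmf_finite) (use ne in simp)
    show "AE x in ?U. integrable R (\<lambda>y. G (fst (x, y)) (snd (x, y)))"
      using ne int by (simp add: AE_measure_pmf_iff)
  qed
  have "(\<integral>z. G (fst z) (snd z) \<partial>(?U \<Otimes>\<^sub>M R)) = (\<integral>j. (\<integral>r. G j r \<partial>R) \<partial>?U)"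
    using integral_fst'[OF *] by simp
  also have "\<dots> = avg m (\<lambda>j. \<integral>r. G j r \<partial>R)"
    by (subst integral_pmf_of_set[OF ne]) (auto simp: avg_def)
  finally show "(\<integral>z. G (fst z) (snd z) \<partial>(?U \<Otimes>\<^sub>M R)) = avg m (\<lambda>j. \<integral>r. G j r \<partial>R)" .
qed

section \<open>Gradient bounds for the finite sum\<close>

locale finite_sum_problem =
  fixes n m :: nat
    and fs :: "nat \<Rightarrow> nat \<Rightarrow> real ^ 'd \<Rightarrow> real"
    and xstar :: "real ^ 'd"
    and L \<mu> :: real
  assumes n_pos: "n \<ge> 1" and m_pos: "m \<ge> 1" and L_pos: "L > 0"
    and convex: "\<And>i j. i \<in> {1..n} \<Longrightarrow> j \<in> {1..m} \<Longrightarrow> convex_on UNIV (fs i j)"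
    and smooth: "\<And>i j. i \<in> {1..n} \<Longrightarrow> j \<in> {1..m} \<Longrightarrow> smooth L (fs i j)"
    and mu: "\<mu> \<ge> 0"
    and qsc: "quasi_strongly_convex \<mu> (objective n m fs)"
    and xstar: "is_arg_min (objective n m fs) (\<lambda>_. True) xstar"
begin

abbreviation "f \<equiv> objective n m fs"
abbreviation "worker_grad i \<equiv> grad (worker_obj m fs i)"
abbreviation "gap y \<equiv> f y - f xstar"

text \<open>Indices outside the range get the zero gradient: the estimator is then measurable jointly in
  the index and the point, whatever the index.\<close>

definition comp_grad :: "nat \<Rightarrow> nat \<Rightarrow> real ^ 'd \<Rightarrow> real ^ 'd" where
  "comp_grad i j y = (if j \<in> {1..m} then grad (fs i j) y else 0)"

definition estimator :: "nat \<Rightarrow> nat \<Rightarrow> real ^ 'd \<Rightarrow> real ^ 'd \<Rightarrow> real ^ 'd" where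
  "estimator i j y u = comp_grad i j y - comp_grad i j u + worker_grad i u"

lemma worker_obj_eq: "worker_obj m fs i = (\<lambda>y. avg m (\<lambda>j. fs i j y))"
  by (rule ext) (simp add: worker_obj_def)

lemma objective_eq: "f = (\<lambda>y. avg n (\<lambda>i. worker_obj m fs i y))"
  by (rule ext) (simp add: objective_def)

lemma smooth_worker: "i \<in> {1..n} \<Longrightarrow> smooth L (worker_obj m fs i)"
  unfolding worker_obj_eq using m_pos smooth by (intro smooth_avg) auto

lemma worker_grad_eq: "i \<in> {1..n} \<Longrightarrow> worker_grad i y = avg m (\<lambda>j. grad (fs i j) y)"
  unfolding worker_obj_eq using m_pos smooth by (intro smooth_avg) auto

lemma smooth_objective: "smooth L f"
  unfolding objective_eq using n_pos smooth_worker by (intro smooth_avg) auto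

lemma grad_objective: "grad f y = avg n (\<lambda>i. worker_grad i y)"
  unfolding objective_eq using n_pos smooth_worker by (intro smooth_avg) auto

lemma convex_objective: "convex_on UNIV f"
  unfolding objective_eq worker_obj_def by (intro convex_on_avg convex)

lemma gap_nonneg: "0 \<le> gap y"
  using xstar by (auto simp: is_arg_min_def not_less)

lemma grad_xstar: "grad f xstar = 0"
  using grad_minimizer[OF smooth_GDERIV[OF smooth_objective]] gap_nonneg by simp

lemma grad_norm_le: "(norm (grad f y))\<^sup>2 \<le> 2 * L * gap y"
  using smooth_convex_cocoercive[OF convex_objective smooth_objective L_pos, of y xstar]
  by (simp add: grad_xstar)

lemma quasi_convexity: "inner (grad f y) (y - xstar) \<ge> gap y + \<mu> / 2 * (norm (y - xstar))\<^sup>2"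
proof -
  have "f xstar \<ge> f y + inner (grad f y) (xstar - y) + \<mu> / 2 * (norm (y - xstar))\<^sup>2"
    using qsc xstar unfolding quasi_strongly_convex_def by blast
  then show ?thesis by (simp add: inner_diff_right)
qed

text \<open>The error of linearizing \<open>f\<close> at a point, evaluated at the minimizer, is bounded from below by
  quasi strong convexity and from above by smoothness; a point at distance one from the minimizer
  compares the constants.\<close>

lemma mu_le_L: "\<mu> \<le> L"
proof -
  define y where "y = xstar + axis undefined 1"
  have "norm (y - xstar) = 1" by (simp add: y_def norm_axis_1)
  moreover have "f xstar \<le> f y + inner (grad f y) (xstar - y) + L / 2 * (norm (xstar - y))\<^sup>2"
    by (rule smooth_upper_bound[OF smooth_objective])
  ultimately show ?thesis
    using quasi_convexity[of y] by (simp add: inner_diff_right norm_minus_commute)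
qed

text \<open>Co-coercivity holds for each component with its own linear term at the minimizer; these terms
  average to the gradient of \<open>f\<close> there, which vanishes.\<close>

lemma component_divergence:
  "avg n (\<lambda>i. avg m (\<lambda>j. (norm (grad (fs i j) y - grad (fs i j) xstar))\<^sup>2)) \<le> 2 * L * gap y"
proof -
  have "avg n (\<lambda>i. avg m (\<lambda>j. (norm (grad (fs i j) y - grad (fs i j) xstar))\<^sup>2))
      \<le> avg n (\<lambda>i. avg m (\<lambda>j. 2 * L * (fs i j y - fs i j xstar
            - inner (grad (fs i j) xstar) (y - xstar))))"
    by (intro avg_mono smooth_convex_cocoercive convex smooth L_pos)
  also have "\<dots> = 2 * L * (avg n (\<lambda>i. avg m (\<lambda>j. fs i j y)) - avg n (\<lambda>i. avg m (\<lambda>j. fs i j xstar))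
      - inner (avg n (\<lambda>i. avg m (\<lambda>j. grad (fs i j) xstar))) (y - xstar))"
    by (simp only: avg_mult avg_diff inner_avg_left)
  also have "avg n (\<lambda>i. avg m (\<lambda>j. grad (fs i j) xstar)) = grad f xstar"
    unfolding grad_objective by (intro avg_cong worker_grad_eq[symmetric])
  finally show ?thesis by (simp add: grad_xstar objective_def worker_obj_def)
qed

lemma worker_divergence:
  "avg n (\<lambda>i. (norm (worker_grad i y - worker_grad i xstar))\<^sup>2) \<le> 2 * L * gap y"
proof -
  have "avg n (\<lambda>i. (norm (worker_grad i y - worker_grad i xstar))\<^sup>2)
      \<le> avg n (\<lambda>i. avg m (\<lambda>j. (norm (grad (fs i j) y - grad (fs i j) xstar))\<^sup>2))"
    by (intro avg_mono) (simp add: worker_grad_eq avg_diff[symmetric] norm_avg_sq_le[OF m_pos])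
  also note component_divergence
  finally show ?thesis .
qed

lemma avg_comp_grad: "i \<in> {1..n} \<Longrightarrow> avg m (\<lambda>j. comp_grad i j y) = worker_grad i y"
  unfolding worker_grad_eq by (intro avg_cong) (simp add: comp_grad_def)

lemma avg_estimator: "i \<in> {1..n} \<Longrightarrow> avg m (\<lambda>j. estimator i j y u) = worker_grad i y"
  unfolding estimator_def using m_pos by (simp add: avg_add avg_diff avg_const avg_comp_grad)

lemma sigma2_sq_eq: "sigma2_sq n m fs xstar u
    = avg n (\<lambda>i. avg m (\<lambda>j. (norm (comp_grad i j (u i) - comp_grad i j xstar))\<^sup>2))"
proof -
  have "avg n (\<lambda>i. avg m (\<lambda>j. (norm (comp_grad i j (u i) - comp_grad i j xstar))\<^sup>2))
      = avg n (\<lambda>i. avg m (\<lambda>j. (norm (grad (fs i j) (u i) - grad (fs i j) xstar))\<^sup>2))"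
    by (intro avg_cong) (simp add: comp_grad_def)
  also have "\<dots> = sigma2_sq n m fs xstar u"
    by (simp add: sigma2_sq_def avg_def sum_divide_distrib mult.commute)
  finally show ?thesis by simp
qed

text \<open>Relative to the worker gradient at the minimizer, the estimator is a gradient increment at \<open>y\<close>
  minus a centred gradient increment at the anchor.  The former is a function gap by
  co-coercivity, and centring can only decrease the second moment of the latter.\<close>

lemma estimator_second_moment:
  "avg n (\<lambda>i. avg m (\<lambda>j. (norm (estimator i j y (u i) - worker_grad i xstar))\<^sup>2))
    \<le> 4 * L * gap y + 2 * sigma2_sq n m fs xstar u"
proof -
  have inner_bound: "avg m (\<lambda>j. (norm (estimator i j y (u i) - worker_grad i xstar))\<^sup>2)
      \<le> 2 * avg m (\<lambda>j. (norm (grad (fs i j) y - grad (fs i j) xstar))\<^sup>2)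
        + 2 * avg m (\<lambda>j. (norm (comp_grad i j (u i) - comp_grad i j xstar))\<^sup>2)"
    if i: "i \<in> {1..n}" for i
  proof -
    define b where "b j = comp_grad i j (u i) - comp_grad i j xstar" for j
    have avg_b: "avg m b = worker_grad i (u i) - worker_grad i xstar"
      unfolding b_def by (simp add: avg_diff avg_comp_grad[OF i])
    have "avg m (\<lambda>j. (norm (estimator i j y (u i) - worker_grad i xstar))\<^sup>2)
        = avg m (\<lambda>j. (norm ((comp_grad i j y - comp_grad i j xstar) - (b j - avg m b)))\<^sup>2)"
      unfolding avg_b by (simp add: b_def estimator_def algebra_simps)
    also have "\<dots> \<le> avg m (\<lambda>j. 2 * (norm (comp_grad i j y - comp_grad i j xstar))\<^sup>2
        + 2 * (norm (b j - avg m b))\<^sup>2)"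
      by (intro avg_mono norm_diff_sq_le)
    also have "\<dots> = 2 * avg m (\<lambda>j. (norm (comp_grad i j y - comp_grad i j xstar))\<^sup>2)
        + 2 * avg m (\<lambda>j. (norm (b j - avg m b))\<^sup>2)"
      by (simp only: avg_add avg_mult)
    also have "avg m (\<lambda>j. (norm (comp_grad i j y - comp_grad i j xstar))\<^sup>2)
        = avg m (\<lambda>j. (norm (grad (fs i j) y - grad (fs i j) xstar))\<^sup>2)"
      by (intro avg_cong) (simp add: comp_grad_def)
    finally have "avg m (\<lambda>j. (norm (estimator i j y (u i) - worker_grad i xstar))\<^sup>2)
      \<le> 2 * avg m (\<lambda>j. (norm (grad (fs i j) y - grad (fs i j) xstar))\<^sup>2)
        + 2 * avg m (\<lambda>j. (norm (b j))\<^sup>2)"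
      using avg_variance_le[OF m_pos, of b 0] by simp
    then show ?thesis unfolding b_def .
  qed
  have "avg n (\<lambda>i. avg m (\<lambda>j. (norm (estimator i j y (u i) - worker_grad i xstar))\<^sup>2))
      \<le> avg n (\<lambda>i. 2 * avg m (\<lambda>j. (norm (grad (fs i j) y - grad (fs i j) xstar))\<^sup>2)
        + 2 * avg m (\<lambda>j. (norm (comp_grad i j (u i) - comp_grad i j xstar))\<^sup>2))"
    by (intro avg_mono inner_bound)
  also have "\<dots> = 2 * avg n (\<lambda>i. avg m (\<lambda>j. (norm (grad (fs i j) y - grad (fs i j) xstar))\<^sup>2))
      + 2 * sigma2_sq n m fs xstar u"
    by (simp only: avg_add avg_mult sigma2_sq_eq)
  finally show ?thesis using component_divergence[of y] by simp
qed

lemma estimator_variance: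
  "avg n (\<lambda>i. avg m (\<lambda>j. (norm (estimator i j y (u i) - worker_grad i y))\<^sup>2))
    \<le> 4 * L * gap y + 2 * sigma2_sq n m fs xstar u"
proof -
  have "avg n (\<lambda>i. avg m (\<lambda>j. (norm (estimator i j y (u i) - worker_grad i y))\<^sup>2))
    \<le> avg n (\<lambda>i. avg m (\<lambda>j. (norm (estimator i j y (u i) - worker_grad i xstar))\<^sup>2))"
  proof (rule avg_mono)
    fix i assume "i \<in> {1..n}"
    then show "avg m (\<lambda>j. (norm (estimator i j y (u i) - worker_grad i y))\<^sup>2)
      \<le> avg m (\<lambda>j. (norm (estimator i j y (u i) - worker_grad i xstar))\<^sup>2)"
      using avg_variance_le[OF m_pos, of "\<lambda>j. estimator i j y (u i)" "worker_grad i xstar"]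
      by (simp add: avg_estimator)
  qed
  also note estimator_second_moment
  finally show ?thesis .
qed

text \<open>The worker gradients at the minimizer average to zero, so they can be subtracted from the shifts
  as well; what remains of the shifts is centred.\<close>

lemma shifted_mean_bound:
  "avg n (\<lambda>i. (norm (worker_grad i y - c i + avg n c))\<^sup>2)
    \<le> 4 * L * gap y + 2 * sigma1_sq n m fs xstar c"
proof -
  define b where "b i = c i - worker_grad i xstar" for i
  have avg_b: "avg n b = avg n c"
    unfolding b_def by (simp add: avg_diff grad_objective[symmetric] grad_xstar)
  have "avg n (\<lambda>i. (norm (worker_grad i y - c i + avg n c))\<^sup>2)
      = avg n (\<lambda>i. (norm ((worker_grad i y - worker_grad i xstar) - (b i - avg n b)))\<^sup>2)"
    unfolding avg_b by (simp add: b_def algebra_simps)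
  also have "\<dots> \<le> avg n (\<lambda>i. 2 * (norm (worker_grad i y - worker_grad i xstar))\<^sup>2
      + 2 * (norm (b i - avg n b))\<^sup>2)"
    by (intro avg_mono norm_diff_sq_le)
  also have "\<dots> = 2 * avg n (\<lambda>i. (norm (worker_grad i y - worker_grad i xstar))\<^sup>2)
      + 2 * avg n (\<lambda>i. (norm (b i - avg n b))\<^sup>2)"
    by (simp only: avg_add avg_mult)
  finally show ?thesis
    using worker_divergence[of y] avg_variance_le[OF n_pos, of b 0]
    by (simp add: b_def sigma1_sq_def)
qed

text \<open>In the average over the workers the shifts cancel and the gradients at the minimizer vanish, so
  the shifts do not enter the second moment of the averaged direction.\<close>

lemma avg_gradient_sq_le:
  assumes "\<And>i. i \<in> {1..n} \<Longrightarrow> a i = b i - c i + avg n c"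
  shows "(norm (avg n a))\<^sup>2 \<le> avg n (\<lambda>i. (norm (b i - worker_grad i xstar))\<^sup>2)"
proof -
  have "avg n a = avg n (\<lambda>i. b i - c i + avg n c)" using assms by (rule avg_cong)
  also have "\<dots> = avg n (\<lambda>i. b i - worker_grad i xstar)"
    using n_pos by (simp add: avg_add avg_diff avg_const grad_objective[symmetric] grad_xstar)
  finally show ?thesis using norm_avg_sq_le[OF n_pos] by simp
qed

end

section \<open>Square integrable random vectors\<close>

definition square_integrable :: "'o measure \<Rightarrow> ('o \<Rightarrow> 'a::euclidean_space) \<Rightarrow> bool" where
  "square_integrable M X \<longleftrightarrow> X \<in> borel_measurable M \<and> integrable M (\<lambda>s. (norm (X s))\<^sup>2)"

lemma square_integrable_cong:
  "(\<And>s. s \<in> space M \<Longrightarrow> X s = Y s) \<Longrightarrow> square_integrable M X \<longleftrightarrow> square_integrable M Y"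
  unfolding square_integrable_def
  by (intro conj_cong measurable_cong Bochner_Integration.integrable_cong refl) auto

lemma square_integrable_bound:
  assumes "Y \<in> borel_measurable M" and "integrable M b"
    and "\<And>s. s \<in> space M \<Longrightarrow> (norm (Y s))\<^sup>2 \<le> b s"
  shows "square_integrable M Y"
  unfolding square_integrable_def
proof
  show "integrable M (\<lambda>s. (norm (Y s))\<^sup>2)"
    by (rule Bochner_Integration.integrable_bound[OF assms(2)])
       (use assms(1,3) in \<open>auto intro!: AE_I2 order_trans[OF _ abs_ge_self]\<close>)
qed (rule assms)

lemma square_integrable_add:
  assumes "square_integrable M X" "square_integrable M Y"
  shows "square_integrable M (\<lambda>s. X s + Y s)"
  by (rule square_integrable_bound[where b="\<lambda>s. 2 * (norm (X s))\<^sup>2 + 2 * (norm (Y s))\<^sup>2"])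
     (use assms norm_add_sq_le in \<open>auto simp: square_integrable_def\<close>)

lemma square_integrable_scaleR:
  "square_integrable M X \<Longrightarrow> square_integrable M (\<lambda>s. c *\<^sub>R X s)"
  by (auto simp: square_integrable_def power_mult_distrib)

lemma square_integrable_diff:
  assumes "square_integrable M X" "square_integrable M Y"
  shows "square_integrable M (\<lambda>s. X s - Y s)"
  using square_integrable_add[OF assms(1) square_integrable_scaleR[OF assms(2), of "-1"]] by simp

lemma square_integrable_const: "finite_measure M \<Longrightarrow> square_integrable M (\<lambda>s. c)"
  by (simp add: square_integrable_def finite_measure.integrable_const)

lemma square_integrable_avg:
  assumes "finite_measure M" and "\<And>i. i \<in> {1..n} \<Longrightarrow> square_integrable M (X i)"
  shows "square_integrable M (\<lambda>s. avg n (\<lambda>i. X i s))"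
proof -
  have "square_integrable M (\<lambda>s. \<Sum>i\<in>A. X i s)" if "finite A" "A \<subseteq> {1..n}" for A
    using that
  proof (induction rule: finite_induct)
    case empty
    then show ?case by (simp add: square_integrable_const assms(1))
  next
    case (insert a A)
    then show ?case using assms by (auto intro!: square_integrable_add)
  qed
  then show ?thesis unfolding avg_def by (intro square_integrable_scaleR) simp
qed

lemma square_integrable_inner:
  assumes "square_integrable M X" "square_integrable M Y"
  shows "integrable M (\<lambda>s. inner (X s) (Y s))"
proof (rule Bochner_Integration.integrable_bound)
  show "integrable M (\<lambda>s. (norm (X s))\<^sup>2 + (norm (Y s))\<^sup>2)"
    using assms by (auto simp: square_integrable_def)
  show "(\<lambda>s. inner (X s) (Y s)) \<in> borel_measurable M"
    using assms by (auto simp: square_integrable_def)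
  have "\<bar>inner a b\<bar> \<le> (norm a)\<^sup>2 + (norm b)\<^sup>2" for a b :: 'b
    using Cauchy_Schwarz_ineq2[of a b] sum_squares_bound[of "norm a" "norm b"]
      mult_nonneg_nonneg[of "norm a" "norm b"] by simp
  then show "AE s in M. norm (inner (X s) (Y s)) \<le> norm ((norm (X s))\<^sup>2 + (norm (Y s))\<^sup>2)"
    by simp
qed

lemma square_integrable_integrable:
  assumes "finite_measure M" "square_integrable M X"
  shows "integrable M X"
proof (rule Bochner_Integration.integrable_bound)
  show "integrable M (\<lambda>s. 1 + (norm (X s))\<^sup>2)"
    using assms by (auto simp: square_integrable_def finite_measure.integrable_const)
  have "norm a \<le> 1 + (norm a)\<^sup>2" for a :: 'b
  proof -
    have "2 * norm a \<le> 1 + (norm a)\<^sup>2" using sum_squares_bound[of 1 "norm a"] by simp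
    then show ?thesis using norm_ge_zero[of a] by linarith
  qed
  then show "AE s in M. norm (X s) \<le> norm (1 + (norm (X s))\<^sup>2)"
    by simp
qed (use assms in \<open>simp add: square_integrable_def\<close>)

lemma square_integrable_lipschitz:
  fixes G :: "'a::euclidean_space \<Rightarrow> 'b::euclidean_space"
  assumes fin: "finite_measure M" and X: "square_integrable M X"
    and lip: "\<And>a b. norm (G a - G b) \<le> L * norm (a - b)"
    and meas: "G \<in> borel_measurable borel"
  shows "square_integrable M (\<lambda>s. G (X s))"
proof -
  have "square_integrable M (\<lambda>s. G (X s) - G 0)"
  proof (rule square_integrable_bound)
    show "integrable M (\<lambda>s. L\<^sup>2 * (norm (X s))\<^sup>2)"
      using X by (auto simp: square_integrable_def)
    show "(norm (G (X s) - G 0))\<^sup>2 \<le> L\<^sup>2 * (norm (X s))\<^sup>2" for s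
      using power_mono[OF lip[of "X s" 0] norm_ge_zero, of 2] by (simp add: power_mult_distrib)
    show "(\<lambda>s. G (X s) - G 0) \<in> borel_measurable M"
      using measurable_compose[OF _ meas, of X M] X by (simp add: square_integrable_def)
  qed
  from square_integrable_add[OF this square_integrable_const[OF fin, of "G 0"]]
  show ?thesis by simp
qed

section \<open>Integrating over one worker's draws\<close>

abbreviation "draw_index z \<equiv> fst z"
abbreviation "draw_coin z \<equiv> fst (snd z)"
abbreviation "draw_cseed z \<equiv> fst (snd (snd z))"
abbreviation "draw_qseed z \<equiv> snd (snd (snd z))"

locale worker_draws =
  fixes m :: nat and p :: real and CS :: "'c measure" and QS :: "'q measure"
  assumes m_pos: "m \<ge> 1" and p: "0 < p" "p < 1"
    and prob_CS: "prob_space CS" and prob_QS: "prob_space QS"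
begin

abbreviation "D \<equiv> draw_law m p CS QS"
abbreviation "index_law \<equiv> measure_pmf (pmf_of_set {1..m})"
abbreviation "coin_law \<equiv> measure_pmf (bernoulli_pmf p)"
abbreviation "seed_law \<equiv> coin_law \<Otimes>\<^sub>M CS \<Otimes>\<^sub>M QS"

lemma D_eq: "D = index_law \<Otimes>\<^sub>M seed_law"
  by (simp add: draw_law_def)

lemma prob_CQ: "prob_space (CS \<Otimes>\<^sub>M QS)"
  by (intro prob_space_pair prob_CS prob_QS)

lemma prob_seed_law: "prob_space seed_law"
  by (intro prob_space_pair prob_CQ measure_pmf.prob_space_axioms)

lemma draw_measurable [measurable]:
  "draw_index \<in> measurable D (count_space UNIV)"
  "draw_coin \<in> measurable D (count_space UNIV)"
  "draw_cseed \<in> measurable D CS"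
  "draw_qseed \<in> measurable D QS"
proof -
  show "draw_index \<in> measurable D (count_space UNIV)"
    using measurable_fst[of index_law seed_law] by (simp add: D_eq)
  have "fst \<in> measurable seed_law (count_space UNIV)"
    using measurable_fst[of coin_law "CS \<Otimes>\<^sub>M QS"] by simp
  then show "draw_coin \<in> measurable D (count_space UNIV)"
    unfolding D_eq by (rule measurable_compose[OF measurable_snd])
qed (simp_all add: D_eq)

text \<open>The coin and the seeds are recovered as marginals, so that a function of one of them is integrated
  against its own law.\<close>

lemma seed_marginals:
  "distr seed_law coin_law fst = coin_law"
  "distr seed_law CS (\<lambda>r. fst (snd r)) = CS"
  "distr seed_law QS (\<lambda>r. snd (snd r)) = QS"
proof -
  interpret CQ: prob_space "CS \<Otimes>\<^sub>M QS" by (rule prob_CQ)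
  interpret QS: prob_space QS by (rule prob_QS)
  have snd: "distr seed_law (CS \<Otimes>\<^sub>M QS) snd = CS \<Otimes>\<^sub>M QS"
    by (rule distr_pair_snd[OF measure_pmf.prob_space_axioms CQ.sigma_finite_measure_axioms])
  show "distr seed_law coin_law fst = coin_law" by (rule CQ.distr_pair_fst)
  have "distr seed_law CS (\<lambda>r. fst (snd r)) = distr (distr seed_law (CS \<Otimes>\<^sub>M QS) snd) CS fst"
    by (subst distr_distr) (auto simp: comp_def)
  also have "\<dots> = CS" unfolding snd by (rule QS.distr_pair_fst)
  finally show "distr seed_law CS (\<lambda>r. fst (snd r)) = CS" .
  have "distr seed_law QS (\<lambda>r. snd (snd r)) = distr (distr seed_law (CS \<Otimes>\<^sub>M QS) snd) QS snd"
    by (subst distr_distr) (auto simp: comp_def)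
  also have "\<dots> = QS"
    unfolding snd by (rule distr_pair_snd[OF prob_CS QS.sigma_finite_measure_axioms])
  finally show "distr seed_law QS (\<lambda>r. snd (snd r)) = QS" .
qed

lemma integral_draw_index:
  fixes u :: "nat \<Rightarrow> real"
  shows "integrable D (\<lambda>z. u (draw_index z))" "(\<integral>z. u (draw_index z) \<partial>D) = avg m u"
proof -
  interpret R: prob_space seed_law by (rule prob_seed_law)
  show "integrable D (\<lambda>z. u (draw_index z))" "(\<integral>z. u (draw_index z) \<partial>D) = avg m u"
    using draw_law_integral[OF m_pos prob_seed_law, of "\<lambda>j r. u j"]
    by (simp_all add: D_eq R.prob_space)
qed

lemma integral_draw_coin:
  fixes u :: "bool \<Rightarrow> real"
  shows "integrable D (\<lambda>z. u (draw_coin z))"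
    "(\<integral>z. u (draw_coin z) \<partial>D) = p * u True + (1 - p) * u False"
proof -
  have fst: "fst \<in> measurable seed_law coin_law" by simp
  have u: "u \<in> borel_measurable coin_law" by simp
  have int: "integrable seed_law (\<lambda>r. u (fst r))"
    by (subst integrable_distr_eq[OF fst u, symmetric], subst seed_marginals)
       (simp add: integrable_measure_pmf_finite)
  have "(\<integral>r. u (fst r) \<partial>seed_law) = (\<integral>b. u b \<partial>coin_law)"
    by (subst integral_distr[OF fst u, symmetric], subst seed_marginals) simp
  also have "\<dots> = p * u True + (1 - p) * u False" using p by simp
  finally show "integrable D (\<lambda>z. u (draw_coin z))"
    "(\<integral>z. u (draw_coin z) \<partial>D) = p * u True + (1 - p) * u False"
    using draw_law_integral[OF m_pos prob_seed_law, of "\<lambda>j r. u (fst r)"] int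
      measurable_compose[OF fst u] avg_const[OF m_pos]
    by (simp_all add: D_eq)
qed

lemma integral_draw_cseed:
  fixes u :: "nat \<Rightarrow> 'c \<Rightarrow> real"
  assumes "\<And>j. integrable CS (u j)"
  shows "integrable D (\<lambda>z. u (draw_index z) (draw_cseed z))"
    "(\<integral>z. u (draw_index z) (draw_cseed z) \<partial>D) = avg m (\<lambda>j. \<integral>c. u j c \<partial>CS)"
proof -
  have c: "(\<lambda>r. fst (snd r)) \<in> measurable seed_law CS" by simp
  have u: "u j \<in> borel_measurable CS" for j using assms by simp
  have int: "integrable seed_law (\<lambda>r. u j (fst (snd r)))" for j
    by (subst integrable_distr_eq[OF c u, symmetric], subst seed_marginals) (rule assms)
  have "(\<integral>r. u j (fst (snd r)) \<partial>seed_law) = (\<integral>c. u j c \<partial>CS)" for j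
    by (subst integral_distr[OF c u, symmetric], subst seed_marginals) simp
  then show "integrable D (\<lambda>z. u (draw_index z) (draw_cseed z))"
    "(\<integral>z. u (draw_index z) (draw_cseed z) \<partial>D) = avg m (\<lambda>j. \<integral>c. u j c \<partial>CS)"
    using draw_law_integral[OF m_pos prob_seed_law, of "\<lambda>j r. u j (fst (snd r))"] int
      measurable_compose[OF c u]
    by (simp_all add: D_eq)
qed

lemma integral_draw_qseed:
  fixes u :: "nat \<Rightarrow> 'q \<Rightarrow> real"
  assumes "\<And>j. integrable QS (u j)"
  shows "integrable D (\<lambda>z. u (draw_index z) (draw_qseed z))"
    "(\<integral>z. u (draw_index z) (draw_qseed z) \<partial>D) = avg m (\<lambda>j. \<integral>q. u j q \<partial>QS)"
proof -
  have c: "(\<lambda>r. snd (snd r)) \<in> measurable seed_law QS" by simp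
  have u: "u j \<in> borel_measurable QS" for j using assms by simp
  have int: "integrable seed_law (\<lambda>r. u j (snd (snd r)))" for j
    by (subst integrable_distr_eq[OF c u, symmetric], subst seed_marginals) (rule assms)
  have "(\<integral>r. u j (snd (snd r)) \<partial>seed_law) = (\<integral>q. u j q \<partial>QS)" for j
    by (subst integral_distr[OF c u, symmetric], subst seed_marginals) simp
  then show "integrable D (\<lambda>z. u (draw_index z) (draw_qseed z))"
    "(\<integral>z. u (draw_index z) (draw_qseed z) \<partial>D) = avg m (\<lambda>j. \<integral>q. u j q \<partial>QS)"
    using draw_law_integral[OF m_pos prob_seed_law, of "\<lambda>j r. u j (snd (snd r))"] int
      measurable_compose[OF c u]
    by (simp_all add: D_eq)
qed

lemma compression_error:
  fixes y :: "nat \<Rightarrow> 'a::euclidean_space"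
  assumes "compression_operator \<delta> CS C"
  shows "integrable D (\<lambda>z. (norm (y (draw_index z) - C (draw_cseed z) (y (draw_index z))))\<^sup>2)"
    and "(\<integral>z. (norm (y (draw_index z) - C (draw_cseed z) (y (draw_index z))))\<^sup>2 \<partial>D)
      \<le> (1 - \<delta>) * avg m (\<lambda>j. (norm (y j))\<^sup>2)"
proof -
  define u where "u j c = (norm (y j - C c (y j)))\<^sup>2" for j c
  have u: "integrable CS (u j)" "(\<integral>c. u j c \<partial>CS) \<le> (1 - \<delta>) * (norm (y j))\<^sup>2" for j
    using assms unfolding compression_operator_def u_def by (auto simp: norm_minus_commute)
  show "integrable D (\<lambda>z. (norm (y (draw_index z) - C (draw_cseed z) (y (draw_index z))))\<^sup>2)"
    using integral_draw_cseed(1)[of u] u(1) unfolding u_def by simp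
  have "(\<integral>z. u (draw_index z) (draw_cseed z) \<partial>D) = avg m (\<lambda>j. \<integral>c. u j c \<partial>CS)"
    by (rule integral_draw_cseed(2)[OF u(1)])
  also have "\<dots> \<le> avg m (\<lambda>j. (1 - \<delta>) * (norm (y j))\<^sup>2)"
    by (intro avg_mono u(2))
  finally show "(\<integral>z. (norm (y (draw_index z) - C (draw_cseed z) (y (draw_index z))))\<^sup>2 \<partial>D)
      \<le> (1 - \<delta>) * avg m (\<lambda>j. (norm (y j))\<^sup>2)"
    unfolding u_def avg_mult .
qed

text \<open>Unbiasedness splits the step into its mean \<open>a + \<alpha> y\<close> and a centred part of second moment at most
  \<open>\<alpha>\<^sup>2 \<omega> (norm y)\<^sup>2\<close>.  The restriction on \<open>\<alpha>\<close> merges both quadratic terms in \<open>y\<close> into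
  \<open>\<alpha> (norm y)\<^sup>2\<close>, and the result is a convex combination.\<close>

lemma quantized_step:
  fixes a y :: "'a::euclidean_space"
  assumes "quantization_operator \<omega> QS Q" and "0 < \<omega>" and "0 < \<alpha>" "\<alpha> \<le> 1 / (\<omega> + 1)"
  shows "integrable QS (\<lambda>q. (norm (a + \<alpha> *\<^sub>R Q q y))\<^sup>2)"
    and "(\<integral>q. (norm (a + \<alpha> *\<^sub>R Q q y))\<^sup>2 \<partial>QS) \<le> (1 - \<alpha>) * (norm a)\<^sup>2 + \<alpha> * (norm (a + y))\<^sup>2"
proof -
  interpret QS: prob_space QS by (rule prob_QS)
  have Q: "integrable QS (\<lambda>q. Q q y)" "(\<integral>q. Q q y \<partial>QS) = y"
    "integrable QS (\<lambda>q. (norm (Q q y - y))\<^sup>2)"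
    "(\<integral>q. (norm (Q q y - y))\<^sup>2 \<partial>QS) \<le> \<omega> * (norm y)\<^sup>2"
    using assms(1) unfolding quantization_operator_def by auto
  \<comment> \<open>the mean of the step\<close>
  define b where "b = a + \<alpha> *\<^sub>R y"
  have split: "(norm (a + \<alpha> *\<^sub>R Q q y))\<^sup>2
      = \<alpha>\<^sup>2 * (norm (Q q y - y))\<^sup>2 + (2 * \<alpha> * (inner (Q q y) b - inner y b) + (norm b)\<^sup>2)" for q
  proof -
    have "a + \<alpha> *\<^sub>R Q q y = \<alpha> *\<^sub>R (Q q y - y) + b" by (simp add: b_def algebra_simps)
    then show ?thesis
      
      by (simp only: norm_add_sq norm_scaleR power_mult_distrib power2_abs inner_scaleR_left inner_diff_left)
  qed
  have int: "integrable QS (\<lambda>q. inner (Q q y) b)"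
    using Q(1) by simp
  have mean: "(\<integral>q. inner (Q q y) b \<partial>QS) = inner y b"
    using integral_inner_left[OF Q(1)] Q(2) by simp
  show "integrable QS (\<lambda>q. (norm (a + \<alpha> *\<^sub>R Q q y))\<^sup>2)"
    unfolding split using int Q(3) by simp
  have "(\<integral>q. (norm (a + \<alpha> *\<^sub>R Q q y))\<^sup>2 \<partial>QS)
      = \<alpha>\<^sup>2 * (\<integral>q. (norm (Q q y - y))\<^sup>2 \<partial>QS) + (norm b)\<^sup>2"
    unfolding split using int Q(3) mean by (simp add: QS.prob_space)
  also have "\<dots> \<le> \<alpha>\<^sup>2 * (\<omega> * (norm y)\<^sup>2) + (norm b)\<^sup>2"
    using Q(4) by (intro add_right_mono mult_left_mono) auto
  also have "\<dots> = (norm a)\<^sup>2 + 2 * \<alpha> * inner a y + \<alpha> * (\<alpha> * (\<omega> + 1)) * (norm y)\<^sup>2"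
    unfolding b_def norm_add_sq by (simp add: power_mult_distrib power2_eq_square algebra_simps)
  also have "\<dots> \<le> (norm a)\<^sup>2 + 2 * \<alpha> * inner a y + \<alpha> * 1 * (norm y)\<^sup>2"
    using assms by (intro add_left_mono mult_right_mono mult_left_mono) (auto simp: field_simps)
  also have "\<dots> = (1 - \<alpha>) * (norm a)\<^sup>2 + \<alpha> * (norm (a + y))\<^sup>2"
    unfolding norm_add_sq by (simp add: algebra_simps)
  finally show "(\<integral>q. (norm (a + \<alpha> *\<^sub>R Q q y))\<^sup>2 \<partial>QS)
    \<le> (1 - \<alpha>) * (norm a)\<^sup>2 + \<alpha> * (norm (a + y))\<^sup>2" .
qed

lemma quantized_step_draw:
  fixes a :: "'a::euclidean_space" and y :: "nat \<Rightarrow> 'a"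
  assumes "quantization_operator \<omega> QS Q" and "0 < \<omega>" and "0 < \<alpha>" "\<alpha> \<le> 1 / (\<omega> + 1)"
  shows "integrable D (\<lambda>z. (norm (a + \<alpha> *\<^sub>R Q (draw_qseed z) (y (draw_index z))))\<^sup>2)"
    and "(\<integral>z. (norm (a + \<alpha> *\<^sub>R Q (draw_qseed z) (y (draw_index z))))\<^sup>2 \<partial>D)
      \<le> (1 - \<alpha>) * (norm a)\<^sup>2 + \<alpha> * avg m (\<lambda>j. (norm (a + y j))\<^sup>2)"
proof -
  define u where "u j q = (norm (a + \<alpha> *\<^sub>R Q q (y j)))\<^sup>2" for j q
  have u1: "integrable QS (u j)" for j
    unfolding u_def by (rule quantized_step[OF assms])
  show "integrable D (\<lambda>z. (norm (a + \<alpha> *\<^sub>R Q (draw_qseed z) (y (draw_index z))))\<^sup>2)"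
    using integral_draw_qseed(1)[OF u1] unfolding u_def .
  have "(\<integral>z. u (draw_index z) (draw_qseed z) \<partial>D) = avg m (\<lambda>j. \<integral>q. u j q \<partial>QS)"
    by (rule integral_draw_qseed(2)[OF u1])
  also have "\<dots> \<le> avg m (\<lambda>j. (1 - \<alpha>) * (norm a)\<^sup>2 + \<alpha> * (norm (a + y j))\<^sup>2)"
    unfolding u_def by (intro avg_mono quantized_step[OF assms])
  also have "\<dots> = (1 - \<alpha>) * (norm a)\<^sup>2 + \<alpha> * avg m (\<lambda>j. (norm (a + y j))\<^sup>2)"
    using m_pos by (simp add: avg_add avg_mult avg_const)
  finally show "(\<integral>z. (norm (a + \<alpha> *\<^sub>R Q (draw_qseed z) (y (draw_index z))))\<^sup>2 \<partial>D)
      \<le> (1 - \<alpha>) * (norm a)\<^sup>2 + \<alpha> * avg m (\<lambda>j. (norm (a + y j))\<^sup>2)"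
    unfolding u_def .
qed

end

section \<open>The algorithm and its history\<close>

text \<open>The algorithm with the auxiliary sequences \<open>ghat\<close> and \<open>v\<close> substituted away, and with every random
  choice read off the draw of the worker.\<close>

locale ec_lsvrg_diana = finite_sum_problem n m fs xstar L \<mu>
  for n m :: nat
    and fs :: "nat \<Rightarrow> nat \<Rightarrow> real ^ 'd \<Rightarrow> real"
    and xstar :: "real ^ 'd"
    and L \<mu> :: real +
  fixes \<delta> \<omega> p \<alpha> \<gamma> :: real
    and CS :: "'c measure" and C :: "'c \<Rightarrow> real ^ 'd \<Rightarrow> real ^ 'd"
    and QS :: "'q measure" and Q :: "'q \<Rightarrow> real ^ 'd \<Rightarrow> real ^ 'd"
    and M :: "'o measure"
    and draw :: "nat \<Rightarrow> nat \<Rightarrow> 'o \<Rightarrow> nat \<times> bool \<times> 'c \<times> 'q"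
    and x0 :: "real ^ 'd" and h0 w0 :: "nat \<Rightarrow> real ^ 'd"
    and x :: "nat \<Rightarrow> 'o \<Rightarrow> real ^ 'd"
    and w h e g :: "nat \<Rightarrow> nat \<Rightarrow> 'o \<Rightarrow> real ^ 'd"
  assumes compression: "0 < \<delta>" "\<delta> \<le> 1" "compression_operator \<delta> CS C"
    and quantization: "\<omega> > 0" "quantization_operator \<omega> QS Q"
    and p: "0 < p" "p < 1"
    and alpha: "0 < \<alpha>" "\<alpha> \<le> 1 / (\<omega> + 1)"
    and gamma_pos: "0 < \<gamma>"
    and prob: "prob_space M"
    and distr_draw: "\<And>k i. i \<in> {1..n} \<Longrightarrow>
           distr M (draw_law m p CS QS) (draw k i) = draw_law m p CS QS"
    and draw_indep: "prob_space.indep_vars M (\<lambda>_. draw_law m p CS QS)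
           (\<lambda>(k, i). draw k i) (UNIV \<times> {1..n})"
    and index_range: "\<And>k i s. i \<in> {1..n} \<Longrightarrow> s \<in> space M \<Longrightarrow> draw_index (draw k i s) \<in> {1..m}"
    and x_init: "\<And>s. s \<in> space M \<Longrightarrow> x 0 s = x0"
    and h_init: "\<And>i s. i \<in> {1..n} \<Longrightarrow> s \<in> space M \<Longrightarrow> h 0 i s = h0 i"
    and w_init: "\<And>i s. i \<in> {1..n} \<Longrightarrow> s \<in> space M \<Longrightarrow> w 0 i s = w0 i"
    and e_init: "\<And>i s. i \<in> {1..n} \<Longrightarrow> s \<in> space M \<Longrightarrow> e 0 i s = 0"
    and g_step: "\<And>k i s. i \<in> {1..n} \<Longrightarrow> s \<in> space M \<Longrightarrow>
           g k i s = estimator i (draw_index (draw k i s)) (x k s) (w k i s)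
             - h k i s + avg n (\<lambda>i'. h k i' s)"
    and e_step: "\<And>k i s. i \<in> {1..n} \<Longrightarrow> s \<in> space M \<Longrightarrow>
           e (Suc k) i s = e k i s + \<gamma> *\<^sub>R g k i s
             - C (draw_cseed (draw k i s)) (e k i s + \<gamma> *\<^sub>R g k i s)"
    and h_step: "\<And>k i s. i \<in> {1..n} \<Longrightarrow> s \<in> space M \<Longrightarrow>
           h (Suc k) i s = h k i s + \<alpha> *\<^sub>R Q (draw_qseed (draw k i s))
             (estimator i (draw_index (draw k i s)) (x k s) (w k i s) - h k i s)"
    and w_step: "\<And>k i s. i \<in> {1..n} \<Longrightarrow> s \<in> space M \<Longrightarrow>
           w (Suc k) i s = (if draw_coin (draw k i s) then x k s else w k i s)"
    and x_step: "\<And>k s. s \<in> space M \<Longrightarrow>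
           x (Suc k) s = x k s - avg n (\<lambda>i. e k i s + \<gamma> *\<^sub>R g k i s - e (Suc k) i s)"
begin

sublocale worker_draws m p CS QS
proof (rule worker_draws.intro)
  show "prob_space CS"
    using compression(3) unfolding compression_operator_def randomized_operator_def by blast
  show "prob_space QS"
    using quantization(2) unfolding quantization_operator_def randomized_operator_def by blast
qed (rule m_pos p)+

sublocale M: prob_space M by (rule prob)

abbreviation "\<F> \<equiv> history M D n draw"
abbreviation "past_draws k s \<equiv> (\<lambda>(t, i)\<in>{..<k} \<times> {1..n}. draw t i s)"

lemma draw_measurable_M: "i \<in> {1..n} \<Longrightarrow> draw k i \<in> measurable M D"
proof -
  assume "i \<in> {1..n}"
  then have "(k, i) \<in> UNIV \<times> {1..n}" by simp
  then show ?thesis using draw_indep unfolding M.indep_vars_def2 by force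
qed

lemma past_draws_measurable_M:
  "past_draws k \<in> measurable M (\<Pi>\<^sub>M _\<in>{..<k} \<times> {1..n}. D)"
  by (rule measurable_restrict) (auto intro: draw_measurable_M)

lemma space_history: "space (\<F> k) = space M"
  by (simp add: history_def)

lemma past_draws_measurable:
  "past_draws k \<in> measurable (\<F> k) (\<Pi>\<^sub>M _\<in>{..<k} \<times> {1..n}. D)"
  unfolding history_def
  by (rule measurable_vimage_algebra1) (rule Pi_I, rule measurable_space[OF past_draws_measurable_M])

lemma subalgebra_history: "subalgebra M (\<F> k)"
  unfolding subalgebra_def space_history
  using sets_image_in_sets[OF refl past_draws_measurable_M] by (simp add: history_def)

lemma draw_measurable_history:
  assumes "t < k" "i \<in> {1..n}"
  shows "draw t i \<in> measurable (\<F> k) D"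
proof -
  have "(\<lambda>s. past_draws k s (t, i)) \<in> measurable (\<F> k) D"
    by (rule measurable_compose[OF past_draws_measurable measurable_component_singleton])
       (use assms in auto)
  then show ?thesis using assms by simp
qed

lemma history_mono:
  assumes "X \<in> measurable (\<F> k) N"
  shows "X \<in> measurable (\<F> (Suc k)) N"
proof -
  have "past_draws k \<in> measurable (\<F> (Suc k)) (\<Pi>\<^sub>M _\<in>{..<k} \<times> {1..n}. D)"
    by (rule measurable_restrict) (auto intro: draw_measurable_history)
  then have "sets (\<F> k) \<subseteq> sets (\<F> (Suc k))"
    unfolding history_def[of M D n draw k] by (intro sets_image_in_sets space_history)
  then show ?thesis using assms by (auto simp: measurable_def space_history)
qed

lemma history_to_M: "X \<in> measurable (\<F> k) N \<Longrightarrow> X \<in> measurable M N"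
  by (rule measurable_from_subalg[OF subalgebra_history])

text \<open>The history and the current draw of a worker are restrictions of one independent family to
  disjoint sets of indices.\<close>

lemma fresh:
  assumes i: "i \<in> {1..n}"
  shows "fresh_draw M (\<F> k) D D (draw k i)"
proof
  show "subalgebra M (\<F> k)" by (rule subalgebra_history)
  show "draw k i \<in> measurable M D" by (rule draw_measurable_M[OF i])
  show "distr M D (draw k i) = D" by (rule distr_draw[OF i])
next
  fix A B assume A: "A \<in> sets (\<F> k)" and B: "B \<in> sets D"
  let ?P = "\<Pi>\<^sub>M _\<in>{..<k} \<times> {1..n}. D" and ?S = "\<Pi>\<^sub>M _\<in>{(k, i)}. D"
  let ?Y = "\<lambda>s. restrict (\<lambda>(t, i). draw t i s) {(k, i)}"
  obtain A' where A': "A' \<in> sets ?P" "A = past_draws k -` A' \<inter> space M"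
    using A measurable_space[OF past_draws_measurable_M]
    unfolding history_def by (subst (asm) sets_vimage_algebra2) auto
  define B' where "B' = (\<lambda>u. u (k, i)) -` B \<inter> space ?S"
  have comp: "(\<lambda>u. u (k, i)) \<in> measurable ?S D" by (rule measurable_component_singleton) simp
  have B': "B' \<in> sets ?S" unfolding B'_def using comp B by (rule measurable_sets)
  have Y: "?Y s \<in> space ?S" if "s \<in> space M" for s
    using measurable_space[OF draw_measurable_M[OF i] that] by (auto simp: space_PiM)
  have "?Y -` B' \<inter> space M = draw k i -` B \<inter> space M"
    unfolding B'_def using Y by auto
  moreover have "M.indep_var ?P (past_draws k) ?S ?Y"
    using M.indep_var_restrict[OF draw_indep, of "{..<k} \<times> {1..n}" "{(k, i)}"] i
    by (auto simp: case_prod_beta')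
  then have "M.prob ((\<lambda>s. (past_draws k s, ?Y s)) -` (A' \<times> B') \<inter> space M)
      = M.prob (past_draws k -` A' \<inter> space M) * M.prob (?Y -` B' \<inter> space M)"
    by (rule M.indep_varD[OF _ A'(1) B'])
  moreover have "(\<lambda>s. (past_draws k s, ?Y s)) -` (A' \<times> B') \<inter> space M = A \<inter> (?Y -` B' \<inter> space M)"
    unfolding A'(2) by blast
  ultimately show "M.prob (A \<inter> (draw k i -` B \<inter> space M)) = M.prob A * M.prob (draw k i -` B \<inter> space M)"
    using A'(2) by simp
qed

end

section \<open>Measurability and averages\<close>

lemma lipschitz_measurable:
  fixes G :: "'a::euclidean_space \<Rightarrow> 'b::euclidean_space"
  assumes "\<And>a b. norm (G a - G b) \<le> L * norm (a - b)" and "0 \<le> L"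
  shows "G \<in> borel_measurable borel"
proof (rule borel_measurable_continuous_onI)
  have "L-lipschitz_on UNIV G" using assms by (intro lipschitz_onI) (auto simp: dist_norm)
  then show "continuous_on UNIV G" by (rule lipschitz_on_continuous_on)
qed

lemma integrable_avg:
  fixes X :: "nat \<Rightarrow> 'o \<Rightarrow> real"
  assumes "\<And>i. i \<in> {1..n} \<Longrightarrow> integrable M (X i)"
  shows "integrable M (\<lambda>s. avg n (\<lambda>i. X i s))"
  unfolding avg_def
  by (intro integrable_scaleR_right Bochner_Integration.integrable_sum assms)

lemma (in sigma_finite_subalgebra) real_cond_exp_avg:
  assumes "\<And>i. i \<in> {1..n} \<Longrightarrow> integrable M (X i)"
  shows "AE s in M. real_cond_exp M F (\<lambda>s. avg n (\<lambda>i. X i s)) s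
    = avg n (\<lambda>i. real_cond_exp M F (X i) s)"
proof -
  \<comment> \<open>the rule for sums asks for integrability at every index\<close>
  define Y where "Y i = (if i \<in> {1..n} then X i else (\<lambda>_. 0))" for i
  have Y: "integrable M (Y i)" for i using assms by (simp add: Y_def)
  have "AE s in M. real_cond_exp M F (\<lambda>s. (1 / real n) * (\<Sum>i=1..n. Y i s)) s
      = (1 / real n) * real_cond_exp M F (\<lambda>s. \<Sum>i=1..n. Y i s) s"
    by (rule real_cond_exp_cmult) (use Y in auto)
  moreover have "AE s in M. real_cond_exp M F (\<lambda>s. \<Sum>i=1..n. Y i s) s
      = (\<Sum>i=1..n. real_cond_exp M F (Y i) s)"
    by (rule real_cond_exp_sum) (rule Y)
  moreover have "(\<lambda>s. (1 / real n) * (\<Sum>i=1..n. Y i s)) = (\<lambda>s. avg n (\<lambda>i. X i s))"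
    by (auto simp: avg_def Y_def)
  ultimately show ?thesis
    by (auto simp: avg_def Y_def)
qed

section \<open>One iteration, conditionally on the past\<close>

context finite_sum_problem
begin

lemma worker_grad_lipschitz:
  "i \<in> {1..n} \<Longrightarrow> norm (worker_grad i a - worker_grad i b) \<le> L * norm (a - b)"
  by (rule smooth_lipschitz[OF smooth_worker])

lemma comp_grad_lipschitz:
  "i \<in> {1..n} \<Longrightarrow> norm (comp_grad i j a - comp_grad i j b) \<le> L * norm (a - b)"
  unfolding comp_grad_def using smooth_lipschitz[OF smooth] L_pos by simp

lemma worker_grad_measurable: "i \<in> {1..n} \<Longrightarrow> worker_grad i \<in> borel_measurable borel"
  using lipschitz_measurable[OF worker_grad_lipschitz] L_pos by simp

lemma comp_grad_measurable: "i \<in> {1..n} \<Longrightarrow> comp_grad i j \<in> borel_measurable borel"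
  using lipschitz_measurable[OF comp_grad_lipschitz] L_pos by simp

lemma f_measurable: "f \<in> borel_measurable borel"
proof (rule borel_measurable_continuous_onI)
  show "continuous_on UNIV f"
    unfolding continuous_on_eq_continuous_at[OF open_UNIV]
    using has_derivative_continuous smooth_GDERIV[OF smooth_objective] unfolding gderiv_def by blast
qed

end

context ec_lsvrg_diana
begin

abbreviation "hbar k s \<equiv> avg n (\<lambda>i. h k i s)"

text \<open>The next quantities as functions of a pair of a sample point, which only enters through the past,
  and a value of the draw.  In this form the draw can be integrated out while the past is frozen.\<close>

definition step_estimate :: "nat \<Rightarrow> nat \<Rightarrow> 'o \<times> nat \<times> bool \<times> 'c \<times> 'q \<Rightarrow> real ^ 'd" where
  "step_estimate k i u = estimator i (draw_index (snd u)) (x k (fst u)) (w k i (fst u))"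

definition step_direction :: "nat \<Rightarrow> nat \<Rightarrow> 'o \<times> nat \<times> bool \<times> 'c \<times> 'q \<Rightarrow> real ^ 'd" where
  "step_direction k i u = step_estimate k i u - h k i (fst u) + hbar k (fst u)"

definition step_error :: "nat \<Rightarrow> nat \<Rightarrow> 'o \<times> nat \<times> bool \<times> 'c \<times> 'q \<Rightarrow> real ^ 'd" where
  "step_error k i u = e k i (fst u) + \<gamma> *\<^sub>R step_direction k i u
     - C (draw_cseed (snd u)) (e k i (fst u) + \<gamma> *\<^sub>R step_direction k i u)"

definition step_shift :: "nat \<Rightarrow> nat \<Rightarrow> 'o \<times> nat \<times> bool \<times> 'c \<times> 'q \<Rightarrow> real ^ 'd" where
  "step_shift k i u = h k i (fst u)
     + \<alpha> *\<^sub>R Q (draw_qseed (snd u)) (step_estimate k i u - h k i (fst u))"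

definition step_anchor :: "nat \<Rightarrow> nat \<Rightarrow> 'o \<times> nat \<times> bool \<times> 'c \<times> 'q \<Rightarrow> real ^ 'd" where
  "step_anchor k i u = (if draw_coin (snd u) then x k (fst u) else w k i (fst u))"

lemma steps:
  assumes "i \<in> {1..n}" "s \<in> space M"
  shows "g k i s = step_direction k i (s, draw k i s)"
    and "e (Suc k) i s = step_error k i (s, draw k i s)"
    and "h (Suc k) i s = step_shift k i (s, draw k i s)"
    and "w (Suc k) i s = step_anchor k i (s, draw k i s)"
  using assms
  by (simp_all add: step_direction_def step_estimate_def step_error_def step_shift_def
      step_anchor_def g_step e_step h_step w_step)

definition adapted :: "nat \<Rightarrow> bool" where
  "adapted k \<longleftrightarrow> x k \<in> borel_measurable (\<F> k) \<and>
    (\<forall>i\<in>{1..n}. w k i \<in> borel_measurable (\<F> k) \<and> h k i \<in> borel_measurable (\<F> k)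
      \<and> e k i \<in> borel_measurable (\<F> k))"

text \<open>The index is discrete, so joint measurability follows from measurability for every fixed index.\<close>

lemma step_measurable:
  assumes i: "i \<in> {1..n}" and "adapted k"
  shows "step_estimate k i \<in> borel_measurable (\<F> k \<Otimes>\<^sub>M D)"
    and "step_direction k i \<in> borel_measurable (\<F> k \<Otimes>\<^sub>M D)"
    and "step_error k i \<in> borel_measurable (\<F> k \<Otimes>\<^sub>M D)"
    and "step_shift k i \<in> borel_measurable (\<F> k \<Otimes>\<^sub>M D)"
    and "step_anchor k i \<in> borel_measurable (\<F> k \<Otimes>\<^sub>M D)"
proof -
  have [measurable]: "x k \<in> borel_measurable (\<F> k)" "w k i \<in> borel_measurable (\<F> k)"
    "e k i \<in> borel_measurable (\<F> k)" "h k i \<in> borel_measurable (\<F> k)"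
    using assms unfolding adapted_def by auto
  have h: "h k i' \<in> borel_measurable (\<F> k)" if "i' \<in> {1..n}" for i'
    using that assms unfolding adapted_def by auto
  have [measurable]: "hbar k \<in> borel_measurable (\<F> k)"
    unfolding avg_def by (intro borel_measurable_scaleR borel_measurable_sum h) auto
  have [measurable]: "comp_grad i j \<in> borel_measurable borel"
    "worker_grad i \<in> borel_measurable borel" for j
    by (rule comp_grad_measurable[OF i] worker_grad_measurable[OF i])+
  have [measurable]: "(\<lambda>(c, y). C c y) \<in> borel_measurable (CS \<Otimes>\<^sub>M borel)"
    "(\<lambda>(q, y). Q q y) \<in> borel_measurable (QS \<Otimes>\<^sub>M borel)"
    using compression(3) quantization(2)
    unfolding compression_operator_def quantization_operator_def randomized_operator_def by auto
  have index: "(\<lambda>u. draw_index (snd u)) \<in> measurable (\<F> k \<Otimes>\<^sub>M D) (count_space UNIV)"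
    by measurable
  have [measurable]: "step_estimate k i \<in> borel_measurable (\<F> k \<Otimes>\<^sub>M D)"
    unfolding step_estimate_def
    by (rule measurable_compose_countable[OF _ index,
          where f="\<lambda>j u. estimator i j (x k (fst u)) (w k i (fst u))"])
       (unfold estimator_def, measurable)
  then show "step_estimate k i \<in> borel_measurable (\<F> k \<Otimes>\<^sub>M D)" .
  have [measurable]: "step_direction k i \<in> borel_measurable (\<F> k \<Otimes>\<^sub>M D)"
    unfolding step_direction_def by measurable
  then show "step_direction k i \<in> borel_measurable (\<F> k \<Otimes>\<^sub>M D)" .
  show "step_error k i \<in> borel_measurable (\<F> k \<Otimes>\<^sub>M D)"
    unfolding step_error_def by measurable
  show "step_shift k i \<in> borel_measurable (\<F> k \<Otimes>\<^sub>M D)"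
    unfolding step_shift_def by measurable
  show "step_anchor k i \<in> borel_measurable (\<F> k \<Otimes>\<^sub>M D)"
    unfolding step_anchor_def by measurable
qed

lemma adapted: "adapted k"
proof (induction k)
  case 0
  have "x 0 \<in> borel_measurable (\<F> 0)"
    by (subst measurable_cong[where g="\<lambda>_. x0"]) (auto simp: space_history x_init)
  moreover have "w 0 i \<in> borel_measurable (\<F> 0)" "h 0 i \<in> borel_measurable (\<F> 0)"
    "e 0 i \<in> borel_measurable (\<F> 0)" if i: "i \<in> {1..n}" for i
  proof -
    show "w 0 i \<in> borel_measurable (\<F> 0)"
      by (subst measurable_cong[where g="\<lambda>_. w0 i"]) (use i in \<open>auto simp: space_history w_init\<close>)
    show "h 0 i \<in> borel_measurable (\<F> 0)"
      by (subst measurable_cong[where g="\<lambda>_. h0 i"]) (use i in \<open>auto simp: space_history h_init\<close>)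
    show "e 0 i \<in> borel_measurable (\<F> 0)"
      by (subst measurable_cong[where g="\<lambda>_. 0"]) (use i in \<open>auto simp: space_history e_init\<close>)
  qed
  ultimately show ?case unfolding adapted_def by blast
next
  case (Suc k)
  have pair: "(\<lambda>s. (s, draw k i s)) \<in> measurable (\<F> (Suc k)) (\<F> k \<Otimes>\<^sub>M D)" if "i \<in> {1..n}" for i
    using that by (intro measurable_Pair history_mono draw_measurable_history) auto
  have step: "X \<in> borel_measurable (\<F> (Suc k))"
    if "i \<in> {1..n}" "\<phi> \<in> borel_measurable (\<F> k \<Otimes>\<^sub>M D)"
      "\<And>s. s \<in> space M \<Longrightarrow> X s = \<phi> (s, draw k i s)"
    for i X and \<phi> :: "_ \<Rightarrow> real ^ 'd"
    using measurable_compose[OF pair[OF that(1)] that(2)] that(3)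
    by (subst measurable_cong[where g="\<lambda>s. \<phi> (s, draw k i s)"]) (auto simp: space_history)
  have e: "e (Suc k) i \<in> borel_measurable (\<F> (Suc k))"
    and g: "g k i \<in> borel_measurable (\<F> (Suc k))"
    and h: "h (Suc k) i \<in> borel_measurable (\<F> (Suc k))"
    and w: "w (Suc k) i \<in> borel_measurable (\<F> (Suc k))" if i: "i \<in> {1..n}" for i
    using step[OF i] step_measurable[OF i Suc] steps[OF i] by metis+
  have e': "e k i \<in> borel_measurable (\<F> (Suc k))" if i: "i \<in> {1..n}" for i
    using Suc i unfolding adapted_def by (blast intro: history_mono)
  have x': "x k \<in> borel_measurable (\<F> (Suc k))"
    using Suc unfolding adapted_def by (blast intro: history_mono)
  have "(\<lambda>s. x k s - avg n (\<lambda>i. e k i s + \<gamma> *\<^sub>R g k i s - e (Suc k) i s))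
      \<in> borel_measurable (\<F> (Suc k))"
    unfolding avg_def
    by (intro borel_measurable_diff borel_measurable_scaleR borel_measurable_sum
        borel_measurable_add borel_measurable_const x' e e' g)
  then have "x (Suc k) \<in> borel_measurable (\<F> (Suc k))"
    by (subst measurable_cong[where
          g="\<lambda>s. x k s - avg n (\<lambda>i. e k i s + \<gamma> *\<^sub>R g k i s - e (Suc k) i s)"])
       (auto simp: space_history x_step)
  with e h w show ?case unfolding adapted_def by blast
qed

lemma adapted_measurable:
  "x k \<in> borel_measurable (\<F> k)"
  "i \<in> {1..n} \<Longrightarrow> w k i \<in> borel_measurable (\<F> k)"
  "i \<in> {1..n} \<Longrightarrow> h k i \<in> borel_measurable (\<F> k)"
  "i \<in> {1..n} \<Longrightarrow> e k i \<in> borel_measurable (\<F> k)"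
  using adapted[of k] unfolding adapted_def by auto

sublocale past: finite_measure_subalgebra M "\<F> k" for k
  by unfold_locales (rule subalgebra_history)

text \<open>Only one worker's draw is integrated at a time: all quantities of interest are averages over the
  workers, or are bounded by such averages.\<close>

lemma worker_step_bound:
  assumes i: "i \<in> {1..n}" and meas: "\<phi> \<in> borel_measurable (\<F> k \<Otimes>\<^sub>M D)"
    and nonneg: "\<And>u. 0 \<le> (\<phi> u :: real)"
    and X: "\<And>s. s \<in> space M \<Longrightarrow> X s = \<phi> (s, draw k i s)"
    and sections: "\<And>s. s \<in> space M \<Longrightarrow> integrable D (\<lambda>z. \<phi> (s, z))"
    and bound: "\<And>s. s \<in> space M \<Longrightarrow> (\<integral>z. \<phi> (s, z) \<partial>D) \<le> \<psi> s"
    and int: "integrable M \<psi>"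
  shows "integrable M X" and "AE s in M. real_cond_exp M (\<F> k) X s \<le> \<psi> s"
proof -
  interpret fresh: fresh_draw M "\<F> k" D D "draw k i" by (rule fresh[OF i])
  have *: "integrable M (\<lambda>s. \<phi> (s, draw k i s))"
    "AE s in M. real_cond_exp M (\<F> k) (\<lambda>s. \<phi> (s, draw k i s)) s \<le> \<psi> s"
    by (rule fresh.freezing_bound[where \<psi>=\<psi>]; fact meas nonneg sections bound int)+
  show X_int: "integrable M X"
    using *(1) by (subst Bochner_Integration.integrable_cong[OF refl X]) auto
  have "AE s in M. real_cond_exp M (\<F> k) X s = real_cond_exp M (\<F> k) (\<lambda>s. \<phi> (s, draw k i s)) s"
    by (rule past.real_cond_exp_cong) (use X X_int *(1) in auto)
  with *(2) show "AE s in M. real_cond_exp M (\<F> k) X s \<le> \<psi> s"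
    by eventually_elim simp
qed

lemma average_step_bound:
  assumes "\<And>i. i \<in> {1..n} \<Longrightarrow> integrable M (X i)"
    and "\<And>i. i \<in> {1..n} \<Longrightarrow> AE s in M. real_cond_exp M (\<F> k) (X i) s \<le> \<psi> i s"
    and "\<And>s. s \<in> space M \<Longrightarrow> avg n (\<lambda>i. \<psi> i s) \<le> b s"
  shows "AE s in M. avg n (\<lambda>i. real_cond_exp M (\<F> k) (X i) s) \<le> b s"
    and "AE s in M. real_cond_exp M (\<F> k) (\<lambda>s. avg n (\<lambda>i. X i s)) s \<le> b s"
proof -
  have "AE s in M. \<forall>i\<in>{1..n}. real_cond_exp M (\<F> k) (X i) s \<le> \<psi> i s"
    using assms(2) by (simp add: AE_finite_all)
  then show *: "AE s in M. avg n (\<lambda>i. real_cond_exp M (\<F> k) (X i) s) \<le> b s"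
    using AE_space
  proof eventually_elim
    case (elim s)
    then have "avg n (\<lambda>i. real_cond_exp M (\<F> k) (X i) s) \<le> avg n (\<lambda>i. \<psi> i s)"
      by (intro avg_mono) auto
    also have "\<dots> \<le> b s" using elim assms(3) by simp
    finally show ?case .
  qed
  have "AE s in M. real_cond_exp M (\<F> k) (\<lambda>s. avg n (\<lambda>i. X i s)) s
    = avg n (\<lambda>i. real_cond_exp M (\<F> k) (X i) s)"
    by (rule past.real_cond_exp_avg[OF assms(1)])
  with * show "AE s in M. real_cond_exp M (\<F> k) (\<lambda>s. avg n (\<lambda>i. X i s)) s \<le> b s"
    by eventually_elim simp
qed

lemma expectation_le:
  assumes "integrable M X" "integrable M b" "AE s in M. real_cond_exp M (\<F> k) X s \<le> b s"
  shows "(\<integral>s. X s \<partial>M) \<le> (\<integral>s. b s \<partial>M)"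
  using integral_mono_AE[OF past.real_cond_exp_int(1)[OF assms(1)] assms(2,3)]
    past.real_cond_exp_int(2)[OF assms(1)] by simp

end

lemma avg_component: "avg m (\<lambda>j. a j $ c) = avg m a $ c" for a :: "nat \<Rightarrow> real ^ 'd"
  by (simp add: avg_def)

context ec_lsvrg_diana
begin

text \<open>A quantity that depends on the draw through the index alone takes one of \<open>m\<close> values; it is
  dominated by the sum of their absolute values, and its conditional mean is their average.\<close>

lemma index_cond_exp:
  fixes u :: "nat \<Rightarrow> 'o \<Rightarrow> real"
  assumes i: "i \<in> {1..n}"
    and X: "\<And>s. s \<in> space M \<Longrightarrow> X s = u (draw_index (draw k i s)) s"
    and meas: "\<And>j. u j \<in> borel_measurable (\<F> k)"
    and int: "\<And>j. j \<in> {1..m} \<Longrightarrow> integrable M (u j)"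
  shows "integrable M X"
    and "AE s in M. real_cond_exp M (\<F> k) X s = avg m (\<lambda>j. u j s)"
    and "(\<integral>s. X s \<partial>M) = (\<integral>s. avg m (\<lambda>j. u j s) \<partial>M)"
proof -
  interpret fresh: fresh_draw M "\<F> k" D D "draw k i" by (rule fresh[OF i])
  define \<phi> where "\<phi> v = u (draw_index (snd v)) (fst v)" for v :: "'o \<times> nat \<times> bool \<times> 'c \<times> 'q"
  have index: "(\<lambda>v. draw_index (snd v)) \<in> measurable (\<F> k \<Otimes>\<^sub>M D) (count_space UNIV)"
    by measurable
  have \<phi>: "\<phi> \<in> borel_measurable (\<F> k \<Otimes>\<^sub>M D)"
    unfolding \<phi>_def
    by (rule measurable_compose_countable[OF _ index, where f="\<lambda>j v. u j (fst v)"])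
       (rule measurable_compose[OF measurable_fst meas])
  have X_eq: "X s = \<phi> (s, draw k i s)" if "s \<in> space M" for s
    using X[OF that] by (simp add: \<phi>_def)
  have \<phi>_meas: "(\<lambda>s. \<phi> (s, draw k i s)) \<in> borel_measurable M"
    by (rule measurable_compose[OF fresh.pair_measurable \<phi>])
  have \<phi>_int: "integrable M (\<lambda>s. \<phi> (s, draw k i s))"
  proof (rule Bochner_Integration.integrable_bound[OF _ \<phi>_meas])
    show "integrable M (\<lambda>s. \<Sum>j\<in>{1..m}. \<bar>u j s\<bar>)"
      by (intro Bochner_Integration.integrable_sum integrable_abs int)
    have "\<bar>\<phi> (s, draw k i s)\<bar> \<le> (\<Sum>j\<in>{1..m}. \<bar>u j s\<bar>)" if "s \<in> space M" for s
      unfolding \<phi>_def using member_le_sum[OF index_range[OF i that], where f="\<lambda>j. \<bar>u j s\<bar>"] by simp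
    then show "AE s in M. norm (\<phi> (s, draw k i s)) \<le> norm (\<Sum>j\<in>{1..m}. \<bar>u j s\<bar>)"
      by (intro AE_I2) (auto intro: order_trans[OF _ abs_ge_self])
  qed
  then show X_int: "integrable M X"
    by (subst Bochner_Integration.integrable_cong[OF refl X_eq]) auto
  have section_integral: "(\<integral>z. \<phi> (s, z) \<partial>D) = avg m (\<lambda>j. u j s)" for s
    unfolding \<phi>_def using integral_draw_index(2)[of "\<lambda>j. u j s"] by simp
  have "AE s in M. real_cond_exp M (\<F> k) X s = real_cond_exp M (\<F> k) (\<lambda>s. \<phi> (s, draw k i s)) s"
    by (rule past.real_cond_exp_cong) (use X_eq X_int \<phi>_meas in auto)
  with fresh.freezing_cond_exp(1)[OF \<phi> \<phi>_int]
  show "AE s in M. real_cond_exp M (\<F> k) X s = avg m (\<lambda>j. u j s)"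
    unfolding section_integral by eventually_elim simp
  have "(\<integral>s. X s \<partial>M) = (\<integral>s. \<phi> (s, draw k i s) \<partial>M)"
    by (intro Bochner_Integration.integral_cong X_eq refl)
  also have "\<dots> = (\<integral>s. avg m (\<lambda>j. u j s) \<partial>M)"
    using fresh.freezing_cond_exp(2)[OF \<phi> \<phi>_int] unfolding section_integral .
  finally show "(\<integral>s. X s \<partial>M) = (\<integral>s. avg m (\<lambda>j. u j s) \<partial>M)" .
qed

text \<open>The direction \<open>g\<close> with the random index replaced by a fixed one.\<close>

definition direction :: "nat \<Rightarrow> nat \<Rightarrow> nat \<Rightarrow> 'o \<Rightarrow> real ^ 'd" where
  "direction k i j s = estimator i j (x k s) (w k i s) - h k i s + hbar k s"

lemma g_eq_direction:
  "i \<in> {1..n} \<Longrightarrow> s \<in> space M \<Longrightarrow> g k i s = direction k i (draw_index (draw k i s)) s"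
  by (simp add: g_step direction_def)

lemma avg_direction:
  "i \<in> {1..n} \<Longrightarrow> avg m (\<lambda>j. direction k i j s) = worker_grad i (x k s) - h k i s + hbar k s"
  using m_pos by (simp add: direction_def avg_add avg_diff avg_const avg_estimator)

lemma estimator_adapted:
  "i \<in> {1..n} \<Longrightarrow> (\<lambda>s. estimator i j (x k s) (w k i s)) \<in> borel_measurable (\<F> k)"
  unfolding estimator_def
  by (intro borel_measurable_add borel_measurable_diff
      measurable_compose[OF adapted_measurable(1) comp_grad_measurable]
      measurable_compose[OF adapted_measurable(2) comp_grad_measurable]
      measurable_compose[OF adapted_measurable(2) worker_grad_measurable])

lemma hbar_adapted: "hbar k \<in> borel_measurable (\<F> k)"
  unfolding avg_def
  by (intro borel_measurable_scaleR borel_measurable_sum adapted_measurable borel_measurable_const)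

lemma direction_adapted: "i \<in> {1..n} \<Longrightarrow> direction k i j \<in> borel_measurable (\<F> k)"
  unfolding direction_def
  by (intro borel_measurable_add borel_measurable_diff estimator_adapted hbar_adapted
      adapted_measurable)

lemma square_integrable_estimator:
  assumes i: "i \<in> {1..n}" and "square_integrable M X" "square_integrable M U"
  shows "square_integrable M (\<lambda>s. estimator i j (X s) (U s))"
  unfolding estimator_def
  by (intro square_integrable_add square_integrable_diff
      square_integrable_lipschitz[OF M.finite_measure_axioms _ comp_grad_lipschitz[OF i]]
      square_integrable_lipschitz[OF M.finite_measure_axioms _ worker_grad_lipschitz[OF i]]
      comp_grad_measurable worker_grad_measurable assms)

definition state_square_integrable :: "nat \<Rightarrow> bool" where
  "state_square_integrable k \<longleftrightarrow> square_integrable M (x k) \<and>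
    (\<forall>i\<in>{1..n}. square_integrable M (w k i) \<and> square_integrable M (h k i) \<and>
      square_integrable M (e k i))"

lemma square_integrable_direction:
  assumes k: "state_square_integrable k" and i: "i \<in> {1..n}"
  shows "square_integrable M (direction k i j)"
    and "square_integrable M (\<lambda>s. estimator i j (x k s) (w k i s))"
    and "square_integrable M (g k i)"
proof -
  have state: "square_integrable M (x k)" "i \<in> {1..n} \<Longrightarrow> square_integrable M (w k i)"
    "i \<in> {1..n} \<Longrightarrow> square_integrable M (h k i)" for i
    using k unfolding state_square_integrable_def by auto
  show "square_integrable M (\<lambda>s. estimator i j (x k s) (w k i s))" for j
    by (intro square_integrable_estimator state i)
  then show dir: "square_integrable M (direction k i j)" for j
    unfolding direction_def
    by (intro square_integrable_add square_integrable_diff square_integrable_avg state i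
        M.finite_measure_axioms)
  show "square_integrable M (g k i)"
  proof (rule square_integrable_bound)
    have "step_direction k i \<in> borel_measurable (\<F> k \<Otimes>\<^sub>M D)"
      by (rule step_measurable[OF i adapted])
    moreover have "(\<lambda>s. (s, draw k i s)) \<in> measurable M (\<F> k \<Otimes>\<^sub>M D)"
      by (rule fresh_draw.pair_measurable[OF fresh[OF i]])
    ultimately have "(\<lambda>s. step_direction k i (s, draw k i s)) \<in> borel_measurable M"
      by (rule measurable_compose[rotated])
    then show "g k i \<in> borel_measurable M"
      by (subst measurable_cong[OF steps(1)[OF i]])
    show "integrable M (\<lambda>s. \<Sum>j=1..m. (norm (direction k i j s))\<^sup>2)"
      using dir by (intro Bochner_Integration.integrable_sum) (simp add: square_integrable_def)
    show "(norm (g k i s))\<^sup>2 \<le> (\<Sum>j=1..m. (norm (direction k i j s))\<^sup>2)" if "s \<in> space M" for s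
      unfolding g_eq_direction[OF i that]
      using member_le_sum[OF index_range[OF i that], where f="\<lambda>j. (norm (direction k i j s))\<^sup>2"] by simp
  qed
qed

lemma norm_sq_diff_integrable:
  "square_integrable M X \<Longrightarrow> square_integrable M Y \<Longrightarrow> integrable M (\<lambda>s. (norm (X s - Y s))\<^sup>2)"
  using square_integrable_diff[of M X Y] by (simp add: square_integrable_def)

lemma square_integrable_constant: "square_integrable M (\<lambda>s. c)"
  by (rule square_integrable_const[OF M.finite_measure_axioms])

text \<open>Whatever the index, the compressor contracts the vector it is applied to; the average over the
  index remains.\<close>

lemma error_step:
  assumes k: "state_square_integrable k" and i: "i \<in> {1..n}"
  defines "\<psi> \<equiv> \<lambda>s. (1 - \<delta>) * avg m (\<lambda>j. (norm (e k i s + \<gamma> *\<^sub>R direction k i j s))\<^sup>2)"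
  shows "integrable M (\<lambda>s. (norm (e (Suc k) i s))\<^sup>2)"
    and "AE s in M. real_cond_exp M (\<F> k) (\<lambda>s. (norm (e (Suc k) i s))\<^sup>2) s \<le> \<psi> s"
    and "integrable M \<psi>"
proof -
  have e: "square_integrable M (e k i)" using k i unfolding state_square_integrable_def by auto
  have "square_integrable M (\<lambda>s. e k i s + \<gamma> *\<^sub>R direction k i j s)" for j
    by (intro square_integrable_add square_integrable_scaleR square_integrable_direction k i e)
  then show \<psi>: "integrable M \<psi>"
    unfolding \<psi>_def by (intro integrable_mult_right integrable_avg) (simp add: square_integrable_def)
  define \<phi> where "\<phi> u = (norm (step_error k i u))\<^sup>2" for u
  have "\<phi> \<in> borel_measurable (\<F> k \<Otimes>\<^sub>M D)"
    unfolding \<phi>_def using step_measurable(3)[OF i adapted, of k] by simp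
  moreover have "0 \<le> \<phi> u" for u by (simp add: \<phi>_def)
  moreover have "(norm (e (Suc k) i s))\<^sup>2 = \<phi> (s, draw k i s)" if "s \<in> space M" for s
    unfolding \<phi>_def steps(2)[OF i that] ..
  moreover have section_eq: "\<phi> (s, z) = (norm ((e k i s + \<gamma> *\<^sub>R direction k i (draw_index z) s)
      - C (draw_cseed z) (e k i s + \<gamma> *\<^sub>R direction k i (draw_index z) s)))\<^sup>2" for s z
    by (simp add: \<phi>_def step_error_def step_direction_def step_estimate_def direction_def)
  have "integrable D (\<lambda>z. \<phi> (s, z))" "(\<integral>z. \<phi> (s, z) \<partial>D) \<le> \<psi> s" for s
    unfolding section_eq \<psi>_def
    by (rule compression_error[OF compression(3), of "\<lambda>j. e k i s + \<gamma> *\<^sub>R direction k i j s"])+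
  ultimately show "integrable M (\<lambda>s. (norm (e (Suc k) i s))\<^sup>2)"
    and "AE s in M. real_cond_exp M (\<F> k) (\<lambda>s. (norm (e (Suc k) i s))\<^sup>2) s \<le> \<psi> s"
    using worker_step_bound[OF i, of \<phi> k "\<lambda>s. (norm (e (Suc k) i s))\<^sup>2" \<psi>] \<psi> by blast+
qed

text \<open>The shift moves from \<open>h\<close> towards the estimator by a quantized step; measured from \<open>c\<close>, this is
  a convex combination in mean square.\<close>

lemma shift_step:
  fixes c :: "real ^ 'd"
  assumes k: "state_square_integrable k" and i: "i \<in> {1..n}"
  defines "\<psi> \<equiv> \<lambda>s. (1 - \<alpha>) * (norm (h k i s - c))\<^sup>2
    + \<alpha> * avg m (\<lambda>j. (norm (estimator i j (x k s) (w k i s) - c))\<^sup>2)"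
  shows "integrable M (\<lambda>s. (norm (h (Suc k) i s - c))\<^sup>2)"
    and "AE s in M. real_cond_exp M (\<F> k) (\<lambda>s. (norm (h (Suc k) i s - c))\<^sup>2) s \<le> \<psi> s"
    and "integrable M \<psi>"
proof -
  have "square_integrable M (h k i)" using k i unfolding state_square_integrable_def by auto
  then show \<psi>: "integrable M \<psi>"
    unfolding \<psi>_def
    by (intro Bochner_Integration.integrable_add integrable_mult_right integrable_avg
        norm_sq_diff_integrable square_integrable_direction square_integrable_constant k i)
  define \<phi> where "\<phi> u = (norm (step_shift k i u - c))\<^sup>2" for u
  have "\<phi> \<in> borel_measurable (\<F> k \<Otimes>\<^sub>M D)"
    unfolding \<phi>_def using step_measurable(4)[OF i adapted, of k] by simp
  moreover have "0 \<le> \<phi> u" for u by (simp add: \<phi>_def)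
  moreover have "(norm (h (Suc k) i s - c))\<^sup>2 = \<phi> (s, draw k i s)" if "s \<in> space M" for s
    unfolding \<phi>_def steps(3)[OF i that] ..
  moreover have section_eq: "\<phi> (s, z) = (norm ((h k i s - c) + \<alpha> *\<^sub>R Q (draw_qseed z)
      (estimator i (draw_index z) (x k s) (w k i s) - h k i s)))\<^sup>2" for s z
    by (simp add: \<phi>_def step_shift_def step_estimate_def algebra_simps)
  have "integrable D (\<lambda>z. \<phi> (s, z))" "(\<integral>z. \<phi> (s, z) \<partial>D) \<le> \<psi> s" for s
    using quantized_step_draw[OF quantization(2,1) alpha, of "h k i s - c"
        "\<lambda>j. estimator i j (x k s) (w k i s) - h k i s"]
    unfolding section_eq \<psi>_def by simp_all
  ultimately show "integrable M (\<lambda>s. (norm (h (Suc k) i s - c))\<^sup>2)"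
    and "AE s in M. real_cond_exp M (\<F> k) (\<lambda>s. (norm (h (Suc k) i s - c))\<^sup>2) s \<le> \<psi> s"
    using worker_step_bound[OF i, of \<phi> k "\<lambda>s. (norm (h (Suc k) i s - c))\<^sup>2" \<psi>] \<psi> by blast+
qed

text \<open>The gradients grow linearly, and the two randomized operators have bounded conditional second
  moments, so square integrability is inherited along the iteration.\<close>

lemma state_square_integrable: "state_square_integrable k"
proof (induction k)
  case 0
  have "square_integrable M (x 0)"
    by (subst square_integrable_cong[OF x_init]) (auto intro: square_integrable_constant)
  moreover have "square_integrable M (w 0 i)" "square_integrable M (h 0 i)"
    "square_integrable M (e 0 i)" if i: "i \<in> {1..n}" for i
    by (subst square_integrable_cong[OF w_init[OF i]] square_integrable_cong[OF h_init[OF i]]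
        square_integrable_cong[OF e_init[OF i]]; auto intro: square_integrable_constant)+
  ultimately show ?case unfolding state_square_integrable_def by blast
next
  case (Suc k)
  have state: "square_integrable M (x k)" "i \<in> {1..n} \<Longrightarrow> square_integrable M (w k i)"
    "i \<in> {1..n} \<Longrightarrow> square_integrable M (e k i)" for i
    using Suc unfolding state_square_integrable_def by auto
  have meas: "i \<in> {1..n} \<Longrightarrow> w (Suc k) i \<in> borel_measurable M"
    "i \<in> {1..n} \<Longrightarrow> h (Suc k) i \<in> borel_measurable M"
    "i \<in> {1..n} \<Longrightarrow> e (Suc k) i \<in> borel_measurable M" for i
    by (erule history_to_M[OF adapted_measurable(2)] history_to_M[OF adapted_measurable(3)]
        history_to_M[OF adapted_measurable(4)])+
  have e: "square_integrable M (e (Suc k) i)" if "i \<in> {1..n}" for i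
    unfolding square_integrable_def using error_step(1)[OF Suc that] meas that by simp
  have h: "square_integrable M (h (Suc k) i)" if "i \<in> {1..n}" for i
    unfolding square_integrable_def using shift_step(1)[OF Suc that, of 0] meas that by simp
  have w: "square_integrable M (w (Suc k) i)" if i: "i \<in> {1..n}" for i
  proof (rule square_integrable_bound)
    show "integrable M (\<lambda>s. (norm (x k s))\<^sup>2 + (norm (w k i s))\<^sup>2)"
      using state i by (simp add: square_integrable_def)
  qed (use meas i in \<open>auto simp: w_step\<close>)
  have "square_integrable M
      (\<lambda>s. x k s - avg n (\<lambda>i. e k i s + \<gamma> *\<^sub>R g k i s - e (Suc k) i s))"
    by (intro square_integrable_diff square_integrable_avg square_integrable_add
        square_integrable_scaleR square_integrable_direction Suc e state M.finite_measure_axioms)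
  then have "square_integrable M (x (Suc k))"
    by (subst square_integrable_cong[OF x_step])
  with e h w show ?case unfolding state_square_integrable_def by blast
qed

lemma square_integrable_state:
  "square_integrable M (x k)"
  "i \<in> {1..n} \<Longrightarrow> square_integrable M (w k i)"
  "i \<in> {1..n} \<Longrightarrow> square_integrable M (h k i)"
  "i \<in> {1..n} \<Longrightarrow> square_integrable M (e k i)"
  "i \<in> {1..n} \<Longrightarrow> square_integrable M (g k i)"
  "i \<in> {1..n} \<Longrightarrow> square_integrable M (direction k i j)"
  "i \<in> {1..n} \<Longrightarrow> square_integrable M (\<lambda>s. estimator i j (x k s) (w k i s))"
  using state_square_integrable[of k] square_integrable_direction(1)[OF state_square_integrable[of k], of i j]
    square_integrable_direction(2)[OF state_square_integrable[of k], of i j]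
    square_integrable_direction(3)[OF state_square_integrable[of k], of i]
  unfolding state_square_integrable_def by auto

end

section \<open>The parametric bounds\<close>

lemma integral_avg:
  fixes X :: "nat \<Rightarrow> 'o \<Rightarrow> real"
  assumes "\<And>i. i \<in> {1..n} \<Longrightarrow> integrable M (X i)"
  shows "(\<integral>s. avg n (\<lambda>i. X i s) \<partial>M) = avg n (\<lambda>i. \<integral>s. X i s \<partial>M)"
  unfolding avg_def by (subst Bochner_Integration.integral_scaleR_right)
    (simp only: Bochner_Integration.integral_sum[OF assms])

lemma borel_measurable_component:
  fixes X :: "'o \<Rightarrow> real ^ 'd"
  assumes "X \<in> borel_measurable N"
  shows "(\<lambda>s. X s $ c) \<in> borel_measurable N"
proof -
  have "(\<lambda>s. inner (X s) (axis c 1)) \<in> borel_measurable N" using assms by simp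
  then show ?thesis by (simp add: inner_axis)
qed

lemma borel_measurable_vecI:
  fixes X :: "'o \<Rightarrow> 'd::finite \<Rightarrow> real"
  assumes "\<And>c. (\<lambda>s. X s c) \<in> borel_measurable N"
  shows "(\<lambda>s. \<chi> c. X s c) \<in> borel_measurable N"
  using assms
  by (subst borel_measurable_euclidean_space) (auto simp: Basis_vec_def inner_axis)

lemma (in finite_sum_problem) gap_le: "gap y \<le> L / 2 * (norm (y - xstar))\<^sup>2"
  using smooth_upper_bound[OF smooth_objective, of y xstar] by (simp add: grad_xstar)

context ec_lsvrg_diana
begin

abbreviation "S1 k s \<equiv> sigma1_sq n m fs xstar (\<lambda>i. h k i s)"
abbreviation "S2 k s \<equiv> sigma2_sq n m fs xstar (\<lambda>i. w k i s)"
abbreviation "err k s \<equiv> avg n (\<lambda>i. (norm (e k i s))\<^sup>2)"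
abbreviation "mean_direction k i s \<equiv> worker_grad i (x k s) - h k i s + hbar k s"

lemma integrable_gap: "integrable M (\<lambda>s. gap (x k s))"
proof (rule Bochner_Integration.integrable_bound)
  show "integrable M (\<lambda>s. L / 2 * (norm (x k s - xstar))\<^sup>2)"
    by (intro integrable_mult_right norm_sq_diff_integrable square_integrable_state
        square_integrable_constant)
  have "(\<lambda>s. f (x k s)) \<in> borel_measurable M"
    by (rule measurable_compose[OF history_to_M[OF adapted_measurable(1)] f_measurable])
  then show "(\<lambda>s. gap (x k s)) \<in> borel_measurable M" by simp
  show "AE s in M. norm (gap (x k s)) \<le> norm (L / 2 * (norm (x k s - xstar))\<^sup>2)"
    using gap_nonneg gap_le L_pos by (intro AE_I2) simp
qed

lemma integrable_objective: "integrable M (\<lambda>s. f (x k s))"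
  using Bochner_Integration.integrable_add[OF integrable_gap M.integrable_const[of "f xstar"], of k]
  by simp

lemma integrable_S1: "integrable M (S1 k)"
  unfolding sigma1_sq_def
  by (intro integrable_avg norm_sq_diff_integrable square_integrable_state
      square_integrable_constant)

lemma square_integrable_comp_grad:
  "i \<in> {1..n} \<Longrightarrow> square_integrable M X \<Longrightarrow> square_integrable M (\<lambda>s. comp_grad i j (X s))"
  by (intro square_integrable_lipschitz[OF M.finite_measure_axioms _ comp_grad_lipschitz]
      comp_grad_measurable)

lemma integrable_comp_grad_divergence:
  "i \<in> {1..n} \<Longrightarrow> square_integrable M X \<Longrightarrow>
    integrable M (\<lambda>s. avg m (\<lambda>j. (norm (comp_grad i j (X s) - comp_grad i j xstar))\<^sup>2))"
  by (intro integrable_avg norm_sq_diff_integrable square_integrable_comp_grad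
      square_integrable_constant)

lemma integrable_S2: "integrable M (S2 k)"
  unfolding sigma2_sq_eq
  by (intro integrable_avg integrable_comp_grad_divergence square_integrable_state)

lemma integrable_err: "integrable M (err k)"
  by (intro integrable_avg) (use square_integrable_state(4) in \<open>simp add: square_integrable_def\<close>)

lemma cond_S1:
  "AE s in M. real_cond_exp M (\<F> k) (S1 (Suc k)) s
    \<le> (1 - \<alpha>) * S1 k s + \<alpha> * (4 * L * gap (x k s) + 2 * S2 k s)"
  unfolding sigma1_sq_def
proof (rule average_step_bound(2)[OF shift_step(1,2)[OF state_square_integrable]])
  fix s
  have "avg n (\<lambda>i. (1 - \<alpha>) * (norm (h k i s - worker_grad i xstar))\<^sup>2
      + \<alpha> * avg m (\<lambda>j. (norm (estimator i j (x k s) (w k i s) - worker_grad i xstar))\<^sup>2))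
    = (1 - \<alpha>) * avg n (\<lambda>i. (norm (h k i s - worker_grad i xstar))\<^sup>2)
      + \<alpha> * avg n (\<lambda>i. avg m (\<lambda>j.
          (norm (estimator i j (x k s) (w k i s) - worker_grad i xstar))\<^sup>2))"
    by (simp only: avg_add avg_mult)
  also have "\<dots> \<le> (1 - \<alpha>) * avg n (\<lambda>i. (norm (h k i s - worker_grad i xstar))\<^sup>2)
      + \<alpha> * (4 * L * gap (x k s) + 2 * S2 k s)"
    using alpha(1) by (intro add_left_mono mult_left_mono estimator_second_moment) simp
  finally show "avg n (\<lambda>i. (1 - \<alpha>) * (norm (h k i s - worker_grad i xstar))\<^sup>2
      + \<alpha> * avg m (\<lambda>j. (norm (estimator i j (x k s) (w k i s) - worker_grad i xstar))\<^sup>2))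
    \<le> (1 - \<alpha>) * avg n (\<lambda>i. (norm (h k i s - worker_grad i xstar))\<^sup>2)
      + \<alpha> * (4 * L * gap (x k s) + 2 * S2 k s)" .
qed

text \<open>With probability \<open>p\<close> the divergence of an anchor is replaced by that of the current iterate, whose
  average over the workers is a function gap.\<close>

lemma cond_S2:
  "AE s in M. real_cond_exp M (\<F> k) (S2 (Suc k)) s \<le> (1 - p) * S2 k s + 2 * (L * p) * gap (x k s)"
proof -
  define B where "B i y = avg m (\<lambda>j. (norm (comp_grad i j y - comp_grad i j xstar))\<^sup>2)" for i y
  define \<psi> where "\<psi> i s = p * B i (x k s) + (1 - p) * B i (w k i s)" for i s
  have B_nonneg: "0 \<le> B i y" for i y
    unfolding B_def by (intro avg_nonneg) simp
  have B_int: "integrable M (\<lambda>s. B i (X s))" if "i \<in> {1..n}" "square_integrable M X" for i X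
    unfolding B_def by (rule integrable_comp_grad_divergence[OF that])
  have S2_eq: "sigma2_sq n m fs xstar u = avg n (\<lambda>i. B i (u i))" for u
    unfolding B_def by (rule sigma2_sq_eq)
  have int: "integrable M (\<lambda>s. B i (w (Suc k) i s))" if "i \<in> {1..n}" for i
    by (intro B_int that square_integrable_state)
  have cond: "AE s in M. real_cond_exp M (\<F> k) (\<lambda>s. B i (w (Suc k) i s)) s \<le> \<psi> i s"
    if i: "i \<in> {1..n}" for i
  proof (rule worker_step_bound(2)[OF i, of "\<lambda>u. B i (step_anchor k i u)"])
    have "(\<lambda>y. B i y) \<in> borel_measurable borel"
      unfolding B_def avg_def using comp_grad_measurable[OF i] by simp
    then show "(\<lambda>u. B i (step_anchor k i u)) \<in> borel_measurable (\<F> k \<Otimes>\<^sub>M D)"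
      by (rule measurable_compose[OF step_measurable(5)[OF i adapted]])
    show "B i (w (Suc k) i s) = B i (step_anchor k i (s, draw k i s))" if "s \<in> space M" for s
      using steps(4)[OF i that] by simp
    define v where "v s b = B i (if b then x k s else w k i s)" for s b
    have sec: "B i (step_anchor k i (s, z)) = v s (draw_coin z)" for s z
      by (simp add: step_anchor_def v_def)
    show "integrable D (\<lambda>z. B i (step_anchor k i (s, z)))" for s
      unfolding sec by (rule integral_draw_coin)
    show "(\<integral>z. B i (step_anchor k i (s, z)) \<partial>D) \<le> \<psi> i s" for s
      unfolding sec integral_draw_coin by (simp add: v_def \<psi>_def)
    show "integrable M (\<psi> i)"
      unfolding \<psi>_def
      by (intro Bochner_Integration.integrable_add integrable_mult_right B_int
          square_integrable_state i)
  qed (rule B_nonneg)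
  show ?thesis
    unfolding S2_eq
  proof (rule average_step_bound(2)[OF int cond])
    fix s
    have "avg n (\<lambda>i. \<psi> i s) = p * avg n (\<lambda>i. B i (x k s)) + (1 - p) * avg n (\<lambda>i. B i (w k i s))"
      unfolding \<psi>_def by (simp only: avg_add avg_mult)
    moreover have "avg n (\<lambda>i. B i (x k s)) \<le> 2 * L * gap (x k s)"
    proof -
      have "avg n (\<lambda>i. B i (x k s))
          = avg n (\<lambda>i. avg m (\<lambda>j. (norm (grad (fs i j) (x k s) - grad (fs i j) xstar))\<^sup>2))"
        unfolding B_def by (intro avg_cong) (simp add: comp_grad_def)
      also note component_divergence
      finally show ?thesis .
    qed
    then have "p * avg n (\<lambda>i. B i (x k s)) \<le> p * (2 * L * gap (x k s))"
      using p by (intro mult_left_mono) auto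
    ultimately show "avg n (\<lambda>i. \<psi> i s)
        \<le> (1 - p) * avg n (\<lambda>i. B i (w k i s)) + 2 * (L * p) * gap (x k s)"
      by (simp add: algebra_simps)
  qed
qed

text \<open>Conditionally on the past, the compressed vector splits into its mean and its variance over the
  index.  Only the mean contains the old error; Young's inequality with constant \<open>\<delta> / 2\<close> separates
  the two while half of the contraction of the compressor survives.\<close>

lemma cond_err:
  "AE s in M. real_cond_exp M (\<F> k) (err (Suc k)) s
    \<le> (1 - \<delta> / 2) * err k s + \<gamma>\<^sup>2 * ((8 * L / \<delta> + 4 * L) * gap (x k s) + 4 / \<delta> * S1 k s + 2 * S2 k s)"
proof (rule average_step_bound(2)[OF error_step(1,2)[OF state_square_integrable]])
  fix s
  let ?G = "\<lambda>i. mean_direction k i s"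
  let ?V = "\<lambda>i. avg m (\<lambda>j. (norm (estimator i j (x k s) (w k i s) - worker_grad i (x k s)))\<^sup>2)"
  have per_worker: "(1 - \<delta>) * avg m (\<lambda>j. (norm (e k i s + \<gamma> *\<^sub>R direction k i j s))\<^sup>2)
      \<le> (1 - \<delta> / 2) * (norm (e k i s))\<^sup>2 + (2 / \<delta> * \<gamma>\<^sup>2 * (norm (?G i))\<^sup>2 + \<gamma>\<^sup>2 * ?V i)"
    if i: "i \<in> {1..n}" for i
  proof -
    define a where "a j = e k i s + \<gamma> *\<^sub>R direction k i j s" for j
    have avg_a: "avg m a = e k i s + \<gamma> *\<^sub>R ?G i"
      unfolding a_def using m_pos by (simp add: avg_add avg_const avg_scaleR avg_direction[OF i])
    have "avg m (\<lambda>j. (norm (a j))\<^sup>2)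
        = (norm (avg m a))\<^sup>2 + avg m (\<lambda>j. (norm (a j - avg m a))\<^sup>2)"
      unfolding avg_norm_sq_shift[OF m_pos] by (simp add: power2_norm_eq_inner)
    also have "avg m (\<lambda>j. (norm (a j - avg m a))\<^sup>2) = \<gamma>\<^sup>2 * ?V i"
    proof -
      have "a j - avg m a = \<gamma> *\<^sub>R (estimator i j (x k s) (w k i s) - worker_grad i (x k s))" for j
        unfolding avg_a by (simp add: a_def direction_def algebra_simps)
      then show ?thesis by (simp add: power_mult_distrib avg_mult)
    qed
    also have "(norm (avg m a))\<^sup>2 \<le> (1 + \<delta> / 2) * (norm (e k i s))\<^sup>2
        + (1 + 1 / (\<delta> / 2)) * (norm (\<gamma> *\<^sub>R ?G i))\<^sup>2"
      unfolding avg_a using compression by (intro young) simp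
    finally have "avg m (\<lambda>j. (norm (a j))\<^sup>2) \<le> (1 + \<delta> / 2) * (norm (e k i s))\<^sup>2
        + (1 + 2 / \<delta>) * (\<gamma>\<^sup>2 * (norm (?G i))\<^sup>2) + \<gamma>\<^sup>2 * ?V i"
      by (simp add: power_mult_distrib)
    then have "(1 - \<delta>) * avg m (\<lambda>j. (norm (a j))\<^sup>2) \<le> (1 - \<delta>) * ((1 + \<delta> / 2) * (norm (e k i s))\<^sup>2
        + (1 + 2 / \<delta>) * (\<gamma>\<^sup>2 * (norm (?G i))\<^sup>2) + \<gamma>\<^sup>2 * ?V i)"
      using compression by (intro mult_left_mono) auto
    also have "\<dots> = ((1 - \<delta>) * (1 + \<delta> / 2)) * (norm (e k i s))\<^sup>2
        + ((1 - \<delta>) * (1 + 2 / \<delta>)) * (\<gamma>\<^sup>2 * (norm (?G i))\<^sup>2) + (1 - \<delta>) * (\<gamma>\<^sup>2 * ?V i)"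
      by (simp add: algebra_simps)
    also have "\<dots> \<le> (1 - \<delta> / 2) * (norm (e k i s))\<^sup>2
        + 2 / \<delta> * (\<gamma>\<^sup>2 * (norm (?G i))\<^sup>2) + 1 * (\<gamma>\<^sup>2 * ?V i)"
    proof (intro add_mono mult_right_mono)
      \<comment> \<open>the contraction of the compressor beats the expansion from Young's inequality\<close>
      show "(1 - \<delta>) * (1 + \<delta> / 2) \<le> 1 - \<delta> / 2"
        by (simp add: algebra_simps)
      show "(1 - \<delta>) * (1 + 2 / \<delta>) \<le> 2 / \<delta>"
        using compression by (simp add: field_simps)
      show "0 \<le> \<gamma>\<^sup>2 * ?V i" by (intro mult_nonneg_nonneg avg_nonneg) auto
    qed (use compression in auto)
    finally show ?thesis unfolding a_def by simp
  qed
  have "avg n (\<lambda>i. (1 - \<delta>) * avg m (\<lambda>j. (norm (e k i s + \<gamma> *\<^sub>R direction k i j s))\<^sup>2))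
    \<le> avg n (\<lambda>i. (1 - \<delta> / 2) * (norm (e k i s))\<^sup>2
        + (2 / \<delta> * \<gamma>\<^sup>2 * (norm (?G i))\<^sup>2 + \<gamma>\<^sup>2 * ?V i))"
    by (rule avg_mono) (rule per_worker)
  also have "\<dots> = (1 - \<delta> / 2) * err k s
      + (2 / \<delta> * \<gamma>\<^sup>2 * avg n (\<lambda>i. (norm (?G i))\<^sup>2) + \<gamma>\<^sup>2 * avg n ?V)"
    by (simp only: avg_add avg_mult)
  also have "\<dots> \<le> (1 - \<delta> / 2) * err k s
      + (2 / \<delta> * \<gamma>\<^sup>2 * (4 * L * gap (x k s) + 2 * S1 k s)
        + \<gamma>\<^sup>2 * (4 * L * gap (x k s) + 2 * S2 k s))"
    using compression
    by (intro add_left_mono add_mono mult_left_mono shifted_mean_bound estimator_variance) auto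
  also have "\<dots> = (1 - \<delta> / 2) * err k s
      + \<gamma>\<^sup>2 * ((8 * L / \<delta> + 4 * L) * gap (x k s) + 4 / \<delta> * S1 k s + 2 * S2 k s)"
    using compression by (simp add: field_simps)
  finally show "avg n (\<lambda>i. (1 - \<delta>) * avg m (\<lambda>j. (norm (e k i s + \<gamma> *\<^sub>R direction k i j s))\<^sup>2))
    \<le> (1 - \<delta> / 2) * err k s
      + \<gamma>\<^sup>2 * ((8 * L / \<delta> + 4 * L) * gap (x k s) + 4 / \<delta> * S1 k s + 2 * S2 k s)" .
qed

lemma cond_direction_component:
  assumes i: "i \<in> {1..n}"
  shows "AE s in M. real_cond_exp M (\<F> k) (\<lambda>s. g k i s $ c) s = mean_direction k i s $ c"
proof -
  have int: "integrable M (\<lambda>s. direction k i j s $ c)" for j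
    using square_integrable_inner[OF square_integrable_state(6)[OF i]
        square_integrable_constant[of "axis c 1"]]
    by (simp add: inner_axis)
  have "AE s in M. real_cond_exp M (\<F> k) (\<lambda>s. g k i s $ c) s = avg m (\<lambda>j. direction k i j s $ c)"
    by (rule index_cond_exp[OF i])
       (use int g_eq_direction[OF i] borel_measurable_component[OF direction_adapted[OF i]] in auto)
  then show ?thesis unfolding avg_component avg_direction[OF i] .
qed

lemma cond_direction:
  assumes i: "i \<in> {1..n}"
  shows "AE s in M. vec_cond_exp M (\<F> k) (g k i) s = mean_direction k i s"
proof -
  have "AE s in M. \<forall>c\<in>UNIV. real_cond_exp M (\<F> k) (\<lambda>s. g k i s $ c) s = mean_direction k i s $ c"
    by (rule AE_finite_allI[OF finite cond_direction_component[OF i]])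
  then show ?thesis by eventually_elim (simp add: vec_cond_exp_def vec_eq_iff)
qed

lemma cond_average_direction:
  "AE s in M. vec_cond_exp M (\<F> k) (\<lambda>s. avg n (\<lambda>i. g k i s)) s = grad f (x k s)"
proof -
  have "AE s in M. real_cond_exp M (\<F> k) (\<lambda>s. avg n (\<lambda>i. g k i s) $ c) s = grad f (x k s) $ c" for c
  proof -
    have int: "integrable M (\<lambda>s. g k i s $ c)" if "i \<in> {1..n}" for i
      using square_integrable_inner[OF square_integrable_state(5)[OF that]
          square_integrable_constant[of "axis c 1"]]
      by (simp add: inner_axis)
    have "AE s in M. \<forall>i\<in>{1..n}.
        real_cond_exp M (\<F> k) (\<lambda>s. g k i s $ c) s = mean_direction k i s $ c"
      using cond_direction_component by (simp add: AE_finite_all)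
    moreover have "AE s in M. real_cond_exp M (\<F> k) (\<lambda>s. avg n (\<lambda>i. g k i s $ c)) s
        = avg n (\<lambda>i. real_cond_exp M (\<F> k) (\<lambda>s. g k i s $ c) s)"
      by (rule past.real_cond_exp_avg[OF int])
    ultimately show ?thesis
    proof eventually_elim
      case (elim s)
      have "avg n (\<lambda>i. real_cond_exp M (\<F> k) (\<lambda>s. g k i s $ c) s)
          = avg n (\<lambda>i. mean_direction k i s $ c)"
        by (rule avg_cong) (use elim in auto)
      also have "avg n (\<lambda>i. mean_direction k i s) = grad f (x k s)"
        using n_pos by (simp add: avg_add avg_diff avg_const grad_objective)
      then have "avg n (\<lambda>i. mean_direction k i s $ c) = grad f (x k s) $ c"
        unfolding avg_component by simp
      finally show ?case using elim by (simp add: avg_component)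
    qed
  qed
  then have "AE s in M. \<forall>c\<in>UNIV.
      real_cond_exp M (\<F> k) (\<lambda>s. avg n (\<lambda>i. g k i s) $ c) s = grad f (x k s) $ c"
    by (rule AE_finite_allI[OF finite])
  then show ?thesis by eventually_elim (simp add: vec_cond_exp_def vec_eq_iff)
qed

lemma variance_step:
  fixes c :: "nat \<Rightarrow> 'o \<Rightarrow> real ^ 'd"
  assumes i: "i \<in> {1..n}" and c: "c i \<in> borel_measurable (\<F> k)" "square_integrable M (c i)"
  defines "X \<equiv> \<lambda>s. (norm (estimator i (draw_index (draw k i s)) (x k s) (w k i s) - c i s))\<^sup>2"
  shows "integrable M X"
    and "AE s in M. real_cond_exp M (\<F> k) X s
      \<le> avg m (\<lambda>j. (norm (estimator i j (x k s) (w k i s) - c i s))\<^sup>2)"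
proof -
  define u where "u j s = (norm (estimator i j (x k s) (w k i s) - c i s))\<^sup>2" for j s
  have X: "X s = u (draw_index (draw k i s)) s" for s by (simp add: X_def u_def)
  have meas: "u j \<in> borel_measurable (\<F> k)" for j
    unfolding u_def using estimator_adapted[OF i] c(1) by simp
  have int: "integrable M (u j)" for j
    unfolding u_def by (intro norm_sq_diff_integrable square_integrable_state i c)
  show "integrable M X" by (rule index_cond_exp(1)[OF i X meas int])
  have "AE s in M. real_cond_exp M (\<F> k) X s = avg m (\<lambda>j. u j s)"
    by (rule index_cond_exp(2)[OF i X meas int])
  then show "AE s in M. real_cond_exp M (\<F> k) X s
      \<le> avg m (\<lambda>j. (norm (estimator i j (x k s) (w k i s) - c i s))\<^sup>2)"
    unfolding u_def by eventually_elim simp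
qed

lemma worker_grad_adapted:
  assumes i: "i \<in> {1..n}"
  shows "(\<lambda>s. worker_grad i (x k s)) \<in> borel_measurable (\<F> k)"
    and "square_integrable M (\<lambda>s. worker_grad i (x k s))"
proof -
  show "(\<lambda>s. worker_grad i (x k s)) \<in> borel_measurable (\<F> k)"
    by (rule measurable_compose[OF adapted_measurable(1) worker_grad_measurable[OF i]])
  show "square_integrable M (\<lambda>s. worker_grad i (x k s))"
    by (intro square_integrable_lipschitz[OF M.finite_measure_axioms _ worker_grad_lipschitz[OF i]]
        square_integrable_state worker_grad_measurable i)
qed

text \<open>The conditional mean of a direction is only known almost everywhere, so it is first exchanged for its
  explicit form; the shifts then cancel and the variance of the estimator remains.\<close>

lemma cond_variance:
  shows "i \<in> {1..n} \<Longrightarrow> integrable M (\<lambda>s. (norm (g k i s - vec_cond_exp M (\<F> k) (g k i) s))\<^sup>2)"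
    and "AE s in M. avg n (\<lambda>i. real_cond_exp M (\<F> k)
        (\<lambda>s. (norm (g k i s - vec_cond_exp M (\<F> k) (g k i) s))\<^sup>2) s)
      \<le> 4 * L * gap (x k s) + 2 * S2 k s"
proof -
  let ?X = "\<lambda>i s. (norm (estimator i (draw_index (draw k i s)) (x k s) (w k i s)
    - worker_grad i (x k s)))\<^sup>2"
  let ?Y = "\<lambda>i s. (norm (g k i s - vec_cond_exp M (\<F> k) (g k i) s))\<^sup>2"
  have vec_meas: "vec_cond_exp M (\<F> k) X \<in> borel_measurable M" for X :: "'o \<Rightarrow> real ^ 'd"
    unfolding vec_cond_exp_def by (rule borel_measurable_vecI) simp
  note X = variance_step[of _ "\<lambda>i s. worker_grad i (x k s)", OF _ worker_grad_adapted]
  have eq: "AE s in M. ?Y i s = ?X i s" if i: "i \<in> {1..n}" for i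
    using cond_direction[OF i, of k] AE_space by eventually_elim (simp add: g_step[OF i])
  have meas: "?Y i \<in> borel_measurable M" if i: "i \<in> {1..n}" for i
  proof -
    have "g k i \<in> borel_measurable M"
      using square_integrable_state(5)[OF i] by (simp add: square_integrable_def)
    then have "(\<lambda>s. g k i s - vec_cond_exp M (\<F> k) (g k i) s) \<in> borel_measurable M"
      by (intro borel_measurable_diff vec_meas)
    then show ?thesis by simp
  qed
  show Y: "integrable M (?Y i)" if i: "i \<in> {1..n}" for i
    using X(1)[OF i i i] eq[OF i] meas[OF i] integrable_cong_AE[of "?Y i" M "?X i"] by auto
  show "AE s in M. avg n (\<lambda>i. real_cond_exp M (\<F> k) (?Y i) s) \<le> 4 * L * gap (x k s) + 2 * S2 k s"
  proof (rule average_step_bound(1)[OF Y])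
    fix i assume i: "i \<in> {1..n}"
    have "AE s in M. real_cond_exp M (\<F> k) (?Y i) s = real_cond_exp M (\<F> k) (?X i) s"
      using X(1)[OF i i i] meas[OF i] by (intro past.real_cond_exp_cong eq i) auto
    with X(2)[OF i i i] show "AE s in M. real_cond_exp M (\<F> k) (?Y i) s
      \<le> avg m (\<lambda>j. (norm (estimator i j (x k s) (w k i s) - worker_grad i (x k s)))\<^sup>2)"
      by eventually_elim simp
  qed (assumption | rule estimator_variance)+
qed

lemma square_integrable_average_direction: "square_integrable M (\<lambda>s. avg n (\<lambda>i. g k i s))"
  by (intro square_integrable_avg square_integrable_state M.finite_measure_axioms)

lemma cond_second_moment:
  "AE s in M. real_cond_exp M (\<F> k) (\<lambda>s. (norm (avg n (\<lambda>i. g k i s)))\<^sup>2) s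
    \<le> 4 * L * gap (x k s) + 2 * S2 k s"
proof -
  let ?X = "\<lambda>i s. (norm (estimator i (draw_index (draw k i s)) (x k s) (w k i s)
    - worker_grad i xstar))\<^sup>2"
  note X = variance_step[of _ "\<lambda>i s. worker_grad i xstar", OF _ borel_measurable_const
      square_integrable_constant, of _ k]
  have "(norm (avg n (\<lambda>i. g k i s)))\<^sup>2 \<le> avg n (\<lambda>i. ?X i s)" if "s \<in> space M" for s
    by (rule avg_gradient_sq_le) (rule g_step[OF _ that])
  then have "AE s in M. real_cond_exp M (\<F> k) (\<lambda>s. (norm (avg n (\<lambda>i. g k i s)))\<^sup>2) s
      \<le> real_cond_exp M (\<F> k) (\<lambda>s. avg n (\<lambda>i. ?X i s)) s"
    using square_integrable_average_direction X(1)
    by (intro past.real_cond_exp_mono AE_I2 integrable_avg) (auto simp: square_integrable_def)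
  moreover have "AE s in M. real_cond_exp M (\<F> k) (\<lambda>s. avg n (\<lambda>i. ?X i s)) s
      \<le> 4 * L * gap (x k s) + 2 * S2 k s"
    by (rule average_step_bound(2)[OF X]) (auto intro: estimator_second_moment)
  ultimately show ?thesis by eventually_elim simp
qed

lemma cond_mean_sq_le:
  "AE s in M. avg n (\<lambda>i. (norm (vec_cond_exp M (\<F> k) (g k i) s))\<^sup>2)
    \<le> 4 * L * gap (x k s) + 2 * S1 k s"
proof -
  have "AE s in M. \<forall>i\<in>{1..n}. vec_cond_exp M (\<F> k) (g k i) s = mean_direction k i s"
    using cond_direction by (simp add: AE_finite_all)
  then show ?thesis
  proof eventually_elim
    case (elim s)
    then have "avg n (\<lambda>i. (norm (vec_cond_exp M (\<F> k) (g k i) s))\<^sup>2)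
        = avg n (\<lambda>i. (norm (mean_direction k i s))\<^sup>2)"
      by (intro avg_cong) auto
    also note shifted_mean_bound
    finally show ?case .
  qed
qed

text \<open>The direction may be replaced by its conditional mean when tested against a vector that is
  determined by the past.\<close>

lemma expectation_inner_direction:
  assumes y: "y \<in> borel_measurable (\<F> k)" "square_integrable M y"
  shows "(\<integral>s. inner (y s) (avg n (\<lambda>i. g k i s)) \<partial>M) = (\<integral>s. inner (y s) (grad f (x k s)) \<partial>M)"
proof -
  have worker: "integrable M (\<lambda>s. inner (y s) (g k i s))"
    "(\<integral>s. inner (y s) (g k i s) \<partial>M) = (\<integral>s. inner (y s) (mean_direction k i s) \<partial>M)"
    "integrable M (\<lambda>s. inner (y s) (mean_direction k i s))"
    if i: "i \<in> {1..n}" for i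
  proof -
    have u: "(\<lambda>s. inner (y s) (direction k i j s)) \<in> borel_measurable (\<F> k)"
      "integrable M (\<lambda>s. inner (y s) (direction k i j s))" for j
      using y direction_adapted[OF i] square_integrable_inner[OF y(2) square_integrable_state(6)[OF i]]
      by auto
    have avg: "avg m (\<lambda>j. inner (y s) (direction k i j s)) = inner (y s) (mean_direction k i s)" for s
      unfolding inner_avg_right[symmetric] avg_direction[OF i] ..
    have X: "inner (y s) (g k i s) = inner (y s) (direction k i (draw_index (draw k i s)) s)"
      if "s \<in> space M" for s
      using g_eq_direction[OF i that] by simp
    show "integrable M (\<lambda>s. inner (y s) (g k i s))"
      by (rule index_cond_exp(1)[OF i X u])
    show "(\<integral>s. inner (y s) (g k i s) \<partial>M) = (\<integral>s. inner (y s) (mean_direction k i s) \<partial>M)"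
      using index_cond_exp(3)[OF i X u] unfolding avg .
    show "integrable M (\<lambda>s. inner (y s) (mean_direction k i s))"
      unfolding avg[symmetric] by (intro integrable_avg u)
  qed
  have "(\<integral>s. inner (y s) (avg n (\<lambda>i. g k i s)) \<partial>M) = avg n (\<lambda>i. \<integral>s. inner (y s) (g k i s) \<partial>M)"
    unfolding inner_avg_right by (rule integral_avg[OF worker(1)])
  also have "\<dots> = avg n (\<lambda>i. \<integral>s. inner (y s) (mean_direction k i s) \<partial>M)"
    by (intro avg_cong worker)
  also have "\<dots> = (\<integral>s. inner (y s) (avg n (\<lambda>i. mean_direction k i s)) \<partial>M)"
    unfolding inner_avg_right by (rule integral_avg[OF worker(3), symmetric])
  also have "(\<lambda>s. avg n (\<lambda>i. mean_direction k i s)) = (\<lambda>s. grad f (x k s))"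
    using n_pos by (simp add: avg_add avg_diff avg_const grad_objective)
  then have "(\<integral>s. inner (y s) (avg n (\<lambda>i. mean_direction k i s)) \<partial>M)
      = (\<integral>s. inner (y s) (grad f (x k s)) \<partial>M)"
    by metis
  finally show ?thesis .
qed

end

section \<open>Weighted sums of contracting sequences\<close>

lemma weight_pos: "\<eta> < 1 \<Longrightarrow> 0 < weight \<eta> k"
  by (simp add: weight_def)

lemma weight_Suc: "\<eta> < 1 \<Longrightarrow> (1 - \<eta>) * weight \<eta> (Suc k) = weight \<eta> k"
  by (simp add: weight_def)

text \<open>Since \<open>(1 - \<eta>) weight (k + 1) = weight k\<close>, shifting the index by one costs a factor
  \<open>1 - \<eta>\<close>, and the recursion can be summed.  The case \<open>\<rho> = \<eta>\<close> is a telescoping sum.\<close>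

lemma weighted_contraction:
  fixes a b :: "nat \<Rightarrow> real"
  assumes \<eta>: "\<eta> < 1" and nonneg: "\<And>k. 0 \<le> a k"
    and step: "\<And>k. a (Suc k) \<le> (1 - \<rho>) * a k + b k"
  shows "(\<rho> - \<eta>) * (\<Sum>k=0..K. weight \<eta> k * a k) \<le> a 0 + (\<Sum>k=0..K. weight \<eta> k * b k)"
proof -
  let ?t = "\<lambda>k. weight \<eta> k * ((1 - \<rho>) * a k + b k)"
  have tele: "(1 - \<eta>) * (\<Sum>k=0..K. weight \<eta> k * a k) \<le> a 0 + (\<Sum>k<K. ?t k)"
  proof (induction K)
    case 0
    then show ?case using \<eta> by (simp add: weight_def)
  next
    case (Suc K)
    have "(1 - \<eta>) * (weight \<eta> (Suc K) * a (Suc K)) = weight \<eta> K * a (Suc K)"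
      using weight_Suc[OF \<eta>, of K] by (simp add: mult.assoc[symmetric])
    also have "\<dots> \<le> ?t K"
      using step weight_pos[OF \<eta>, of K] by (intro mult_left_mono) auto
    finally show ?case using Suc by (simp add: distrib_left)
  qed
  \<comment> \<open>the last summand may be added, since it bounds the nonnegative \<open>a (Suc K)\<close>\<close>
  have "0 \<le> (1 - \<rho>) * a K + b K" using nonneg[of "Suc K"] step[of K] by linarith
  then have "0 \<le> ?t K" using weight_pos[OF \<eta>, of K] by simp
  moreover have "{0..K} = insert K {..<K}" by auto
  ultimately have "(\<Sum>k<K. ?t k) \<le> (\<Sum>k=0..K. ?t k)" by simp
  also have "\<dots> = (1 - \<rho>) * (\<Sum>k=0..K. weight \<eta> k * a k) + (\<Sum>k=0..K. weight \<eta> k * b k)"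
    unfolding sum_distrib_left sum.distrib[symmetric] by (intro sum.cong) (auto simp: algebra_simps)
  finally show ?thesis using tele by (simp add: algebra_simps)
qed

text \<open>The square root in the step-size restriction is at least \<open>18\<close>: the quantity under it is at least
  \<open>6 (4 + 56)\<close>, which exceeds \<open>18\<^sup>2\<close>.\<close>

lemma step_size_bound:
  fixes L \<gamma> \<delta> \<alpha> p :: real
  assumes "0 < L" "0 < \<delta>" "0 < \<alpha>" "\<alpha> < 1" "0 < p" "p < 1"
    and "\<gamma> \<le> \<delta> / (4 * L * sqrt (6 * (4 + 3 * \<delta>
                    + 2 / (1 - \<alpha>) * (3 + 4 / (1 - p)) * (4 + 3 * \<delta>)
                    + 6 * \<delta> / (1 - p))))"
  shows "\<gamma> * L \<le> \<delta> / 72"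
proof -
  define Y where "Y = 2 / (1 - \<alpha>) * (3 + 4 / (1 - p)) * (4 + 3 * \<delta>)"
  define Z where "Z = 6 * \<delta> / (1 - p)"
  define X where "X = 4 + 3 * \<delta> + Y + Z"
  have "2 \<le> 2 / (1 - \<alpha>)" "4 \<le> 4 / (1 - p)" and Z: "0 \<le> Z"
    using assms by (auto simp: Z_def field_simps)
  then have "2 * (3 + 4) * 4 \<le> Y"
    unfolding Y_def using assms by (intro mult_mono) auto
  then have "56 \<le> Y" by simp
  then have X60: "60 \<le> X"
    using Z \<open>0 < \<delta>\<close> unfolding X_def by linarith
  then have "18\<^sup>2 \<le> 6 * X" by simp
  then have sqrt: "18 \<le> sqrt (6 * X)" by (rule real_le_rsqrt)
  have "\<gamma> \<le> \<delta> / (4 * L * sqrt (6 * X))" using assms(7) unfolding X_def Y_def Z_def .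
  also have "\<dots> \<le> \<delta> / (4 * L * 18)"
    using sqrt X60 assms(1-6) by (intro divide_left_mono mult_left_mono mult_pos_pos) auto
  finally show ?thesis using assms by (simp add: field_simps)
qed

text \<open>The three summed recursions form a triangular system: the accumulated anchor terms are bounded by
  the gaps, the shift terms by both, and the errors by all three.  Substituting from the top, the
  errors inherit the coefficient \<open>816 (\<gamma> L / \<delta>)\<^sup>2\<close> in front of the gaps, which the step size keeps
  below a quarter.\<close>

lemma weighted_error_bound:
  fixes L \<gamma> \<delta> \<alpha> p \<eta> SD T1 T2 TE s1 s2 :: real
  assumes pos: "0 < L" "0 < \<gamma>" "0 < \<delta>" "\<delta> \<le> 1" "0 < \<alpha>" "\<alpha> < 1" "0 < p"
    and nonneg: "0 \<le> SD" "0 \<le> T1" "0 \<le> T2" "0 \<le> TE" "0 \<le> s1" "0 \<le> s2"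
    and \<eta>: "0 \<le> \<eta>" "\<eta> \<le> \<alpha> / 4" "\<eta> \<le> p / 4" "\<eta> \<le> \<delta> / 4" "\<eta> < 1"
    and small: "\<gamma> * L \<le> \<delta> / 72"
    and T2: "(p - \<eta>) * T2 \<le> s2 + 2 * (L * p) * SD"
    and T1: "(\<alpha> - \<eta>) * T1 \<le> s1 + \<alpha> * (4 * L * SD + 2 * T2)"
    and TE: "(\<delta> / 2 - \<eta>) * TE \<le> \<gamma>\<^sup>2 * ((8 * L / \<delta> + 4 * L) * SD + 4 / \<delta> * T1 + 2 * T2)"
  shows "3 * L * TE \<le> 1 / 4 * SD
    + 24 * L * \<gamma>\<^sup>2 * (4 / \<delta> + 3) / (\<delta> * \<alpha> * (1 - \<eta>)) * s1
    + 24 * L * \<gamma>\<^sup>2 * (4 / (1 - \<alpha>) * (4 / \<delta> + 3) + 3) / (\<delta> * p * (1 - \<eta>)) * s2"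
proof -
  have inv: "1 \<le> 1 / \<delta>" using pos by simp
  have "3 / 4 * p * T2 \<le> (p - \<eta>) * T2" using \<eta> nonneg by (intro mult_right_mono) auto
  note T2_upper = order_trans[OF this T2]
  have "p * (3 * T2) = 4 * (3 / 4 * p * T2)" by simp
  also have "\<dots> \<le> 4 * (s2 + 2 * (L * p) * SD)" by (rule mult_left_mono[OF T2_upper]) simp
  also have "\<dots> = p * (4 * s2 / p + 8 * L * SD)" using pos by (simp add: field_simps)
  finally have "p * (3 * T2) \<le> p * (4 * s2 / p + 8 * L * SD)" .
  then have T2': "3 * T2 \<le> 4 * s2 / p + 8 * L * SD" using pos by (simp only: mult_le_cancel_left_pos)
  have "3 / 4 * \<alpha> * T1 \<le> (\<alpha> - \<eta>) * T1" using \<eta> nonneg by (intro mult_right_mono) auto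
  note T1_upper = order_trans[OF this T1]
  have "\<alpha> * (3 * T1) = 4 * (3 / 4 * \<alpha> * T1)" by simp
  also have "\<dots> \<le> 4 * (s1 + \<alpha> * (4 * L * SD + 2 * T2))" by (rule mult_left_mono[OF T1_upper]) simp
  also have "\<dots> = \<alpha> * (4 * s1 / \<alpha> + 16 * L * SD + 8 * T2)" using pos by (simp add: field_simps)
  finally have "\<alpha> * (3 * T1) \<le> \<alpha> * (4 * s1 / \<alpha> + 16 * L * SD + 8 * T2)" .
  then have T1': "3 * T1 \<le> 4 * s1 / \<alpha> + 16 * L * SD + 8 * T2"
    using pos by (simp only: mult_le_cancel_left_pos)
  \<comment> \<open>normalized quantities, in which the triangular system has numerical coefficients\<close>
  define u where "u = s1 / \<alpha>"
  define v where "v = s2 / p"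
  define d where "d = L * SD"
  have uvd: "0 \<le> u" "0 \<le> v" "0 \<le> d" using nonneg pos by (auto simp: u_def v_def d_def)
  have T2'': "T2 \<le> 4 / 3 * v + 8 / 3 * d" using T2' by (simp add: v_def d_def)
  have T1'': "T1 \<le> 4 / 3 * u + 112 / 9 * d + 32 / 9 * v" using T1' T2'' by (simp add: u_def d_def)
  have "\<delta> / 4 * TE \<le> (\<delta> / 2 - \<eta>) * TE" using \<eta> nonneg by (intro mult_right_mono) auto
  also note TE
  also have "\<gamma>\<^sup>2 * ((8 * L / \<delta> + 4 * L) * SD + 4 / \<delta> * T1 + 2 * T2)
      \<le> \<gamma>\<^sup>2 * (1 / \<delta> * (6 * u + 68 * d + 18 * v))"
  proof (rule mult_left_mono)
    have "(8 * L / \<delta> + 4 * L) * SD + 4 / \<delta> * T1 + 2 * T2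
        = 1 / \<delta> * (8 * d + 4 * T1) + 1 * (4 * d + 2 * T2)"
      by (simp add: d_def algebra_simps add_divide_distrib)
    also have "\<dots> \<le> 1 / \<delta> * (8 * d + 4 * T1) + 1 / \<delta> * (4 * d + 2 * T2)"
      using inv uvd nonneg by (intro add_left_mono mult_right_mono) auto
    also have "\<dots> = 1 / \<delta> * (12 * d + 4 * T1 + 2 * T2)"
      by (simp add: add_divide_distrib)
    also have "\<dots> \<le> 1 / \<delta> * (6 * u + 68 * d + 18 * v)"
      using T1'' T2'' pos uvd by (intro mult_left_mono) auto
    finally show "(8 * L / \<delta> + 4 * L) * SD + 4 / \<delta> * T1 + 2 * T2
        \<le> 1 / \<delta> * (6 * u + 68 * d + 18 * v)" .
  qed simp
  finally have TE_upper: "\<delta> / 4 * TE \<le> \<gamma>\<^sup>2 * (1 / \<delta> * (6 * u + 68 * d + 18 * v))" .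
  have "3 * L * TE = 12 * L / \<delta> * (\<delta> / 4 * TE)" using pos by simp
  also have "\<dots> \<le> 12 * L / \<delta> * (\<gamma>\<^sup>2 * (1 / \<delta> * (6 * u + 68 * d + 18 * v)))"
    using pos by (intro mult_left_mono[OF TE_upper]) simp
  also have "\<dots> = (\<gamma> * L / \<delta>)\<^sup>2 * (816 * SD) + 72 * (L * \<gamma>\<^sup>2 / \<delta>\<^sup>2) * u + 216 * (L * \<gamma>\<^sup>2 / \<delta>\<^sup>2) * v"
    using pos by (simp add: d_def power2_eq_square field_simps)
  finally have *: "3 * L * TE
    \<le> (\<gamma> * L / \<delta>)\<^sup>2 * (816 * SD) + 72 * (L * \<gamma>\<^sup>2 / \<delta>\<^sup>2) * u + 216 * (L * \<gamma>\<^sup>2 / \<delta>\<^sup>2) * v" .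
  have "(\<gamma> * L / \<delta>)\<^sup>2 \<le> (1 / 72)\<^sup>2"
    using small pos by (intro power_mono) (auto simp: field_simps)
  then have D: "(\<gamma> * L / \<delta>)\<^sup>2 * (816 * SD) \<le> 1 / 4 * SD"
    using mult_right_mono[of "(\<gamma> * L / \<delta>)\<^sup>2" "(1 / 72)\<^sup>2" "816 * SD"] nonneg(1)
    by (simp add: power2_eq_square)
  define q where "q = L * \<gamma>\<^sup>2 / \<delta>"
  have q: "0 \<le> q" using pos by (simp add: q_def)
  have inv_\<eta>: "1 \<le> 1 / (1 - \<eta>)" using \<eta> by simp
  have inv_\<alpha>: "1 \<le> 1 / (1 - \<alpha>)" using pos by simp
  have "72 * (1 / \<delta>) * 1 \<le> 24 * (4 / \<delta> + 3) * (1 / (1 - \<eta>))"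
  proof (rule mult_mono)
    show "72 * (1 / \<delta>) \<le> 24 * (4 / \<delta> + 3)" using inv by simp
  qed (use inv inv_\<eta> pos in auto)
  then have "q * u * (72 * (1 / \<delta>) * 1) \<le> q * u * (24 * (4 / \<delta> + 3) * (1 / (1 - \<eta>)))"
    using q uvd by (intro mult_left_mono) auto
  then have U: "72 * (L * \<gamma>\<^sup>2 / \<delta>\<^sup>2) * u
      \<le> 24 * L * \<gamma>\<^sup>2 * (4 / \<delta> + 3) / (\<delta> * \<alpha> * (1 - \<eta>)) * s1"
    by (simp add: q_def u_def power2_eq_square mult_ac)
  have "1 * (4 / \<delta> + 3) \<le> 1 / (1 - \<alpha>) * (4 / \<delta> + 3)"
    using inv_\<alpha> pos by (intro mult_right_mono) auto
  moreover define Y where "Y = 1 / (1 - \<alpha>) * (4 / \<delta> + 3)"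
  moreover define z where "z = 1 / \<delta>"
  ultimately have "4 * z + 3 \<le> Y" "1 \<le> z" using inv by simp_all
  then have "216 * z \<le> 24 * (4 * Y + 3)" by (simp add: distrib_left)
  moreover have "4 / (1 - \<alpha>) * (4 / \<delta> + 3) = 4 * Y" by (simp add: Y_def)
  ultimately have "216 * (1 / \<delta>) \<le> 24 * (4 / (1 - \<alpha>) * (4 / \<delta> + 3) + 3)"
    unfolding z_def by simp
  then have "216 * (1 / \<delta>) * 1 \<le> 24 * (4 / (1 - \<alpha>) * (4 / \<delta> + 3) + 3) * (1 / (1 - \<eta>))"
    by (rule mult_mono) (use inv inv_\<eta> pos in auto)
  then have "q * v * (216 * (1 / \<delta>) * 1)
      \<le> q * v * (24 * (4 / (1 - \<alpha>) * (4 / \<delta> + 3) + 3) * (1 / (1 - \<eta>)))"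
    using q uvd by (intro mult_left_mono) auto
  then have V: "216 * (L * \<gamma>\<^sup>2 / \<delta>\<^sup>2) * v
      \<le> 24 * L * \<gamma>\<^sup>2 * (4 / (1 - \<alpha>) * (4 / \<delta> + 3) + 3) / (\<delta> * p * (1 - \<eta>)) * s2"
    by (simp add: q_def v_def power2_eq_square mult_ac)
  from * D U V show ?thesis by linarith
qed

section \<open>Recursions for the expectations\<close>

context ec_lsvrg_diana
begin

abbreviation "mean X \<equiv> (\<integral>s. X s \<partial>M)"
abbreviation "Egap k \<equiv> mean (\<lambda>s. gap (x k s))"

lemma expected_S1:
  "mean (S1 (Suc k)) \<le> (1 - \<alpha>) * mean (S1 k) + \<alpha> * (4 * L * Egap k + 2 * mean (S2 k))"
  using expectation_le[OF integrable_S1 _ cond_S1[of k]] integrable_S1[of k] integrable_S2[of k]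
    integrable_gap[of k]
  by simp

lemma expected_S2:
  "mean (S2 (Suc k)) \<le> (1 - p) * mean (S2 k) + 2 * (L * p) * Egap k"
  using expectation_le[OF integrable_S2 _ cond_S2[of k]] integrable_S2[of k] integrable_gap[of k]
  by simp

lemma expected_err:
  "mean (err (Suc k)) \<le> (1 - \<delta> / 2) * mean (err k)
    + \<gamma>\<^sup>2 * ((8 * L / \<delta> + 4 * L) * Egap k + 4 / \<delta> * mean (S1 k) + 2 * mean (S2 k))"
  using expectation_le[OF integrable_err _ cond_err[of k]] integrable_err[of k] integrable_S1[of k]
    integrable_S2[of k] integrable_gap[of k]
  by simp

text \<open>Removing the average compression error from \<open>x\<close> undoes the compression: what the compressor holds
  back in one iteration is exactly what the error gains.\<close>

abbreviation "ebar k s \<equiv> avg n (\<lambda>i. e k i s)"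
abbreviation "virtual k s \<equiv> x k s - ebar k s"

lemma virtual_step:
  "s \<in> space M \<Longrightarrow> virtual (Suc k) s = virtual k s - \<gamma> *\<^sub>R avg n (\<lambda>i. g k i s)"
  by (simp add: x_step avg_add avg_diff avg_scaleR)

lemma square_integrable_ebar: "square_integrable M (ebar k)"
  by (intro square_integrable_avg square_integrable_state M.finite_measure_axioms)

lemma square_integrable_virtual: "square_integrable M (\<lambda>s. virtual k s - xstar)"
  by (intro square_integrable_diff square_integrable_ebar square_integrable_state
      square_integrable_constant)

text \<open>The gradient is taken at \<open>x\<close> but tested against the virtual iterate.  Quasi strong convexity
  handles the part \<open>x - xstar\<close>; the cross term with the error is paid for by one of the two function
  gaps and by \<open>2 L\<close> times the squared error, and moving the contraction from \<open>x\<close> to the virtual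
  iterate costs \<open>\<mu> \<le> L\<close> times the squared error.\<close>

lemma virtual_inner_bound:
  "- 2 * inner (virtual k s - xstar) (grad f (x k s))
    \<le> - gap (x k s) - \<mu> / 2 * (norm (virtual k s - xstar))\<^sup>2 + 3 * L * (norm (ebar k s))\<^sup>2"
proof -
  define a where "a = x k s - xstar"
  define b where "b = ebar k s"
  define G where "G = grad f (x k s)"
  have split: "virtual k s - xstar = a - b" by (simp add: a_def b_def)
  have "gap (x k s) + \<mu> / 2 * (norm a)\<^sup>2 \<le> inner a G"
    using quasi_convexity[of "x k s"] by (simp add: a_def G_def inner_commute)
  moreover have "2 * inner b G \<le> 2 * L * (norm b)\<^sup>2 + gap (x k s)"
  proof -
    \<comment> \<open>the weight \<open>2 L\<close> turns the squared gradient into at most one function gap\<close>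
    have "0 \<le> 1 / (2 * L) * (norm ((2 * L) *\<^sub>R b - G))\<^sup>2" using L_pos by simp
    also have "\<dots> = 2 * L * (norm b)\<^sup>2 - 2 * inner b G + 1 / (2 * L) * (norm G)\<^sup>2"
      unfolding norm_diff_sq using L_pos by (simp add: power2_eq_square field_simps)
    finally have "2 * inner b G \<le> 2 * L * (norm b)\<^sup>2 + 1 / (2 * L) * (norm G)\<^sup>2" by simp
    also have "1 / (2 * L) * (norm G)\<^sup>2 \<le> gap (x k s)"
      using grad_norm_le[of "x k s"] L_pos by (simp add: G_def field_simps)
    finally show ?thesis by simp
  qed
  moreover have "\<mu> / 2 * (norm (a - b))\<^sup>2 \<le> \<mu> / 2 * (2 * (norm a)\<^sup>2 + 2 * (norm b)\<^sup>2)"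
    using mu by (intro mult_left_mono norm_diff_sq_le) simp
  moreover have "\<mu> * (norm b)\<^sup>2 \<le> L * (norm b)\<^sup>2"
    by (intro mult_right_mono mu_le_L) simp
  ultimately have "- 2 * inner (a - b) G
      \<le> - gap (x k s) - \<mu> / 2 * (norm (a - b))\<^sup>2 + 3 * L * (norm b)\<^sup>2"
    by (simp add: inner_diff_left algebra_simps)
  then show ?thesis unfolding split unfolding a_def b_def G_def .
qed

lemma expected_virtual:
  "mean (\<lambda>s. (norm (virtual (Suc k) s - xstar))\<^sup>2)
    \<le> (1 - \<gamma> * \<mu> / 2) * mean (\<lambda>s. (norm (virtual k s - xstar))\<^sup>2) - \<gamma> * Egap k
      + 3 * L * \<gamma> * mean (\<lambda>s. (norm (ebar k s))\<^sup>2) + \<gamma>\<^sup>2 * (4 * L * Egap k + 2 * mean (S2 k))"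
proof -
  let ?y = "\<lambda>s. virtual k s - xstar" and ?g = "\<lambda>s. avg n (\<lambda>i. g k i s)"
  let ?r = "mean (\<lambda>s. (norm (?y s))\<^sup>2)" and ?q = "mean (\<lambda>s. (norm (ebar k s))\<^sup>2)"
  have y: "integrable M (\<lambda>s. (norm (?y s))\<^sup>2)" and e: "integrable M (\<lambda>s. (norm (ebar k s))\<^sup>2)"
    and g2: "integrable M (\<lambda>s. (norm (?g s))\<^sup>2)"
    using square_integrable_virtual square_integrable_ebar square_integrable_average_direction
    unfolding square_integrable_def by auto
  have yg: "integrable M (\<lambda>s. inner (?y s) (?g s))"
    by (intro square_integrable_inner square_integrable_virtual square_integrable_average_direction)
  have grad: "square_integrable M (\<lambda>s. grad f (x k s))"
    by (rule square_integrable_lipschitz[OF M.finite_measure_axioms square_integrable_state(1)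
          smooth_lipschitz[OF smooth_objective]
          lipschitz_measurable[OF smooth_lipschitz[OF smooth_objective]]])
       (use L_pos in simp)
  have yG: "integrable M (\<lambda>s. inner (?y s) (grad f (x k s)))"
    by (intro square_integrable_inner square_integrable_virtual grad)
  have "mean (\<lambda>s. (norm (virtual (Suc k) s - xstar))\<^sup>2)
      = mean (\<lambda>s. (norm (?y s))\<^sup>2 - 2 * \<gamma> * inner (?y s) (?g s) + \<gamma>\<^sup>2 * (norm (?g s))\<^sup>2)"
  proof (rule Bochner_Integration.integral_cong[OF refl])
    fix s assume s: "s \<in> space M"
    have y_step: "virtual (Suc k) s - xstar = ?y s - \<gamma> *\<^sub>R ?g s"
      unfolding virtual_step[OF s] by simp
    show "(norm (virtual (Suc k) s - xstar))\<^sup>2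
      = (norm (?y s))\<^sup>2 - 2 * \<gamma> * inner (?y s) (?g s) + \<gamma>\<^sup>2 * (norm (?g s))\<^sup>2"
      unfolding y_step norm_diff_sq[of "?y s"] by (simp add: power_mult_distrib)
  qed
  also have "\<dots> = ?r - 2 * \<gamma> * mean (\<lambda>s. inner (?y s) (?g s)) + \<gamma>\<^sup>2 * mean (\<lambda>s. (norm (?g s))\<^sup>2)"
    using y yg g2 by simp
  also have "mean (\<lambda>s. inner (?y s) (?g s)) = mean (\<lambda>s. inner (?y s) (grad f (x k s)))"
  proof (rule expectation_inner_direction[OF _ square_integrable_virtual])
    show "?y \<in> borel_measurable (\<F> k)"
      unfolding avg_def
      by (intro borel_measurable_diff borel_measurable_scaleR borel_measurable_sum
          adapted_measurable borel_measurable_const)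
  qed
  also have "?r - 2 * \<gamma> * mean (\<lambda>s. inner (?y s) (grad f (x k s))) + \<gamma>\<^sup>2 * mean (\<lambda>s. (norm (?g s))\<^sup>2)
    \<le> ?r + \<gamma> * (- Egap k - \<mu> / 2 * ?r + 3 * L * ?q) + \<gamma>\<^sup>2 * (4 * L * Egap k + 2 * mean (S2 k))"
  proof -
    have bound: "mean (\<lambda>s. - 2 * inner (?y s) (grad f (x k s)))
      \<le> mean (\<lambda>s. - gap (x k s) - \<mu> / 2 * (norm (?y s))\<^sup>2 + 3 * L * (norm (ebar k s))\<^sup>2)"
      
      by (intro integral_mono virtual_inner_bound Bochner_Integration.integrable_add
          Bochner_Integration.integrable_diff Bochner_Integration.integrable_minus
          integrable_mult_right integrable_gap y e yG)
    have "- 2 * mean (\<lambda>s. inner (?y s) (grad f (x k s))) \<le> - Egap k - \<mu> / 2 * ?r + 3 * L * ?q"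
    proof -
      define D where "D s = gap (x k s)" for s
      have "integrable M D" unfolding D_def by (rule integrable_gap)
      then have "mean (\<lambda>s. - D s - \<mu> / 2 * (norm (?y s))\<^sup>2 + 3 * L * (norm (ebar k s))\<^sup>2)
          = - mean D - \<mu> / 2 * ?r + 3 * L * ?q"
        using y e by simp
      moreover have "mean (\<lambda>s. - 2 * inner (?y s) (grad f (x k s)))
          = - 2 * mean (\<lambda>s. inner (?y s) (grad f (x k s)))"
        using yG by (rule Bochner_Integration.integral_mult_right)
      ultimately show ?thesis
        using bound unfolding D_def by simp
    qed
    from mult_left_mono[OF this, of \<gamma>]
    have "- 2 * \<gamma> * mean (\<lambda>s. inner (?y s) (grad f (x k s))) \<le> \<gamma> * (- Egap k - \<mu> / 2 * ?r + 3 * L * ?q)"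
      using gamma_pos by (simp add: mult_ac)
    moreover have "mean (\<lambda>s. (norm (?g s))\<^sup>2) \<le> 4 * L * Egap k + 2 * mean (S2 k)"
      using expectation_le[OF g2 _ cond_second_moment] integrable_gap[of k] integrable_S2[of k] by simp
    then have "\<gamma>\<^sup>2 * mean (\<lambda>s. (norm (?g s))\<^sup>2) \<le> \<gamma>\<^sup>2 * (4 * L * Egap k + 2 * mean (S2 k))"
      by (intro mult_left_mono) auto
    ultimately show ?thesis by simp
  qed
  finally show ?thesis by (simp add: algebra_simps)
qed

end

section \<open>Summing the recursions\<close>

text \<open>The last weight alone is at least as large as the bound.\<close>

lemma weight_sum_ge_power:
  assumes "0 \<le> \<eta>" "\<eta> < 1"
  shows "1 / (1 - \<eta>) ^ K \<le> weight_sum \<eta> K"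
proof -
  have "1 / (1 - \<eta>) ^ K \<le> weight \<eta> K"
    unfolding weight_def using assms
    by (intro divide_left_mono mult_pos_pos zero_less_power power_decreasing) auto
  also have "\<dots> \<le> weight_sum \<eta> K"
    unfolding weight_sum_def using weight_pos[OF assms(2)]
    by (intro member_le_sum) (auto intro: less_imp_le)
  finally show ?thesis .
qed

lemma weight_sum_zero: "weight_sum 0 K = real K + 1"
  by (simp add: weight_sum_def weight_def)

lemma (in finite_sum_problem) sigma_nonneg:
  "0 \<le> sigma1_sq n m fs xstar c" "0 \<le> sigma2_sq n m fs xstar u"
  unfolding sigma1_sq_def sigma2_sq_eq by (intro avg_nonneg; simp add: avg_nonneg)+

context ec_lsvrg_diana
begin

abbreviation "\<eta> \<equiv> min (\<gamma> * \<mu> / 2) (min (\<alpha> / 4) (p / 4))"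
abbreviation "S10 \<equiv> sigma1_sq n m fs xstar h0"
abbreviation "S20 \<equiv> sigma2_sq n m fs xstar w0"
abbreviation "F1 \<equiv> 24 * L * \<gamma>\<^sup>2 * (4 / \<delta> + 3) / (\<delta> * \<alpha> * (1 - \<eta>))"
abbreviation "F2 \<equiv> 24 * L * \<gamma>\<^sup>2 * (4 / (1 - \<alpha>) * (4 / \<delta> + 3) + 3) / (\<delta> * p * (1 - \<eta>))"
abbreviation "M2 \<equiv> 8 / (3 * p) + 32 / (9 * p)"
abbreviation "wsum K a \<equiv> \<Sum>k=0..K. weight \<eta> k * a k"

lemma alpha_less_1: "\<alpha> < 1"
proof -
  have "1 / (\<omega> + 1) < 1" using quantization(1) by simp
  then show ?thesis using alpha by linarith
qed

lemma eta_bounds: "0 \<le> \<eta>" "\<eta> < 1" "\<eta> \<le> \<gamma> * \<mu> / 2" "\<eta> \<le> \<alpha> / 4" "\<eta> \<le> p / 4"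
  using p alpha gamma_pos mu by auto

lemma wsum_nonneg: "(\<And>k. 0 \<le> a k) \<Longrightarrow> 0 \<le> wsum K a"
  using weight_pos[OF eta_bounds(2)] by (intro sum_nonneg mult_nonneg_nonneg) (auto intro: less_imp_le)

lemma wsum_mono: "(\<And>k. a k \<le> b k) \<Longrightarrow> wsum K a \<le> wsum K b"
  using weight_pos[OF eta_bounds(2)] by (intro sum_mono mult_left_mono) (auto intro: less_imp_le)

lemma wsum_add: "wsum K (\<lambda>k. a k + b k) = wsum K a + wsum K b"
  by (simp add: distrib_left sum.distrib)

lemma wsum_mult: "wsum K (\<lambda>k. c * a k) = c * wsum K a"
  by (simp add: sum_distrib_left mult.left_commute)

lemma initial_S1: "s \<in> space M \<Longrightarrow> S1 0 s = S10"
  unfolding sigma1_sq_def by (intro avg_cong) (simp add: h_init)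

lemma initial_S2: "s \<in> space M \<Longrightarrow> S2 0 s = S20"
  unfolding sigma2_sq_eq by (intro avg_cong) (simp add: w_init)

lemma initial_ebar: "s \<in> space M \<Longrightarrow> ebar 0 s = 0"
  using avg_cong[of n "\<lambda>i. e 0 i s" "\<lambda>_. 0"] e_init avg_const[OF n_pos] by simp

lemma initial_err: "s \<in> space M \<Longrightarrow> err 0 s = 0"
  using avg_cong[of n "\<lambda>i. (norm (e 0 i s))\<^sup>2" "\<lambda>_. 0"] e_init avg_const[OF n_pos] by simp

lemma mean_constant: "(\<And>s. s \<in> space M \<Longrightarrow> X s = c) \<Longrightarrow> mean X = c" for c :: real
  using Bochner_Integration.integral_cong[OF refl, of M X "\<lambda>_. c"] by (simp add: M.prob_space)

lemma mean_initial_S1: "mean (S1 0) = S10"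
  by (rule mean_constant[OF initial_S1])

lemma mean_initial_S2: "mean (S2 0) = S20"
  by (rule mean_constant[OF initial_S2])

lemma mean_initial_err: "mean (err 0) = 0"
  by (rule mean_constant[OF initial_err])

lemma Egap_nonneg: "0 \<le> Egap k"
  by (intro integral_nonneg_AE AE_I2 gap_nonneg)

text \<open>The step size also makes \<open>\<eta>\<close> small against \<open>\<delta>\<close>, because \<open>\<mu> \<le> L\<close>; hence the weights do not
  destroy the contraction of the error.\<close>

lemma compensation_error:
  assumes small: "\<gamma> * L \<le> \<delta> / 72"
  shows "3 * L * wsum K (\<lambda>k. mean (\<lambda>s. (norm (ebar k s))\<^sup>2))
    \<le> 1 / 4 * wsum K Egap + F1 * S10 + F2 * S20"
proof -
  have nonneg: "0 \<le> mean (S1 k)" "0 \<le> mean (S2 k)" "0 \<le> mean (err k)" for k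
    by (intro integral_nonneg_AE AE_I2 sigma_nonneg avg_nonneg; simp)+
  have "\<gamma> * \<mu> / 2 \<le> \<gamma> * L / 2"
    using mu_le_L gamma_pos by simp
  then have \<eta>_\<delta>: "\<eta> \<le> \<delta> / 4" using eta_bounds(3) small compression(1) by linarith
  have "3 * L * wsum K (\<lambda>k. mean (\<lambda>s. (norm (ebar k s))\<^sup>2)) \<le> 3 * L * wsum K (\<lambda>k. mean (err k))"
    using L_pos integrable_err square_integrable_ebar norm_avg_sq_le[OF n_pos]
    by (intro mult_left_mono wsum_mono integral_mono) (auto simp: square_integrable_def)
  also have "\<dots> \<le> 1 / 4 * wsum K Egap + F1 * S10 + F2 * S20"
  proof (rule weighted_error_bound[where \<eta>=\<eta> and ?T1.0="wsum K (\<lambda>k. mean (S1 k))"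
        and ?T2.0="wsum K (\<lambda>k. mean (S2 k))"])
    have "(p - \<eta>) * wsum K (\<lambda>k. mean (S2 k)) \<le> mean (S2 0) + wsum K (\<lambda>k. 2 * (L * p) * Egap k)"
      by (rule weighted_contraction[where a="\<lambda>k. mean (S2 k)"
            and b="\<lambda>k. 2 * (L * p) * Egap k"])
         (rule eta_bounds nonneg expected_S2)+
    then show "(p - \<eta>) * wsum K (\<lambda>k. mean (S2 k)) \<le> S20 + 2 * (L * p) * wsum K Egap"
      unfolding wsum_mult mean_initial_S2 .
    have "(\<alpha> - \<eta>) * wsum K (\<lambda>k. mean (S1 k))
      \<le> mean (S1 0) + wsum K (\<lambda>k. \<alpha> * (4 * L * Egap k + 2 * mean (S2 k)))"
      by (rule weighted_contraction[where a="\<lambda>k. mean (S1 k)"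
            and b="\<lambda>k. \<alpha> * (4 * L * Egap k + 2 * mean (S2 k))"])
         (rule eta_bounds nonneg expected_S1)+
    then show "(\<alpha> - \<eta>) * wsum K (\<lambda>k. mean (S1 k))
      \<le> S10 + \<alpha> * (4 * L * wsum K Egap + 2 * wsum K (\<lambda>k. mean (S2 k)))"
      unfolding wsum_mult wsum_add mean_initial_S1 .
    have "(\<delta> / 2 - \<eta>) * wsum K (\<lambda>k. mean (err k)) \<le> mean (err 0) + wsum K (\<lambda>k. \<gamma>\<^sup>2 *
        ((8 * L / \<delta> + 4 * L) * Egap k + 4 / \<delta> * mean (S1 k) + 2 * mean (S2 k)))"
      by (rule weighted_contraction[where a="\<lambda>k. mean (err k)"
            and b="\<lambda>k. \<gamma>\<^sup>2 * ((8 * L / \<delta> + 4 * L) * Egap k + 4 / \<delta> * mean (S1 k) + 2 * mean (S2 k))"])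
         (rule eta_bounds nonneg expected_err)+
    then show "(\<delta> / 2 - \<eta>) * wsum K (\<lambda>k. mean (err k)) \<le> \<gamma>\<^sup>2 * ((8 * L / \<delta> + 4 * L) * wsum K Egap
        + 4 / \<delta> * wsum K (\<lambda>k. mean (S1 k)) + 2 * wsum K (\<lambda>k. mean (S2 k)))"
      unfolding wsum_mult wsum_add mean_initial_err by simp
  qed (rule L_pos gamma_pos compression alpha alpha_less_1 p eta_bounds \<eta>_\<delta> small
      wsum_nonneg Egap_nonneg nonneg sigma_nonneg)+
  finally show ?thesis .
qed

text \<open>The factor \<open>M2\<close> is such that the contraction of \<open>\<sigma>\<^sub>2\<^sup>2\<close> outweighs its contribution to the second
  moment of the direction: \<open>2 + M2 (1 - p) \<le> (1 - p / 4) M2\<close>.\<close>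

definition lyapunov :: "nat \<Rightarrow> real" where
  "lyapunov k = mean (\<lambda>s. (norm (virtual k s - xstar))\<^sup>2) + M2 * \<gamma>\<^sup>2 * mean (S2 k)"

text \<open>The gaps produced by the second moment and by the anchors add up to \<open>148 / 9 (\<gamma> L)\<close> times
  \<open>\<gamma>\<close> times the gap, and the bound \<open>9 / (296 L)\<close> on the step size makes this half of the descent.\<close>

lemma lyapunov_step:
  assumes \<gamma>: "\<gamma> \<le> 9 / (296 * L)"
  shows "lyapunov (Suc k)
    \<le> (1 - \<eta>) * lyapunov k + (- (\<gamma> / 2) * Egap k + 3 * L * \<gamma> * mean (\<lambda>s. (norm (ebar k s))\<^sup>2))"
proof -
  let ?r = "mean (\<lambda>s. (norm (virtual k s - xstar))\<^sup>2)" and ?s = "mean (S2 k)"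
    and ?q = "mean (\<lambda>s. (norm (ebar k s))\<^sup>2)"
  define c where "c = M2"
  have c: "c = 56 / (9 * p)" unfolding c_def by (simp add: field_simps)
  have lyapunov: "lyapunov k = mean (\<lambda>s. (norm (virtual k s - xstar))\<^sup>2) + c * \<gamma>\<^sup>2 * mean (S2 k)" for k
    unfolding lyapunov_def c_def ..
  have "0 \<le> ?r" by (intro integral_nonneg_AE AE_I2) simp
  then have r: "(1 - \<gamma> * \<mu> / 2) * ?r \<le> (1 - \<eta>) * ?r"
    using eta_bounds(3) by (intro mult_right_mono) auto
  have "0 \<le> ?s" by (intro integral_nonneg_AE AE_I2 sigma_nonneg)
  moreover have "2 + c * (1 - p) \<le> (1 - \<eta>) * c"
  proof -
    have "p * c = 56 / 9" using p unfolding c by simp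
    moreover have "\<eta> * c \<le> p / 4 * c"
      using eta_bounds(5) p by (intro mult_right_mono) (auto simp: c)
    ultimately have "2 + (c - p * c) \<le> c - \<eta> * c" by simp
    then show ?thesis by (simp add: left_diff_distrib right_diff_distrib mult.commute)
  qed
  ultimately have s: "(2 + c * (1 - p)) * (\<gamma>\<^sup>2 * ?s) \<le> (1 - \<eta>) * c * (\<gamma>\<^sup>2 * ?s)"
    by (intro mult_right_mono) auto
  have "\<gamma> * L \<le> 9 / 296" using \<gamma> L_pos by (simp add: field_simps)
  then have "148 / 9 * (\<gamma> * L) * (\<gamma> * Egap k) \<le> 1 / 2 * (\<gamma> * Egap k)"
    using gamma_pos Egap_nonneg[of k] by (intro mult_right_mono) auto
  moreover have "\<gamma>\<^sup>2 * (4 * L * Egap k) + c * \<gamma>\<^sup>2 * (2 * (L * p) * Egap k)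
      = 148 / 9 * (\<gamma> * L) * (\<gamma> * Egap k)"
    using p unfolding c by (simp add: power2_eq_square field_simps)
  ultimately have d: "\<gamma>\<^sup>2 * (4 * L * Egap k) + c * \<gamma>\<^sup>2 * (2 * (L * p) * Egap k)
      \<le> 1 / 2 * (\<gamma> * Egap k)" by simp
  have "c * \<gamma>\<^sup>2 * mean (S2 (Suc k)) \<le> c * \<gamma>\<^sup>2 * ((1 - p) * ?s + 2 * (L * p) * Egap k)"
    using p by (intro mult_left_mono expected_S2) (auto simp: c)
  then have "lyapunov (Suc k) \<le> (1 - \<gamma> * \<mu> / 2) * ?r - \<gamma> * Egap k + 3 * L * \<gamma> * ?q
      + \<gamma>\<^sup>2 * (4 * L * Egap k + 2 * ?s) + c * \<gamma>\<^sup>2 * ((1 - p) * ?s + 2 * (L * p) * Egap k)"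
    unfolding lyapunov using expected_virtual[of k] by linarith
  also have "\<dots> = (1 - \<gamma> * \<mu> / 2) * ?r + (2 + c * (1 - p)) * (\<gamma>\<^sup>2 * ?s)
      + (\<gamma>\<^sup>2 * (4 * L * Egap k) + c * \<gamma>\<^sup>2 * (2 * (L * p) * Egap k)) - \<gamma> * Egap k + 3 * L * \<gamma> * ?q"
    by (simp only: distrib_left distrib_right) (simp add: mult_ac)
  also have "\<dots> \<le> (1 - \<eta>) * ?r + (1 - \<eta>) * c * (\<gamma>\<^sup>2 * ?s)
      + 1 / 2 * (\<gamma> * Egap k) - \<gamma> * Egap k + 3 * L * \<gamma> * ?q"
    using r s d by linarith
  also have "\<dots> = (1 - \<eta>) * lyapunov k + (- (\<gamma> / 2) * Egap k + 3 * L * \<gamma> * ?q)"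
    unfolding lyapunov by (simp only: distrib_left)
  finally show ?thesis .
qed

text \<open>The descent leaves half of the accumulated gap, and the compression error consumes half of that.\<close>

lemma total_gap:
  assumes "\<gamma> \<le> 9 / (296 * L)" and small: "\<gamma> * L \<le> \<delta> / 72"
  shows "\<gamma> / 4 * wsum K Egap
    \<le> (norm (x0 - xstar))\<^sup>2 + M2 * \<gamma>\<^sup>2 * S20 + \<gamma> * F1 * S10 + \<gamma> * F2 * S20"
proof -
  let ?Q = "wsum K (\<lambda>k. mean (\<lambda>s. (norm (ebar k s))\<^sup>2))"
  have nonneg: "0 \<le> lyapunov k" for k
    unfolding lyapunov_def using p
    by (intro add_nonneg_nonneg mult_nonneg_nonneg integral_nonneg_AE AE_I2 sigma_nonneg) auto
  have "mean (\<lambda>s. (norm (virtual 0 s - xstar))\<^sup>2) = (norm (x0 - xstar))\<^sup>2"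
    by (rule mean_constant) (simp add: initial_ebar x_init)
  then have init: "lyapunov 0 = (norm (x0 - xstar))\<^sup>2 + M2 * \<gamma>\<^sup>2 * S20"
    unfolding lyapunov_def mean_initial_S2 by simp
  have "(\<eta> - \<eta>) * wsum K lyapunov \<le> lyapunov 0 + wsum K (\<lambda>k. - (\<gamma> / 2) * Egap k
      + 3 * L * \<gamma> * mean (\<lambda>s. (norm (ebar k s))\<^sup>2))"
    by (rule weighted_contraction[where a=lyapunov and b="\<lambda>k. - (\<gamma> / 2) * Egap k
            + 3 * L * \<gamma> * mean (\<lambda>s. (norm (ebar k s))\<^sup>2)"])
       (rule eta_bounds nonneg lyapunov_step[OF assms(1)])+
  then have "\<gamma> / 2 * wsum K Egap \<le> lyapunov 0 + \<gamma> * (3 * L * ?Q)"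
    unfolding wsum_add wsum_mult by (simp add: mult_ac)
  also have "\<dots> \<le> lyapunov 0 + \<gamma> * (1 / 4 * wsum K Egap + F1 * S10 + F2 * S20)"
    using gamma_pos by (intro add_left_mono mult_left_mono compensation_error small) simp
  also have "\<dots> = lyapunov 0 + (\<gamma> / 4 * wsum K Egap + \<gamma> * F1 * S10 + \<gamma> * F2 * S20)"
    by (simp only: distrib_left)
  finally show ?thesis unfolding init by linarith
qed

abbreviation "xbar K s \<equiv> (1 / weight_sum \<eta> K) *\<^sub>R (\<Sum>k=0..K. weight \<eta> k *\<^sub>R x k s)"

lemma weight_sum_pos: "0 < weight_sum \<eta> K"
  unfolding weight_sum_def using weight_pos[OF eta_bounds(2)] by (intro sum_pos) auto

text \<open>Jensen's inequality for the convex function \<open>f\<close> and the normalized weights.\<close>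

lemma gap_xbar_le: "gap (xbar K s) \<le> 1 / weight_sum \<eta> K * wsum K (\<lambda>k. gap (x k s))"
proof -
  let ?c = "\<lambda>k. weight \<eta> k / weight_sum \<eta> K"
  have c: "(\<Sum>k=0..K. ?c k) = 1"
    using weight_sum_pos[of K] unfolding sum_divide_distrib[symmetric] weight_sum_def by simp
  have "f (\<Sum>k=0..K. ?c k *\<^sub>R x k s) \<le> (\<Sum>k=0..K. ?c k * f (x k s))"
    using weight_pos[OF eta_bounds(2)] weight_sum_pos[of K]
    by (intro convex_on_sum[OF _ _ convex_objective c]) (auto intro: divide_nonneg_nonneg less_imp_le)
  moreover have "(\<Sum>k=0..K. ?c k *\<^sub>R x k s) = xbar K s"
    by (simp add: scaleR_sum_right)
  ultimately have "f (xbar K s) \<le> (\<Sum>k=0..K. ?c k * f (x k s))" by (simp only:)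
  then have "gap (xbar K s) \<le> (\<Sum>k=0..K. ?c k * f (x k s)) - f xstar"
    by (rule diff_right_mono)
  also have "\<dots> = (\<Sum>k=0..K. ?c k * gap (x k s))"
    using c by (simp only: right_diff_distrib sum_subtractf sum_distrib_right[symmetric] mult_1)
  also have "\<dots> = 1 / weight_sum \<eta> K * wsum K (\<lambda>k. gap (x k s))"
    by (simp add: sum_distrib_left)
  finally show ?thesis .
qed

lemma gap_xbar:
  shows "integrable M (\<lambda>s. gap (xbar K s))"
    and "mean (\<lambda>s. gap (xbar K s)) \<le> 1 / weight_sum \<eta> K * wsum K Egap"
proof -
  let ?b = "\<lambda>s. 1 / weight_sum \<eta> K * wsum K (\<lambda>k. gap (x k s))"
  have b: "integrable M ?b"
    by (intro integrable_mult_right Bochner_Integration.integrable_sum integrable_gap)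
  have xbar: "xbar K \<in> borel_measurable M"
    by (intro borel_measurable_scaleR borel_measurable_sum borel_measurable_const
        history_to_M[OF adapted_measurable(1)])
  have "(\<lambda>s. f (xbar K s)) \<in> borel_measurable M"
    by (rule measurable_compose[OF xbar f_measurable])
  then have "(\<lambda>s. f (xbar K s) - f xstar) \<in> borel_measurable M"
    by (rule borel_measurable_diff) simp
  then show int: "integrable M (\<lambda>s. gap (xbar K s))"
  proof (rule Bochner_Integration.integrable_bound[OF b])
    show "AE s in M. norm (gap (xbar K s)) \<le> norm (?b s)"
    proof (rule AE_I2)
      fix s
      have "0 \<le> gap (xbar K s)" by (rule gap_nonneg)
      then show "norm (gap (xbar K s)) \<le> norm (?b s)"
        using order_trans[OF gap_xbar_le abs_ge_self] by (simp only: real_norm_def abs_of_nonneg)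
    qed
  qed
  have "mean (\<lambda>s. gap (xbar K s)) \<le> mean ?b"
    by (rule integral_mono[OF int b gap_xbar_le])
  also have "mean ?b = 1 / weight_sum \<eta> K * mean (\<lambda>s. wsum K (\<lambda>k. gap (x k s)))"
    by (rule Bochner_Integration.integral_mult_right)
       (intro integrable_mult_right Bochner_Integration.integrable_sum integrable_gap)
  also have "mean (\<lambda>s. wsum K (\<lambda>k. gap (x k s))) = (\<Sum>k=0..K. mean (\<lambda>s. weight \<eta> k * gap (x k s)))"
    by (rule Bochner_Integration.integral_sum) (intro integrable_mult_right integrable_gap)
  also have "\<dots> = wsum K Egap"
    by (intro sum.cong refl Bochner_Integration.integral_mult_right integrable_gap)
  finally show "mean (\<lambda>s. gap (xbar K s)) \<le> 1 / weight_sum \<eta> K * wsum K Egap" .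
qed

lemma convergence:
  assumes "\<gamma> \<le> 9 / (296 * L)" and "\<gamma> * L \<le> \<delta> / 72"
    and c: "0 < c" "c \<le> weight_sum \<eta> K"
  shows "mean (\<lambda>s. gap (xbar K s))
    \<le> 4 * ((norm (x0 - xstar))\<^sup>2 + M2 * \<gamma>\<^sup>2 * S20 + \<gamma> * F1 * S10 + \<gamma> * F2 * S20) / (c * \<gamma>)"
proof -
  define B where "B = (norm (x0 - xstar))\<^sup>2 + M2 * \<gamma>\<^sup>2 * S20 + \<gamma> * F1 * S10 + \<gamma> * F2 * S20"
  define W where "W = wsum K Egap"
  have "\<gamma> / 4 * W \<le> B" unfolding B_def W_def by (rule total_gap[OF assms(1,2)])
  then have B: "W \<le> 4 * B / \<gamma>" using gamma_pos by (simp add: field_simps)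
  have W: "0 \<le> W" unfolding W_def by (intro wsum_nonneg Egap_nonneg)
  have "mean (\<lambda>s. gap (xbar K s)) \<le> 1 / weight_sum \<eta> K * W"
    unfolding W_def by (rule gap_xbar(2))
  also have "\<dots> \<le> 1 / c * W"
    using c W by (intro mult_right_mono frac_le) auto
  also have "\<dots> \<le> 1 / c * (4 * B / \<gamma>)"
    using c by (intro mult_left_mono B) simp
  also have "\<dots> = 4 * B / (c * \<gamma>)" by simp
  finally show ?thesis unfolding B_def .
qed

lemma parametric_assumption_holds:
  assumes small: "\<gamma> * L \<le> \<delta> / 72"
  shows "parametric_assumption M \<F> n f xstar L \<mu> \<gamma> x g e S1 S2
     \<lparr> cA = 2 * L, cB1 = 2, cB2 = 0, cD1 = 0,
       cAt = 3 * L, cB1t = 3, cB2t = 3, cD1t = 0,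
       cA' = 2 * L, cB1' = 0, cB2' = 2, cD1' = 0,
       c\<rho>1 = \<alpha>, cC1 = 3 * L * \<alpha>, cG = 2, cD2 = 0,
       c\<rho>2 = p, cC2 = L * p, cF1 = F1, cF2 = F2, cD3 = 0 \<rparr>"
  unfolding parametric_assumption_def Let_def parametric_constants.simps
proof (intro conjI allI ballI)
  have pos: "0 \<le> L * gap (x k s)" "0 \<le> S1 k s" "0 \<le> S2 k s" for k s
    using gap_nonneg L_pos sigma_nonneg by auto
  show "integrable M (g k i)" if "i \<in> {1..n}" for k i
    by (rule square_integrable_integrable[OF M.finite_measure_axioms square_integrable_state(5)[OF that]])
  show "integrable M (\<lambda>s. (norm (g k i s - vec_cond_exp M (\<F> k) (g k i) s))\<^sup>2)"
    if "i \<in> {1..n}" for k i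
    by (rule cond_variance(1)[OF that])
  show "integrable M (\<lambda>s. (norm (avg n (\<lambda>i. g k i s)))\<^sup>2)"
    "integrable M (\<lambda>s. (norm (ebar k s))\<^sup>2)" for k
    using square_integrable_average_direction square_integrable_ebar
    unfolding square_integrable_def by auto
  show "integrable M (\<lambda>s. f (x k s))" "integrable M (S1 k)" "integrable M (S2 k)" for k
    by (rule integrable_objective integrable_S1 integrable_S2)+
  show "AE s in M. vec_cond_exp M (\<F> k) (\<lambda>s. avg n (\<lambda>i. g k i s)) s = grad f (x k s)" for k
    by (rule cond_average_direction)
  show "AE s in M. avg n (\<lambda>i. (norm (vec_cond_exp M (\<F> k) (g k i) s))\<^sup>2)
      \<le> 2 * (2 * L) * gap (x k s) + 2 * S1 k s + 0 * S2 k s + 0" for k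
    using cond_mean_sq_le[of k] by eventually_elim simp
  show "AE s in M. avg n (\<lambda>i. real_cond_exp M (\<F> k)
        (\<lambda>s. (norm (g k i s - vec_cond_exp M (\<F> k) (g k i) s))\<^sup>2) s)
      \<le> 2 * (3 * L) * gap (x k s) + 3 * S1 k s + 3 * S2 k s + 0" for k
    using cond_variance(2)[of k]
  proof eventually_elim
    case (elim s)
    have "4 * L * gap (x k s) = 4 * (L * gap (x k s))"
      "2 * (3 * L) * gap (x k s) = 6 * (L * gap (x k s))" by simp_all
    with elim pos[of k s] show ?case by linarith
  qed
  show "AE s in M. real_cond_exp M (\<F> k) (\<lambda>s. (norm (avg n (\<lambda>i. g k i s)))\<^sup>2) s
      \<le> 2 * (2 * L) * gap (x k s) + 0 * S1 k s + 2 * S2 k s + 0" for k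
    using cond_second_moment[of k] by eventually_elim simp
  show "AE s in M. real_cond_exp M (\<F> k) (S1 (Suc k)) s
      \<le> (1 - \<alpha>) * S1 k s + 2 * (3 * L * \<alpha>) * gap (x k s) + 2 * \<alpha> * S2 k s + 0" for k
    using cond_S1[of k]
  proof eventually_elim
    case (elim s)
    have "\<alpha> * (4 * L * gap (x k s) + 2 * S2 k s) = 4 * (\<alpha> * (L * gap (x k s))) + 2 * \<alpha> * S2 k s"
      "2 * (3 * L * \<alpha>) * gap (x k s) = 6 * (\<alpha> * (L * gap (x k s)))"
      by (simp_all add: distrib_left)
    moreover have "0 \<le> \<alpha> * (L * gap (x k s))" using alpha(1) pos by simp
    ultimately show ?case using elim by linarith
  qed
  show "AE s in M. real_cond_exp M (\<F> k) (S2 (Suc k)) s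
      \<le> (1 - p) * S2 k s + 2 * (L * p) * gap (x k s)" for k
    by (rule cond_S2)
  show "AE s in M. 3 * L * wsum K (\<lambda>k. mean (\<lambda>s. (norm (ebar k s))\<^sup>2))
      \<le> 1 / 4 * wsum K Egap + F1 * S1 0 s + F2 * S2 0 s + \<gamma> * 0 * weight_sum \<eta> K" for K
    using compensation_error[OF small, of K] by (intro AE_I2) (simp add: initial_S1 initial_S2)
qed

end

section \<open>Convergence of EC-LSVRG-DIANA\<close>

theorem theoremJ8:
  fixes n m :: nat
    and fs :: "nat \<Rightarrow> nat \<Rightarrow> real ^ 'd \<Rightarrow> real"
    and xstar :: "real ^ 'd"
    and L \<mu> \<delta> \<omega> p \<alpha> \<gamma> :: real
    and CS :: "'c measure" and C :: "'c \<Rightarrow> real ^ 'd \<Rightarrow> real ^ 'd"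
    and QS :: "'q measure" and Q :: "'q \<Rightarrow> real ^ 'd \<Rightarrow> real ^ 'd"
    and M :: "'o measure"
    and idx :: "nat \<Rightarrow> nat \<Rightarrow> 'o \<Rightarrow> nat"
    and coin :: "nat \<Rightarrow> nat \<Rightarrow> 'o \<Rightarrow> bool"
    and cseed :: "nat \<Rightarrow> nat \<Rightarrow> 'o \<Rightarrow> 'c"
    and qseed :: "nat \<Rightarrow> nat \<Rightarrow> 'o \<Rightarrow> 'q"
    and draw :: "nat \<Rightarrow> nat \<Rightarrow> 'o \<Rightarrow> nat \<times> bool \<times> 'c \<times> 'q"
    and x0 :: "real ^ 'd" and h0 w0 :: "nat \<Rightarrow> real ^ 'd"
    and x :: "nat \<Rightarrow> 'o \<Rightarrow> real ^ 'd"
    and w h e ghat g v :: "nat \<Rightarrow> nat \<Rightarrow> 'o \<Rightarrow> real ^ 'd"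
  assumes n_pos: "n \<ge> 1" and m_pos: "m \<ge> 1" and L_pos: "L > 0"
    and convex: "\<And>i j. i \<in> {1..n} \<Longrightarrow> j \<in> {1..m} \<Longrightarrow> convex_on UNIV (fs i j)"
    and smooth: "\<And>i j. i \<in> {1..n} \<Longrightarrow> j \<in> {1..m} \<Longrightarrow> smooth L (fs i j)"
    and mu: "\<mu> \<ge> 0"
    and qsc: "quasi_strongly_convex \<mu> (objective n m fs)"
    and xstar: "is_arg_min (objective n m fs) (\<lambda>_. True) xstar"
    and compression: "0 < \<delta>" "\<delta> \<le> 1" "compression_operator \<delta> CS C"
    and quantization: "\<omega> > 0" "quantization_operator \<omega> QS Q"
    and p: "0 < p" "p < 1"
    and alpha: "0 < \<alpha>" "\<alpha> \<le> 1 / (\<omega> + 1)"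
    and gamma: "0 < \<gamma>"
      "\<gamma> \<le> min (9 / (296 * L))
             (\<delta> / (4 * L * sqrt (6 * (4 + 3 * \<delta>
                    + 2 / (1 - \<alpha>) * (3 + 4 / (1 - p)) * (4 + 3 * \<delta>)
                    + 6 * \<delta> / (1 - p)))))"
    and prob: "prob_space M"
    and draw: "\<And>k i s. draw k i s = (idx k i s, coin k i s, cseed k i s, qseed k i s)"
    and draw_law: "\<And>k i. i \<in> {1..n} \<Longrightarrow>
           distr M (draw_law m p CS QS) (draw k i) = draw_law m p CS QS"
    and draw_indep: "prob_space.indep_vars M (\<lambda>_. draw_law m p CS QS)
           (\<lambda>(k, i). draw k i) (UNIV \<times> {1..n})"
    and idx_range: "\<And>k i s. i \<in> {1..n} \<Longrightarrow> s \<in> space M \<Longrightarrow> idx k i s \<in> {1..m}"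
    and x_init: "\<And>s. s \<in> space M \<Longrightarrow> x 0 s = x0"
    and h_init: "\<And>i s. i \<in> {1..n} \<Longrightarrow> s \<in> space M \<Longrightarrow> h 0 i s = h0 i"
    and w_init: "\<And>i s. i \<in> {1..n} \<Longrightarrow> s \<in> space M \<Longrightarrow> w 0 i s = w0 i"
    and e_init: "\<And>i s. i \<in> {1..n} \<Longrightarrow> s \<in> space M \<Longrightarrow> e 0 i s = 0"
    and ghat_step: "\<And>k i s. i \<in> {1..n} \<Longrightarrow> s \<in> space M \<Longrightarrow>
           ghat k i s = grad (fs i (idx k i s)) (x k s) - grad (fs i (idx k i s)) (w k i s)
                          + grad (worker_obj m fs i) (w k i s)"
    and g_step: "\<And>k i s. i \<in> {1..n} \<Longrightarrow> s \<in> space M \<Longrightarrow>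
           g k i s = ghat k i s - h k i s + avg n (\<lambda>i'. h k i' s)"
    and v_step: "\<And>k i s. i \<in> {1..n} \<Longrightarrow> s \<in> space M \<Longrightarrow>
           v k i s = C (cseed k i s) (e k i s + \<gamma> *\<^sub>R g k i s)"
    and e_step: "\<And>k i s. i \<in> {1..n} \<Longrightarrow> s \<in> space M \<Longrightarrow>
           e (Suc k) i s = e k i s + \<gamma> *\<^sub>R g k i s - v k i s"
    and h_step: "\<And>k i s. i \<in> {1..n} \<Longrightarrow> s \<in> space M \<Longrightarrow>
           h (Suc k) i s = h k i s + \<alpha> *\<^sub>R Q (qseed k i s) (ghat k i s - h k i s)"
    and w_step: "\<And>k i s. i \<in> {1..n} \<Longrightarrow> s \<in> space M \<Longrightarrow>
           w (Suc k) i s = (if coin k i s then x k s else w k i s)"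
    and x_step: "\<And>k s. s \<in> space M \<Longrightarrow> x (Suc k) s = x k s - avg n (\<lambda>i. v k i s)"
  shows "let f = objective n m fs;
             \<eta> = min (\<gamma> * \<mu> / 2) (min (\<alpha> / 4) (p / 4));
             F1 = 24 * L * \<gamma>\<^sup>2 * (4 / \<delta> + 3) / (\<delta> * \<alpha> * (1 - \<eta>));
             F2 = 24 * L * \<gamma>\<^sup>2 * (4 / (1 - \<alpha>) * (4 / \<delta> + 3) + 3) / (\<delta> * p * (1 - \<eta>));
             M1 = 0;
             M2 = 8 / (3 * p) + 32 / (9 * p);
             S10 = sigma1_sq n m fs xstar h0;
             S20 = sigma2_sq n m fs xstar w0;
             T0 = (norm (x0 - xstar))\<^sup>2 + M1 * \<gamma>\<^sup>2 * S10 + M2 * \<gamma>\<^sup>2 * S20;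
             xbar = (\<lambda>K s. (1 / weight_sum \<eta> K) *\<^sub>R (\<Sum>k=0..K. weight \<eta> k *\<^sub>R x k s))
         in
           parametric_assumption M (history M (draw_law m p CS QS) n draw) n f xstar L \<mu> \<gamma> x g e
             (\<lambda>k s. sigma1_sq n m fs xstar (\<lambda>i. h k i s))
             (\<lambda>k s. sigma2_sq n m fs xstar (\<lambda>i. w k i s))
             \<lparr> cA = 2 * L, cB1 = 2, cB2 = 0, cD1 = 0,
               cAt = 3 * L, cB1t = 3, cB2t = 3, cD1t = 0,
               cA' = 2 * L, cB1' = 0, cB2' = 2, cD1' = 0,
               c\<rho>1 = \<alpha>, cC1 = 3 * L * \<alpha>, cG = 2, cD2 = 0,
               c\<rho>2 = p, cC2 = L * p,
               cF1 = F1, cF2 = F2, cD3 = 0 \<rparr> \<and>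
           (\<forall>K. integrable M (\<lambda>s. f (xbar K s) - f xstar)) \<and>
           (\<mu> > 0 \<longrightarrow> (\<forall>K.
              (\<integral>s. (f (xbar K s) - f xstar) \<partial>M)
                \<le> (1 - \<eta>) ^ K * (4 * (T0 + \<gamma> * F1 * S10 + \<gamma> * F2 * S20) / \<gamma>))) \<and>
           (\<mu> = 0 \<longrightarrow> (\<forall>K\<ge>1.
              (\<integral>s. (f (xbar K s) - f xstar) \<partial>M)
                \<le> 4 * (T0 + \<gamma> * F1 * S10 + \<gamma> * F2 * S20) / (real K * \<gamma>)))"
proof -
  have index_range: "draw_index (draw k i s) \<in> {1..m}" if "i \<in> {1..n}" "s \<in> space M" for k i s
    using idx_range[OF that] by (simp add: draw)
  interpret problem: finite_sum_problem n m fs xstar L \<mu>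
    by (rule finite_sum_problem.intro[OF n_pos m_pos L_pos convex smooth mu qsc xstar])
  \<comment> \<open>the index lies in range, where the clipped gradient is the gradient of the component\<close>
  have ghat_eq: "ghat k i s = problem.estimator i (draw_index (draw k i s)) (x k s) (w k i s)"
    if "i \<in> {1..n}" "s \<in> space M" for k i s
    using ghat_step[OF that] idx_range[OF that]
    by (simp add: problem.estimator_def problem.comp_grad_def draw)
  interpret algorithm: ec_lsvrg_diana n m fs xstar L \<mu> \<delta> \<omega> p \<alpha> \<gamma> CS C QS Q M draw x0 h0 w0 x w h e g
  proof (rule ec_lsvrg_diana.intro[OF problem.finite_sum_problem_axioms],
      rule ec_lsvrg_diana_axioms.intro)
    show "g k i s = problem.estimator i (draw_index (draw k i s)) (x k s) (w k i s)
        - h k i s + avg n (\<lambda>i'. h k i' s)" if "i \<in> {1..n}" "s \<in> space M" for k i s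
      using g_step[OF that] ghat_eq[OF that] by simp
    show "e (Suc k) i s = e k i s + \<gamma> *\<^sub>R g k i s
        - C (draw_cseed (draw k i s)) (e k i s + \<gamma> *\<^sub>R g k i s)"
      if "i \<in> {1..n}" "s \<in> space M" for k i s
      using e_step[OF that] v_step[OF that] by (simp add: draw)
    show "h (Suc k) i s = h k i s + \<alpha> *\<^sub>R Q (draw_qseed (draw k i s))
        (problem.estimator i (draw_index (draw k i s)) (x k s) (w k i s) - h k i s)"
      if "i \<in> {1..n}" "s \<in> space M" for k i s
      using h_step[OF that] ghat_eq[OF that] by (simp add: draw)
    show "w (Suc k) i s = (if draw_coin (draw k i s) then x k s else w k i s)"
      if "i \<in> {1..n}" "s \<in> space M" for k i s
      using w_step[OF that] by (simp add: draw)
    show "x (Suc k) s = x k s - avg n (\<lambda>i. e k i s + \<gamma> *\<^sub>R g k i s - e (Suc k) i s)"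
      if s: "s \<in> space M" for k s
    proof -
      have "avg n (\<lambda>i. v k i s) = avg n (\<lambda>i. e k i s + \<gamma> *\<^sub>R g k i s - e (Suc k) i s)"
        by (rule avg_cong) (simp add: e_step[OF _ s])
      then show ?thesis using x_step[OF s] by simp
    qed
  qed (fact compression quantization p alpha gamma prob draw_law draw_indep index_range
      x_init h_init w_init e_init)+
  have \<gamma>_le: "\<gamma> \<le> 9 / (296 * L)" using gamma(2) by simp
  have small: "\<gamma> * L \<le> \<delta> / 72"
    by (rule step_size_bound[OF L_pos compression(1) alpha(1) algorithm.alpha_less_1 p])
       (use gamma(2) in simp)
  show ?thesis
    \<comment> \<open>the term of \<open>T0\<close> with \<open>M1 = 0\<close> disappears\<close>
    unfolding Let_def mult_zero_left add_0_right
  proof (intro conjI allI impI)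
    fix K :: nat
    let ?B = "(norm (x0 - xstar))\<^sup>2 + algorithm.M2 * \<gamma>\<^sup>2 * algorithm.S20
      + \<gamma> * algorithm.F1 * algorithm.S10 + \<gamma> * algorithm.F2 * algorithm.S20"
    have "1 / (1 - algorithm.\<eta>) ^ K \<le> weight_sum algorithm.\<eta> K"
      by (rule weight_sum_ge_power[OF algorithm.eta_bounds(1,2)])
    moreover have "0 < 1 / (1 - algorithm.\<eta>) ^ K"
      using algorithm.eta_bounds(2) by (intro divide_pos_pos zero_less_power) auto
    ultimately have "algorithm.mean (\<lambda>s. problem.gap (algorithm.xbar K s))
        \<le> 4 * ?B / (1 / (1 - algorithm.\<eta>) ^ K * \<gamma>)"
      by (intro algorithm.convergence \<gamma>_le small)
    also have "\<dots> = (1 - algorithm.\<eta>) ^ K * (4 * ?B / \<gamma>)"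
      by (simp only: divide_divide_eq_right times_divide_eq_left times_divide_eq_right mult_1
          mult.commute)
    finally show "algorithm.mean (\<lambda>s. problem.gap (algorithm.xbar K s))
        \<le> (1 - algorithm.\<eta>) ^ K * (4 * ?B / \<gamma>)" .
  next
    fix K :: nat
    \<comment> \<open>here all weights equal one, and \<open>weight_sum\<close> counts them\<close>
    assume "\<mu> = 0" and K: "1 \<le> K"
    then have "algorithm.\<eta> = 0" using alpha(1) p(1) by simp
    then have "real K \<le> weight_sum algorithm.\<eta> K" by (simp only: weight_sum_zero)
    then show "algorithm.mean (\<lambda>s. problem.gap (algorithm.xbar K s))
        \<le> 4 * ((norm (x0 - xstar))\<^sup>2 + algorithm.M2 * \<gamma>\<^sup>2 * algorithm.S20
          + \<gamma> * algorithm.F1 * algorithm.S10 + \<gamma> * algorithm.F2 * algorithm.S20) / (real K * \<gamma>)"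
      using K by (intro algorithm.convergence \<gamma>_le small) auto
  qed (rule algorithm.parametric_assumption_holds[OF small] algorithm.gap_xbar(1))+
qed

end
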